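(* Let $V$ be a $\mathbb{Q}$-vector space of finite dimension $n$ with a fixed lattice $L\subset V$, let $p$ be a prime, and let $f'\in\mathcal{S}(V^{(p)})$ be a test function away from $p$. Let $C\subset V_{\mathbb{R}}$ be a pointed rational simplicial cone with extremal rays generated by $v_1,\dots,v_r\in V$. If $f'$ satisfies the Vanishing Hypothesis for each of $v_1,\dots,v_r$, then the pseudo-measure $\mu_{f',C}=\mu_{f',C,L_p}\in\widetilde{\mathcal{M}}(L_p)$ is a measure, i.e. it lies in the image of $\mathcal{M}(L_p)$ in $\widetilde{\mathcal{M}}(L_p)$.
   Context: Notation. $V_\ell=V\otimes_{\mathbb{Q}}\mathbb{Q}_\ell$, $L_\ell=L\otimes_{\mathbb{Z}}\mathbb{Z}_\ell$, $V_{\mathbb{R}}=V\otimes_{\mathbb{Q}}\mathbb{R}$. $[U]$ denotes the characteristic function of a set $U$. Test functions. $\mathcal{S}(V_\ell)$ is the group of locally constant, compactly supported functions $V_\ell\to\mathbb{Z}$. $\mathcal{S}(V)=\bigotimes'_{\ell}\mathcal{S}(V_\ell)$ (all primes $\ell$) and $\mathcal{S}(V^{(p)})=\bigotimes'_{\ell\ne p}\mathcal{S}(V_\ell)$ are restricted tensor products over $\mathbb{Z}$ with respect to the functions $[L_\ell]$; they are the $\mathbb{Z}$-valued Bruhat–Schwartz functions on the finite adeles of $V$, respectively on the finite adeles of $V$ away from $p$. Elements of $\mathcal S(V)$ are identified with functions $V\to\mathbb{Z}$ via the diagonal embedding; each is a finite $\mathbb{Z}$-linear combination of characteristic functions of affine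 lattices. For $V=\mathbb{Q}$ one takes $L=\mathbb{Z}$. For $f'\in\mathcal{S}(V^{(p)})$ and $U\subset V_p$ compact open, $f'\otimes[U]\in\mathcal{S}(V)$. Haar measure. For $g\in\mathcal{S}(\mathbb{Q})$ periodic under a lattice $L_g\subset\mathbb{Z}$, $h_{\mathbb{Q}}(g)=\frac{1}{[\mathbb{Z}:L_g]}\sum_{x\in\mathbb{Q}/L_g}g(x)$. For $g'\in\mathcal{S}(\mathbb{Q}^{(p)})$, $h^{(p)}(g')=h_{\mathbb{Q}}(g'\otimes[\mathbb{Z}_p])$. Vanishing Hypothesis. For $v,w\in V$ with $w\neq 0$, $\pi_{v,w}:\mathcal{S}(V^{(p)})\to\mathcal{S}(\mathbb{Q}^{(p)})$ is $(\pi_{v,w}f')(x)=f'(v+xw)$. The function $f'$ satisfies the Vanishing Hypothesis for $w$ if $h^{(p)}(\pi_{v,w}f')=0$ for all $v\in V$. Cones. For linearly independent $u_1,\dots,u_d\in V$, the rational open cone is $C^o(u_1,\dots,u_d)=\{\sum a_iu_i: a_i\in\mathbb{R}, a_i>0\}$ (for $d=0$ it is $\{0\}$). Its extremal rays are the rays through the $u_i$. A rational simplicial cone is a finite union of rational open cones (glued along boundaries), which may be taken disjoint. It is pointed if it contains no line. That $C$ has extremal rays $v_1,\dots,v_r$ means that $C$ is a finite disjoint union of open cones, each generated by a linearly independent subset of $\{v_1,\dots,v_r\}$. Measures. $\mathcal{M}(L_p)$ is the space of continuous linear functionals $\mathcal{C}(L_p)\to\mathbb{Q}_p$, where $\mathcal{C}(L_p)$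 is the Banach space (sup norm) of continuous functions $L_p\to\mathbb{Q}_p$. It is a commutative ring under convolution $(\mu*\nu)(f)=\int\int f(v+w)\,d\nu(w)\,d\mu(v)$. $\delta_v$ is the Dirac measure at $v$, with $\delta_0$ the unit. The ring of pseudo-measures is $\widetilde{\mathcal{M}}(L_p)=S^{-1}\mathcal{M}(L_p)$, where $S$ is the multiplicative set generated by $\{\delta_0-\delta_v: v\in L_p, v\ne0\}$. The natural map $\mathcal{M}(L_p)\to\widetilde{\mathcal{M}}(L_p)$ is injective. The pseudo-measure $\mu_{f',C,U}$. Let $U\subset L_p$ be compact open and $f=f'\otimes[U]$. For a rational open cone $C=C^o(u_1,\dots,u_d)$ choose positive rationals $a_i$ such that $a_iu_i\in L_p$ and $f$ is invariant under translation by each $a_iu_i$. Let $\mathcal{P}=\{\sum\lambda_iu_i:\lambda_i\in\mathbb{Q},\ 0<\lambda_i\le a_i\}$ and put $$\mu_{f',C,U}=\prod_{i=1}^d\frac{1}{\delta_0-\delta_{a_iu_i}}*\sum_{v\in\mathcal{P}}f(v)\delta_v\in\widetilde{\mathcal{M}}(L_p)$$ (a finite sum). This is independent of choices and represents the formal sum $\sum_{v\in C\cap V}f(v)\delta_v$. It is extended additively to finite disjoint unions of open cones. Write $\mu_{f',C}=\mu_{f',C,L_p}$. *)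

theory Defs
  imports "HOL-Analysis.Analysis" "HOL-Algebra.QuotRing"
begin

section \<open>The fields \<open>\<rat>\<^sub>q\<close>\<close>

text \<open>
  All primes \<open>q\<close> occur at once, so \<open>\<rat>\<^sub>q\<close> is not a type but a ring in the sense of HOL-Algebra,
  depending on \<open>q\<close>: the ring of \<open>q\<close>-adic Cauchy sequences of rationals modulo null sequences.
\<close>

definition padic_abs :: "nat \<Rightarrow> rat \<Rightarrow> real" where
  "padic_abs q x =
     (if x = 0 then 0
      else real q powi (int (multiplicity (int q) (snd (quotient_of x)))
                       - int (multiplicity (int q) (fst (quotient_of x)))))"

definition padic_cauchy :: "nat \<Rightarrow> (nat \<Rightarrow> rat) \<Rightarrow> bool" where
  "padic_cauchy q X \<longleftrightarrow> (\<forall>e>0. \<exists>N. \<forall>m\<ge>N. \<forall>n\<ge>N. padic_abs q (X m - X n) < e)"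

definition cauchy_ring :: "nat \<Rightarrow> (nat \<Rightarrow> rat) ring" where
  "cauchy_ring q =
     \<lparr>carrier = {X. padic_cauchy q X}, mult = (\<lambda>X Y n. X n * Y n), one = (\<lambda>_. 1),
      zero = (\<lambda>_. 0), add = (\<lambda>X Y n. X n + Y n)\<rparr>"

definition null_seqs :: "nat \<Rightarrow> (nat \<Rightarrow> rat) set" where
  "null_seqs q = {X. (\<lambda>n. padic_abs q (X n)) \<longlonglongrightarrow> 0}"

type_synonym qp = "(nat \<Rightarrow> rat) set"

definition Qp :: "nat \<Rightarrow> qp ring" where
  "Qp q = cauchy_ring q Quot null_seqs q"

definition qp_of_rat :: "nat \<Rightarrow> rat \<Rightarrow> qp" where
  "qp_of_rat q x = null_seqs q +>\<^bsub>cauchy_ring q\<^esub> (\<lambda>_. x)"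

definition qp_norm :: "nat \<Rightarrow> qp \<Rightarrow> real" where
  "qp_norm q \<xi> = (THE r. \<forall>X\<in>\<xi>. (\<lambda>n. padic_abs q (X n)) \<longlonglongrightarrow> r)"

definition Zp :: "nat \<Rightarrow> qp set" where
  "Zp q = {\<xi> \<in> carrier (Qp q). qp_norm q \<xi> \<le> 1}"

text \<open>The type of metrics requires the distance function to be symmetric and nonnegative also off
  the carrier.\<close>

definition qp_dist :: "nat \<Rightarrow> qp \<Rightarrow> qp \<Rightarrow> real" where
  "qp_dist q x y =
     (if x \<in> carrier (Qp q) \<and> y \<in> carrier (Qp q) then qp_norm q (x \<ominus>\<^bsub>Qp q\<^esub> y) else 0)"

definition qp_metric :: "nat \<Rightarrow> qp metric" where
  "qp_metric q = metric (carrier (Qp q), qp_dist q)"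

subsection \<open>\<open>\<rat>\<^sub>q\<close> is a commutative ring and a metric space\<close>

lemma padic_abs_frac:
  assumes "prime q" "a \<noteq> 0" "b \<noteq> 0"
  shows "padic_abs q (of_int a / of_int b) = real q powi (int (multiplicity (int q) b) - int (multiplicity (int q) a))"
proof -
  let ?x = "of_int a / of_int b :: rat"
  obtain n d where nd: "quotient_of ?x = (n, d)" by fastforce
  have x: "?x = of_int n / of_int d" and d: "d > 0"
    using nd quotient_of_div quotient_of_denom_pos by blast+
  have n0: "n \<noteq> 0" using x assms by auto
  have "of_int (a * d) = (of_int (n * b) :: rat)"
    using x assms d by (simp add: field_simps)
  then have e: "a * d = n * b" by (simp only: of_int_eq_iff)
  have P: "prime_elem (int q)" using assms by simp
  have "multiplicity (int q) a + multiplicity (int q) d = multiplicity (int q) n + multiplicity (int q) b"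
    using prime_elem_multiplicity_mult_distrib[OF P] assms n0 d e
    by (metis order_less_irrefl)
  then have "int (multiplicity (int q) d) - int (multiplicity (int q) n) =
      int (multiplicity (int q) b) - int (multiplicity (int q) a)" by linarith
  then show ?thesis using assms nd unfolding padic_abs_def by simp
qed

lemma padic_abs_0 [simp]: "padic_abs q 0 = 0" by (simp add: padic_abs_def)

lemma padic_abs_nonneg: "padic_abs q x \<ge> 0" by (simp add: padic_abs_def)

lemma padic_abs_eq_0: "prime q \<Longrightarrow> padic_abs q x = 0 \<longleftrightarrow> x = 0"
  by (auto simp: padic_abs_def prime_gt_0_nat power_int_eq_0_iff)

lemma rat_as_frac: fixes x :: rat obtains a b where "x = of_int a / of_int b" "b \<noteq> (0::int)"
proof -
  obtain a b where "quotient_of x = (a, b)" by fastforce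
  then show ?thesis
    using that[of a b] quotient_of_div quotient_of_denom_pos by (metis order_less_irrefl)
qed

lemma padic_abs_mult: assumes "prime q" shows "padic_abs q (x * y) = padic_abs q x * padic_abs q y"
proof (cases "x = 0 \<or> y = 0")
  case False
  obtain a b c d where *: "x = of_int a / of_int b" "b \<noteq> 0" "y = of_int c / of_int d" "d \<noteq> 0"
    by (metis rat_as_frac)
  then have nz: "a \<noteq> 0" "c \<noteq> 0" using False by auto
  have xy: "x * y = of_int (a*c) / of_int (b*d)" using * by simp
  have P: "prime_elem (int q)" using assms by simp
  have q: "real q \<noteq> 0" using assms by (simp add: prime_gt_0_nat)
  have "padic_abs q (x*y) = real q powi (int (multiplicity (int q) (b*d)) - int (multiplicity (int q) (a*c)))"
    unfolding xy using * nz assms by (intro padic_abs_frac) auto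
  also have "\<dots> = padic_abs q x * padic_abs q y"
    using * nz q prime_elem_multiplicity_mult_distrib[OF P]
    by (simp add: padic_abs_frac[OF assms] power_int_add[symmetric] algebra_simps)
  finally show ?thesis .
qed auto

lemma padic_abs_1 [simp]: "padic_abs q 1 = 1" by (simp add: padic_abs_def)

lemma padic_abs_minus: "prime q \<Longrightarrow> padic_abs q (- x) = padic_abs q x"
proof -
  assume q: "prime q"
  have "padic_abs q (-1) = 1" using padic_abs_frac[OF q, of "-1" 1]
    by (simp add: multiplicity_unit_right)
  then show ?thesis using padic_abs_mult[OF q, of "-1" x] by simp
qed

lemma padic_abs_ultra: assumes "prime q" shows "padic_abs q (x + y) \<le> max (padic_abs q x) (padic_abs q y)"
proof (cases "x = 0 \<or> y = 0 \<or> x + y = 0")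
  case True then show ?thesis using padic_abs_nonneg by (auto simp: le_max_iff_disj)
next
  case False
  obtain a b c d where *: "x = of_int a / of_int b" "b \<noteq> 0" "y = of_int c / of_int d" "d \<noteq> 0"
    by (metis rat_as_frac)
  define A D E where "A = a * d" and "D = c * b" and "E = b * d"
  have E: "E \<noteq> 0" "x = of_int A / of_int E" "y = of_int D / of_int E"
    using * by (auto simp: A_def D_def E_def)
  have s: "x + y = of_int (A + D) / of_int E" using E by (simp add: add_divide_distrib)
  have nz: "A \<noteq> 0" "D \<noteq> 0" "A + D \<noteq> 0" using False E s by auto
  have m: "min (multiplicity (int q) A) (multiplicity (int q) D) \<le> multiplicity (int q) (A + D)"
    using assms nz by (intro multiplicity_geI) 
      (auto intro!: dvd_add simp: multiplicity_dvd' prime_nat_iff)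
  have q1: "1 \<le> real q" using assms prime_ge_1_nat by force
  show ?thesis
    unfolding s unfolding E padic_abs_frac[OF assms nz(1) E(1)] padic_abs_frac[OF assms nz(2) E(1)] padic_abs_frac[OF assms nz(3) E(1)]
    using m q1 by (auto simp: le_max_iff_disj min_def intro!: power_int_increasing split: if_splits)
qed

lemma padic_abs_diff_ultra: "prime q \<Longrightarrow> padic_abs q (x - y) \<le> max (padic_abs q x) (padic_abs q y)"
  using padic_abs_ultra[of q x "-y"] by (simp add: padic_abs_minus)

lemma padic_abs_triangle: assumes "prime q" shows "\<bar>padic_abs q x - padic_abs q y\<bar> \<le> padic_abs q (x - y)"
proof -
  have "padic_abs q x \<le> padic_abs q (x - y) + padic_abs q y"
    using padic_abs_ultra[OF assms, of "x-y" y] padic_abs_nonneg[of q "x-y"] padic_abs_nonneg[of q y] by (simp add: max_def split: if_splits)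
  moreover have "padic_abs q y \<le> padic_abs q (y - x) + padic_abs q x"
    using padic_abs_ultra[OF assms, of "y-x" x] padic_abs_nonneg[of q "y-x"] padic_abs_nonneg[of q x] by (simp add: max_def split: if_splits)
  moreover have "padic_abs q (y - x) = padic_abs q (x - y)" using padic_abs_minus[OF assms, of "x-y"] by simp
  ultimately show ?thesis by linarith
qed

lemma padic_cauchy_abs_convergent:
  assumes "prime q" "padic_cauchy q X" shows "convergent (\<lambda>n. padic_abs q (X n))"
proof -
  have "Cauchy (\<lambda>n. padic_abs q (X n))"
    unfolding Cauchy_def dist_real_def using assms padic_abs_triangle[OF assms(1)] unfolding padic_cauchy_def
    by (meson order.strict_trans1)
  then show ?thesis using Cauchy_convergent by blast
qed

lemma padic_cauchy_bounded:
  assumes "prime q" "padic_cauchy q X" obtains K where "K > 0" "\<And>n. padic_abs q (X n) \<le> K"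
proof -
  have "Bseq (\<lambda>n. padic_abs q (X n))" using padic_cauchy_abs_convergent[OF assms] convergent_imp_Bseq by blast
  then show ?thesis using that by (metis BseqE abs_of_nonneg padic_abs_nonneg real_norm_def)
qed

lemma cauchy_add:
  assumes q: "prime q" and X: "padic_cauchy q X" and Y: "padic_cauchy q Y"
  shows "padic_cauchy q (\<lambda>n. X n + Y n)"
  unfolding padic_cauchy_def
proof (intro allI impI)
  fix e :: real assume "e > 0"
  then obtain M N where "\<forall>m\<ge>M. \<forall>n\<ge>M. padic_abs q (X m - X n) < e" "\<forall>m\<ge>N. \<forall>n\<ge>N. padic_abs q (Y m - Y n) < e"
    using X Y unfolding padic_cauchy_def by meson
  then have "\<forall>m\<ge>max M N. \<forall>n\<ge>max M N. padic_abs q (X m + Y m - (X n + Y n)) < e"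
    using padic_abs_ultra[OF q]
    by (smt (verit) add_diff_add max.bounded_iff max_def)
  then show "\<exists>N. \<forall>m\<ge>N. \<forall>n\<ge>N. padic_abs q (X m + Y m - (X n + Y n)) < e" by blast
qed

lemma cauchy_minus: "prime q \<Longrightarrow> padic_cauchy q X \<Longrightarrow> padic_cauchy q (\<lambda>n. - X n)"
  unfolding padic_cauchy_def using padic_abs_minus by (metis minus_diff_eq minus_diff_commute uminus_add_conv_diff diff_minus_eq_add add.commute)

lemma cauchy_const: "padic_cauchy q (\<lambda>_. c)" by (auto simp: padic_cauchy_def)

lemma cauchy_mult:
  assumes q: "prime q" and X: "padic_cauchy q X" and Y: "padic_cauchy q Y"
  shows "padic_cauchy q (\<lambda>n. X n * Y n)"
  unfolding padic_cauchy_def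
proof (intro allI impI)
  fix e :: real assume e: "e > 0"
  obtain K where K: "K > 0" "\<And>n. padic_abs q (X n) \<le> K" using padic_cauchy_bounded[OF q X] by blast
  obtain J where J: "J > 0" "\<And>n. padic_abs q (Y n) \<le> J" using padic_cauchy_bounded[OF q Y] by blast
  obtain M N where MN: "\<forall>m\<ge>M. \<forall>n\<ge>M. padic_abs q (X m - X n) < e / J" "\<forall>m\<ge>N. \<forall>n\<ge>N. padic_abs q (Y m - Y n) < e / K"
    using X Y e K J unfolding padic_cauchy_def by (meson divide_pos_pos)
  have "padic_abs q (X m * Y m - X n * Y n) < e" if "m \<ge> max M N" "n \<ge> max M N" for m n
  proof -
    have a: "X m * Y m - X n * Y n = (X m - X n) * Y m + X n * (Y m - Y n)" by (simp add: algebra_simps)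
    have "padic_abs q ((X m - X n) * Y m) \<le> padic_abs q (X m - X n) * J"
      using J padic_abs_nonneg by (simp add: padic_abs_mult[OF q] mult_left_mono)
    also have "\<dots> < e" using MN(1) that J by (simp add: pos_less_divide_eq)
    finally have 1: "padic_abs q ((X m - X n) * Y m) < e" .
    have "padic_abs q (X n * (Y m - Y n)) \<le> K * padic_abs q (Y m - Y n)"
      using K padic_abs_nonneg by (simp add: padic_abs_mult[OF q] mult_right_mono)
    also have "\<dots> < e" using MN(2) that K by (simp add: pos_less_divide_eq mult.commute)
    finally have 2: "padic_abs q (X n * (Y m - Y n)) < e" .
    show ?thesis unfolding a using padic_abs_ultra[OF q] 1 2 by (meson max_less_iff_conj order.strict_trans1)
  qed
  then show "\<exists>N. \<forall>m\<ge>N. \<forall>n\<ge>N. padic_abs q (X m * Y m - X n * Y n) < e" by blast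
qed

lemma cauchy_ring_cring: assumes q: "prime q" shows "cring (cauchy_ring q)"
proof (rule cringI)
  show "abelian_group (cauchy_ring q)"
  proof (rule abelian_groupI)
    fix x assume "x \<in> carrier (cauchy_ring q)"
    then have "(\<lambda>n. - x n) \<in> carrier (cauchy_ring q)" "(\<lambda>n. - x n) \<oplus>\<^bsub>cauchy_ring q\<^esub> x = \<zero>\<^bsub>cauchy_ring q\<^esub>"
      using cauchy_minus[OF q] by (auto simp: cauchy_ring_def)
    then show "\<exists>y\<in>carrier (cauchy_ring q). y \<oplus>\<^bsub>cauchy_ring q\<^esub> x = \<zero>\<^bsub>cauchy_ring q\<^esub>" by blast
  qed (auto simp: cauchy_ring_def cauchy_const cauchy_add[OF q])
  show "comm_monoid (cauchy_ring q)"
    by (rule comm_monoidI) (auto simp: cauchy_ring_def cauchy_const cauchy_mult[OF q])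
qed (auto simp: cauchy_ring_def algebra_simps)

lemma null_cauchy: assumes q: "prime q" and X: "X \<in> null_seqs q" shows "padic_cauchy q X"
  unfolding padic_cauchy_def
proof (intro allI impI)
  fix e :: real assume "e > 0"
  then obtain N where "\<forall>n\<ge>N. padic_abs q (X n) < e"
    using X unfolding null_seqs_def LIMSEQ_def by (auto simp: dist_real_def padic_abs_nonneg)
  then show "\<exists>N. \<forall>m\<ge>N. \<forall>n\<ge>N. padic_abs q (X m - X n) < e"
    using padic_abs_diff_ultra[OF q] by (meson max_less_iff_conj order.strict_trans1)
qed

lemma null_add: assumes "prime q" "X \<in> null_seqs q" "Y \<in> null_seqs q" shows "(\<lambda>n. X n + Y n) \<in> null_seqs q"
proof -
  have "(\<lambda>n. padic_abs q (X n) + padic_abs q (Y n)) \<longlonglongrightarrow> 0 + 0"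
    using assms unfolding null_seqs_def by (intro tendsto_add) auto
  moreover have "norm (padic_abs q (X n + Y n)) \<le> padic_abs q (X n) + padic_abs q (Y n)" for n
    using padic_abs_ultra[OF assms(1), of "X n" "Y n"] padic_abs_nonneg[of q "X n"] padic_abs_nonneg[of q "Y n"]
      padic_abs_nonneg[of q "X n + Y n"] by (simp add: max_def split: if_splits)
  ultimately show ?thesis unfolding null_seqs_def mem_Collect_eq
    using Lim_null_comparison[OF always_eventually] by (metis (no_types, lifting) add_0)
qed

lemma null_mult: assumes q: "prime q" and X: "X \<in> null_seqs q" and Y: "padic_cauchy q Y" shows "(\<lambda>n. X n * Y n) \<in> null_seqs q"
proof -
  obtain K where K: "K > 0" "\<And>n. padic_abs q (Y n) \<le> K" using padic_cauchy_bounded[OF q Y] by blast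
  have "(\<lambda>n. padic_abs q (X n) * K) \<longlonglongrightarrow> 0 * K"
    using X unfolding null_seqs_def by (intro tendsto_mult) auto
  moreover have "norm (padic_abs q (X n * Y n)) \<le> padic_abs q (X n) * K" for n
    using K[of] padic_abs_nonneg[of q "X n"] padic_abs_nonneg[of q "Y n"]
    by (simp add: padic_abs_mult[OF q] mult_left_mono)
  ultimately show ?thesis unfolding null_seqs_def mem_Collect_eq
    using Lim_null_comparison[OF always_eventually] by (metis (no_types, lifting) mult_zero_left)
qed

lemma null_ideal: assumes q: "prime q" shows "ideal (null_seqs q) (cauchy_ring q)"
proof -
  interpret R: cring "cauchy_ring q" by (rule cauchy_ring_cring[OF q])
  have m: "inv\<^bsub>add_monoid (cauchy_ring q)\<^esub> X = (\<lambda>n. - X n)" if "X \<in> null_seqs q" for X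
    unfolding a_inv_def[symmetric]
    using null_cauchy[OF q that] cauchy_minus[OF q] by (intro R.minus_equality) (simp_all add: cauchy_ring_def)
  show ?thesis
  proof (rule idealI)
    show "subgroup (null_seqs q) (add_monoid (cauchy_ring q))"
    proof (rule subgroup.intro)
      show "null_seqs q \<subseteq> carrier (add_monoid (cauchy_ring q))"
        using null_cauchy[OF q] by (auto simp: cauchy_ring_def)
      show "\<one>\<^bsub>add_monoid (cauchy_ring q)\<^esub> \<in> null_seqs q"
        by (simp add: cauchy_ring_def null_seqs_def)
      show "x \<otimes>\<^bsub>add_monoid (cauchy_ring q)\<^esub> y \<in> null_seqs q"
        if "x \<in> null_seqs q" "y \<in> null_seqs q" for x y
        using null_add[OF q that] by (simp add: cauchy_ring_def)
      show "inv\<^bsub>add_monoid (cauchy_ring q)\<^esub> x \<in> null_seqs q" if "x \<in> null_seqs q" for x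
        using that unfolding m[OF that] by (simp add: null_seqs_def padic_abs_minus[OF q])
    qed
    show "x \<otimes>\<^bsub>cauchy_ring q\<^esub> a \<in> null_seqs q" "a \<otimes>\<^bsub>cauchy_ring q\<^esub> x \<in> null_seqs q"
      if "a \<in> null_seqs q" "x \<in> carrier (cauchy_ring q)" for a x
      using null_mult[OF q that(1), of x] that(2) by (simp_all add: cauchy_ring_def mult.commute)
  qed (rule R.ring_axioms)
qed

lemma Qp_cring: "prime q \<Longrightarrow> cring (Qp q)"
  unfolding Qp_def using ideal.quotient_is_cring[OF null_ideal cauchy_ring_cring] by blast

lemma coset_mem: "Y \<in> null_seqs q +>\<^bsub>cauchy_ring q\<^esub> X \<longleftrightarrow> (\<lambda>n. Y n - X n) \<in> null_seqs q"
proof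
  assume "(\<lambda>n. Y n - X n) \<in> null_seqs q"
  then show "Y \<in> null_seqs q +>\<^bsub>cauchy_ring q\<^esub> X"
    unfolding a_r_coset_def' cauchy_ring_def
    by simp (rule bexI[of _ "\<lambda>n. Y n - X n"]; simp)
qed (auto simp: a_r_coset_def' cauchy_ring_def)

lemma Qp_cases: assumes "prime q" "\<xi> \<in> carrier (Qp q)"
  obtains X where "padic_cauchy q X" "\<xi> = null_seqs q +>\<^bsub>cauchy_ring q\<^esub> X"
proof -
  from assms obtain X where "X \<in> carrier (cauchy_ring q)" "\<xi> = null_seqs q +>\<^bsub>cauchy_ring q\<^esub> X"
    unfolding Qp_def FactRing_def A_RCOSETS_def' by auto
  then show ?thesis using that by (simp add: cauchy_ring_def)
qed

lemma coset_in_Qp: "padic_cauchy q X \<Longrightarrow> null_seqs q +>\<^bsub>cauchy_ring q\<^esub> X \<in> carrier (Qp q)"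
  unfolding Qp_def FactRing_def A_RCOSETS_def' by (auto simp: cauchy_ring_def)

lemma qp_norm_coset: assumes q: "prime q" and X: "padic_cauchy q X"
  shows "(\<lambda>n. padic_abs q (X n)) \<longlonglongrightarrow> qp_norm q (null_seqs q +>\<^bsub>cauchy_ring q\<^esub> X)"
proof -
  obtain r where r: "(\<lambda>n. padic_abs q (X n)) \<longlonglongrightarrow> r" using padic_cauchy_abs_convergent[OF q X] by (auto simp: convergent_def)
  have "(\<lambda>n. padic_abs q (Y n)) \<longlonglongrightarrow> r" if "(\<lambda>n. Y n - X n) \<in> null_seqs q" for Y
  proof -
    have "(\<lambda>n. padic_abs q (Y n - X n)) \<longlonglongrightarrow> 0" using that by (simp add: null_seqs_def)
    then have "(\<lambda>n. padic_abs q (Y n) - padic_abs q (X n)) \<longlonglongrightarrow> 0"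
      by (rule Lim_null_comparison[rotated]) (use padic_abs_triangle[OF q] in auto)
    then show ?thesis by (rule Lim_transform[OF r])
  qed
  then have a: "\<forall>Y\<in>null_seqs q +>\<^bsub>cauchy_ring q\<^esub> X. (\<lambda>n. padic_abs q (Y n)) \<longlonglongrightarrow> r"
    by (simp add: coset_mem)
  have "X \<in> null_seqs q +>\<^bsub>cauchy_ring q\<^esub> X" unfolding coset_mem by (simp add: null_seqs_def)
  then have "qp_norm q (null_seqs q +>\<^bsub>cauchy_ring q\<^esub> X) = r"
    unfolding qp_norm_def using a LIMSEQ_unique[of _ r] by (intro the_equality) (assumption, metis LIMSEQ_unique)
  then show ?thesis using r by simp
qed


lemma Qp_diff: assumes q: "prime q" and X: "padic_cauchy q X" and Y: "padic_cauchy q Y"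
  shows "(null_seqs q +>\<^bsub>cauchy_ring q\<^esub> X) \<ominus>\<^bsub>Qp q\<^esub> (null_seqs q +>\<^bsub>cauchy_ring q\<^esub> Y) =
     null_seqs q +>\<^bsub>cauchy_ring q\<^esub> (\<lambda>n. X n - Y n)"
proof -
  interpret I: ideal "null_seqs q" "cauchy_ring q" by (rule null_ideal[OF q])
  interpret H: ring_hom_ring "cauchy_ring q" "Qp q" "\<lambda>x. null_seqs q +>\<^bsub>cauchy_ring q\<^esub> x"
    unfolding Qp_def by (rule I.rcos_ring_hom_ring)
  have c: "X \<in> carrier (cauchy_ring q)" "Y \<in> carrier (cauchy_ring q)" using X Y by (auto simp: cauchy_ring_def)
  have "\<ominus>\<^bsub>cauchy_ring q\<^esub> Y = (\<lambda>n. - Y n)"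
    by (rule I.minus_equality) (use Y cauchy_minus[OF q Y] in \<open>simp_all add: cauchy_ring_def\<close>)
  moreover have "\<ominus>\<^bsub>cauchy_ring q\<^esub> Y \<in> carrier (cauchy_ring q)" using c by simp
  ultimately have e: "X \<oplus>\<^bsub>cauchy_ring q\<^esub> \<ominus>\<^bsub>cauchy_ring q\<^esub> Y = (\<lambda>n. X n - Y n)"
    by (simp add: cauchy_ring_def)
  have "null_seqs q +>\<^bsub>cauchy_ring q\<^esub> (X \<oplus>\<^bsub>cauchy_ring q\<^esub> \<ominus>\<^bsub>cauchy_ring q\<^esub> Y) =
      (null_seqs q +>\<^bsub>cauchy_ring q\<^esub> X) \<oplus>\<^bsub>Qp q\<^esub>
      (null_seqs q +>\<^bsub>cauchy_ring q\<^esub> (\<ominus>\<^bsub>cauchy_ring q\<^esub> Y))"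
    by (rule H.hom_add) (use c in auto)
  also have "null_seqs q +>\<^bsub>cauchy_ring q\<^esub> (\<ominus>\<^bsub>cauchy_ring q\<^esub> Y) =
      \<ominus>\<^bsub>Qp q\<^esub> (null_seqs q +>\<^bsub>cauchy_ring q\<^esub> Y)"
    by (rule H.hom_a_inv) (rule c)
  finally show ?thesis unfolding e a_minus_def ..
qed

lemma Metric_space_Qp:
  assumes q: "prime q" shows "Metric_space (carrier (Qp q)) (qp_dist q)"
proof -
  let ?c = "\<lambda>X. null_seqs q +>\<^bsub>cauchy_ring q\<^esub> X"
  have lim: "(\<lambda>n. padic_abs q (X n - Y n)) \<longlonglongrightarrow> qp_dist q (?c X) (?c Y)"
    if X: "padic_cauchy q X" and Y: "padic_cauchy q Y" for X Y
  proof -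
    have "padic_cauchy q (\<lambda>n. X n - Y n)"
      using cauchy_add[OF q X cauchy_minus[OF q Y]] by simp
    then show ?thesis
      unfolding qp_dist_def Qp_diff[OF q X Y] using coset_in_Qp X Y qp_norm_coset[OF q] by simp
  qed
  have self: "X \<in> ?c X" for X
    unfolding coset_mem by (simp add: null_seqs_def)
  show ?thesis
  proof
    fix x y
    show "0 \<le> qp_dist q x y"
    proof (cases "x \<in> carrier (Qp q) \<and> y \<in> carrier (Qp q)")
      case True
      then obtain X Y where "padic_cauchy q X" "x = ?c X" "padic_cauchy q Y" "y = ?c Y"
        by (metis Qp_cases[OF q])
      then show ?thesis using LIMSEQ_le_const[OF lim] padic_abs_nonneg by blast
    qed (auto simp: qp_dist_def)
    show "qp_dist q x y = qp_dist q y x"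
    proof (cases "x \<in> carrier (Qp q) \<and> y \<in> carrier (Qp q)")
      case True
      then obtain X Y where XY: "padic_cauchy q X" "x = ?c X" "padic_cauchy q Y" "y = ?c Y"
        by (metis Qp_cases[OF q])
      have "(\<lambda>n. padic_abs q (X n - Y n)) = (\<lambda>n. padic_abs q (Y n - X n))"
        using padic_abs_minus[OF q, of "X n - Y n" for n] by simp
      then show ?thesis
        using LIMSEQ_unique[OF lim[OF XY(1,3)]] lim[OF XY(3,1)] XY by simp
    qed (auto simp: qp_dist_def)
  next
    fix x y assume "x \<in> carrier (Qp q)" "y \<in> carrier (Qp q)"
    then obtain X Y where XY: "padic_cauchy q X" "x = ?c X" "padic_cauchy q Y" "y = ?c Y"
      by (metis Qp_cases[OF q])
    have m: "(\<lambda>n. X n - Y n) \<in> null_seqs q \<longleftrightarrow> (\<lambda>n. padic_abs q (X n - Y n)) \<longlonglongrightarrow> 0"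
      by (simp add: null_seqs_def)
    have "qp_dist q x y = 0 \<longleftrightarrow> (\<lambda>n. X n - Y n) \<in> null_seqs q"
      unfolding m XY(2,4)
    proof
      show "(\<lambda>n. padic_abs q (X n - Y n)) \<longlonglongrightarrow> 0" if "qp_dist q (?c X) (?c Y) = 0"
        using lim[OF XY(1,3)] unfolding that .
    qed (rule LIMSEQ_unique[OF lim[OF XY(1,3)]])
    also have "\<dots> \<longleftrightarrow> X \<in> ?c Y" by (simp add: coset_mem)
    also have "\<dots> \<longleftrightarrow> ?c X = ?c Y"
    proof
      interpret I: ideal "null_seqs q" "cauchy_ring q" by (rule null_ideal[OF q])
      show "X \<in> ?c Y \<Longrightarrow> ?c X = ?c Y"
        using I.a_repr_independence'[of X Y] XY by (simp add: cauchy_ring_def)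
      show "?c X = ?c Y \<Longrightarrow> X \<in> ?c Y"
        using self[of X] by simp
    qed
    finally show "qp_dist q x y = 0 \<longleftrightarrow> x = y" using XY by simp
  next
    fix x y z assume x: "x \<in> carrier (Qp q)" and y: "y \<in> carrier (Qp q)" and z: "z \<in> carrier (Qp q)"
    obtain X where X: "padic_cauchy q X" "x = ?c X" by (rule Qp_cases[OF q x])
    obtain Y where Y: "padic_cauchy q Y" "y = ?c Y" by (rule Qp_cases[OF q y])
    obtain Z where Z: "padic_cauchy q Z" "z = ?c Z" by (rule Qp_cases[OF q z])
    have "padic_abs q (X n - Z n) \<le> padic_abs q (X n - Y n) + padic_abs q (Y n - Z n)" for n
      using padic_abs_ultra[OF q, of "X n - Y n" "Y n - Z n"] padic_abs_nonneg[of q "X n - Y n"]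
        padic_abs_nonneg[of q "Y n - Z n"] by (simp add: max_def split: if_splits)
    then show "qp_dist q x z \<le> qp_dist q x y + qp_dist q y z"
      unfolding X(2) Y(2) Z(2)
      using LIMSEQ_le[OF lim[OF X(1) Z(1)] tendsto_add[OF lim[OF X(1) Y(1)] lim[OF Y(1) Z(1)]]] by blast
  qed
qed

lemma mspace_qp_metric: "prime q \<Longrightarrow> mspace (qp_metric q) = carrier (Qp q)"
  and mdist_qp_metric: "prime q \<Longrightarrow> mdist (qp_metric q) = qp_dist q"
  unfolding qp_metric_def by (simp_all add: Metric_space.mspace_metric Metric_space.mdist_metric Metric_space_Qp)


section \<open>Lattices and scalar extension\<close>

text \<open>
  A \<open>\<rat>\<close>-vector space is a type \<open>'v\<close> with a scalar multiplication \<open>smul\<close>. Throughout,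
  \<open>B\<close> is a \<open>\<int>\<close>-basis of the lattice \<open>L\<close>, and for a field \<open>K\<close> the space \<open>V \<otimes> K\<close> is realised in
  coordinates as the set of (extensional) functions \<open>B \<rightarrow> K\<close>. For \<open>V = \<rat>\<close> and \<open>L = \<int>\<close> take
  \<open>smul = (*)\<close> and \<open>B = {1}\<close>.
\<close>

definition lattice_basis :: "(rat \<Rightarrow> 'v::ab_group_add \<Rightarrow> 'v) \<Rightarrow> 'v set \<Rightarrow> 'v set \<Rightarrow> bool" where
  "lattice_basis smul L B \<longleftrightarrow>
     finite_dimensional_vector_space smul B \<and>
     L = range (\<lambda>c :: 'v \<Rightarrow> int. \<Sum>b\<in>B. smul (of_int (c b)) b)"

abbreviation coord :: "(rat \<Rightarrow> 'v::ab_group_add \<Rightarrow> 'v) \<Rightarrow> 'v set \<Rightarrow> 'v \<Rightarrow> 'v \<Rightarrow> rat" where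
  "coord smul B v b \<equiv> module.representation smul B v b"

definition V_at :: "'v set \<Rightarrow> nat \<Rightarrow> ('v \<Rightarrow> qp) set" where
  "V_at B q = (B \<rightarrow>\<^sub>E carrier (Qp q))"

definition L_at :: "'v set \<Rightarrow> nat \<Rightarrow> ('v \<Rightarrow> qp) set" where
  "L_at B q = (B \<rightarrow>\<^sub>E Zp q)"

definition V_top :: "'v set \<Rightarrow> nat \<Rightarrow> ('v \<Rightarrow> qp) topology" where
  "V_top B q = product_topology (\<lambda>_. mtopology_of (qp_metric q)) B"

definition V_add :: "'v set \<Rightarrow> nat \<Rightarrow> ('v \<Rightarrow> qp) \<Rightarrow> ('v \<Rightarrow> qp) \<Rightarrow> 'v \<Rightarrow> qp" where
  "V_add B q x y = (\<lambda>b\<in>B. x b \<oplus>\<^bsub>Qp q\<^esub> y b)"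

definition V_zero :: "'v set \<Rightarrow> nat \<Rightarrow> 'v \<Rightarrow> qp" where
  "V_zero B q = (\<lambda>b\<in>B. \<zero>\<^bsub>Qp q\<^esub>)"

definition V_emb :: "(rat \<Rightarrow> 'v::ab_group_add \<Rightarrow> 'v) \<Rightarrow> 'v set \<Rightarrow> nat \<Rightarrow> 'v \<Rightarrow> 'v \<Rightarrow> qp" where
  "V_emb smul B q v = (\<lambda>b\<in>B. qp_of_rat q (coord smul B v b))"


section \<open>Test functions\<close>

text \<open>
  For a set \<open>P\<close> of primes, \<open>adeles B P\<close> is the restricted product of the \<open>V\<^sub>q\<close>, \<open>q \<in> P\<close>, with respect
  to the \<open>L\<^sub>q\<close>. The restricted tensor product of the groups \<open>\<S>(V\<^sub>q)\<close> is the group of integral linear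
  combinations of product functions on it.
\<close>

type_synonym 'v adele = "nat \<Rightarrow> 'v \<Rightarrow> qp"

definition adeles :: "'v set \<Rightarrow> nat set \<Rightarrow> 'v adele set" where
  "adeles B P = {x \<in> (\<Pi>\<^sub>E q\<in>P. V_at B q). finite {q\<in>P. x q \<notin> L_at B q}}"

definition local_schwartz :: "'v set \<Rightarrow> nat \<Rightarrow> (('v \<Rightarrow> qp) \<Rightarrow> int) set" where
  "local_schwartz B q =
     {g. continuous_map (V_top B q) (discrete_topology UNIV) g \<and>
         (\<exists>K. compactin (V_top B q) K \<and> {x. g x \<noteq> 0} \<subseteq> K)}"

text \<open>Factors equal to 1 are left out because \<^const>\<open>prod\<close> over an infinite set is 1.\<close>

definition pure_tensor :: "'v set \<Rightarrow> nat set \<Rightarrow> (nat \<Rightarrow> ('v \<Rightarrow> qp) \<Rightarrow> int) \<Rightarrow> 'v adele \<Rightarrow> int" where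
  "pure_tensor B P \<phi> =
     (\<lambda>x. if x \<in> adeles B P then \<Prod>q | q \<in> P \<and> \<phi> q (x q) \<noteq> 1. \<phi> q (x q) else 0)"

definition schwartz :: "'v set \<Rightarrow> nat set \<Rightarrow> ('v adele \<Rightarrow> int) set" where
  "schwartz B P =
     {F. \<exists>(m::nat) (c :: nat \<Rightarrow> int) \<phi>.
           (\<forall>i<m. (\<forall>q\<in>P. \<phi> i q \<in> local_schwartz B q) \<and>
                  finite {q\<in>P. \<phi> i q \<noteq> indicator (L_at B q)}) \<and>
           F = (\<lambda>x. \<Sum>i<m. c i * pure_tensor B P (\<phi> i) x)}"

definition primes :: "nat set" where
  "primes = {q. prime q}"

definition primes_away :: "nat \<Rightarrow> nat set" where
  "primes_away p = {q. prime q \<and> q \<noteq> p}"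

text \<open>\<open>f' \<otimes> [U]\<close> for a test function \<open>f'\<close> away from \<open>p\<close> and \<open>U \<subseteq> V\<^sub>p\<close>.\<close>

definition tensor_char ::
    "'v set \<Rightarrow> nat \<Rightarrow> ('v adele \<Rightarrow> int) \<Rightarrow> ('v \<Rightarrow> qp) set \<Rightarrow> 'v adele \<Rightarrow> int" where
  "tensor_char B p f' U =
     (\<lambda>x. if x \<in> adeles B primes \<and> x p \<in> U then f' (restrict x (primes_away p)) else 0)"

definition diagonal :: "(rat \<Rightarrow> 'v::ab_group_add \<Rightarrow> 'v) \<Rightarrow> 'v set \<Rightarrow> 'v \<Rightarrow> 'v adele" where
  "diagonal smul B v = (\<lambda>q\<in>primes. V_emb smul B q v)"

definition on_V ::
    "(rat \<Rightarrow> 'v::ab_group_add \<Rightarrow> 'v) \<Rightarrow> 'v set \<Rightarrow> ('v adele \<Rightarrow> int) \<Rightarrow> 'v \<Rightarrow> int" where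
  "on_V smul B F v = F (diagonal smul B v)"


section \<open>Haar measure and the Vanishing Hypothesis\<close>

text \<open>The period lattice is \<open>N\<int>\<close>, and \<open>[0, N) \<inter> \<rat>\<close> represents \<open>\<rat> / N\<int>\<close>.\<close>

definition haar_Q :: "(rat \<Rightarrow> int) \<Rightarrow> rat" where
  "haar_Q g =
     (let N = (SOME N::nat. N > 0 \<and> (\<forall>x. g (x + of_nat N) = g x))
      in of_int (\<Sum>x | 0 \<le> x \<and> x < of_nat N \<and> g x \<noteq> 0. g x) / of_nat N)"

definition haar_away :: "nat \<Rightarrow> (rat adele \<Rightarrow> int) \<Rightarrow> rat" where
  "haar_away p g' = haar_Q (on_V (*) {1} (tensor_char {1} p g' (L_at {1} p)))"

definition line_pullback ::
    "(rat \<Rightarrow> 'v::ab_group_add \<Rightarrow> 'v) \<Rightarrow> 'v set \<Rightarrow> nat \<Rightarrow> 'v \<Rightarrow> 'v \<Rightarrow>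
     ('v adele \<Rightarrow> int) \<Rightarrow> rat adele \<Rightarrow> int" where
  "line_pullback smul B p v w f' =
     (\<lambda>x. if x \<in> adeles {1} (primes_away p)
          then f' (\<lambda>q\<in>primes_away p. \<lambda>b\<in>B.
                     V_emb smul B q v b \<oplus>\<^bsub>Qp q\<^esub> x q 1 \<otimes>\<^bsub>Qp q\<^esub> V_emb smul B q w b)
          else 0)"

definition vanishing_hypothesis ::
    "(rat \<Rightarrow> 'v::ab_group_add \<Rightarrow> 'v) \<Rightarrow> 'v set \<Rightarrow> nat \<Rightarrow> ('v adele \<Rightarrow> int) \<Rightarrow> 'v \<Rightarrow> bool" where
  "vanishing_hypothesis smul B p f' w \<longleftrightarrow>
     w \<noteq> 0 \<and> (\<forall>v. haar_away p (line_pullback smul B p v w f') = 0)"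


section \<open>Cones\<close>

text \<open>Cones are subsets of \<open>V\<^sub>\<real>\<close>, the extensional functions \<open>B \<rightarrow> \<real>\<close>. The generators of an open cone
  form a linearly independent set \<open>D \<subseteq> V\<close>.\<close>

definition open_cone ::
    "(rat \<Rightarrow> 'v::ab_group_add \<Rightarrow> 'v) \<Rightarrow> 'v set \<Rightarrow> 'v set \<Rightarrow> ('v \<Rightarrow> real) set" where
  "open_cone smul B D =
     {(\<lambda>b\<in>B. \<Sum>u\<in>D. a u * of_rat (coord smul B u b)) | a. \<forall>u\<in>D. a u > 0}"

definition cone_union ::
    "(rat \<Rightarrow> 'v::ab_group_add \<Rightarrow> 'v) \<Rightarrow> 'v set \<Rightarrow> 'v set set \<Rightarrow> ('v \<Rightarrow> real) set \<Rightarrow> bool" where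
  "cone_union smul B \<D> C \<longleftrightarrow>
     finite \<D> \<and> (\<forall>D\<in>\<D>. finite D \<and> \<not> module.dependent smul D) \<and>
     C = (\<Union>D\<in>\<D>. open_cone smul B D)"

definition cone_decomposition ::
    "(rat \<Rightarrow> 'v::ab_group_add \<Rightarrow> 'v) \<Rightarrow> 'v set \<Rightarrow> 'v set set \<Rightarrow> ('v \<Rightarrow> real) set \<Rightarrow> bool" where
  "cone_decomposition smul B \<D> C \<longleftrightarrow>
     cone_union smul B \<D> C \<and>
     pairwise (\<lambda>D D'. disjnt (open_cone smul B D) (open_cone smul B D')) \<D>"

definition rational_simplicial_cone ::
    "(rat \<Rightarrow> 'v::ab_group_add \<Rightarrow> 'v) \<Rightarrow> 'v set \<Rightarrow> ('v \<Rightarrow> real) set \<Rightarrow> bool" where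
  "rational_simplicial_cone smul B C \<longleftrightarrow> (\<exists>\<D>. cone_union smul B \<D> C)"

text \<open>Only lines through the origin are excluded; this is implied by the absence of affine lines.\<close>

definition pointed_cone :: "'v set \<Rightarrow> ('v \<Rightarrow> real) set \<Rightarrow> bool" where
  "pointed_cone B C \<longleftrightarrow>
     \<not> (\<exists>d \<in> B \<rightarrow>\<^sub>E UNIV. (\<exists>b\<in>B. d b \<noteq> 0) \<and> (\<forall>t. (\<lambda>b\<in>B. t * d b) \<in> C))"

definition has_extremal_rays ::
    "(rat \<Rightarrow> 'v::ab_group_add \<Rightarrow> 'v) \<Rightarrow> 'v set \<Rightarrow> ('v \<Rightarrow> real) set \<Rightarrow> 'v set \<Rightarrow> bool" where
  "has_extremal_rays smul B C E \<longleftrightarrow>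
     finite E \<and> (\<exists>\<D>. cone_decomposition smul B \<D> C \<and> (\<forall>D\<in>\<D>. D \<subseteq> E))"


section \<open>Localization of a commutative ring\<close>

inductive_set mult_closure :: "('a, 'm) monoid_scheme \<Rightarrow> 'a set \<Rightarrow> 'a set"
  for R (structure) and G :: "'a set" where
  one: "\<one> \<in> mult_closure R G"
| mult: "x \<in> G \<Longrightarrow> y \<in> mult_closure R G \<Longrightarrow> x \<otimes> y \<in> mult_closure R G"

definition loc_rel :: "('a, 'm) ring_scheme \<Rightarrow> 'a set \<Rightarrow> (('a \<times> 'a) \<times> ('a \<times> 'a)) set" where
  "loc_rel R S =
     {((a, s), (b, t)). a \<in> carrier R \<and> s \<in> S \<and> b \<in> carrier R \<and> t \<in> S \<and>
        (\<exists>u\<in>S. u \<otimes>\<^bsub>R\<^esub> (t \<otimes>\<^bsub>R\<^esub> a \<ominus>\<^bsub>R\<^esub> s \<otimes>\<^bsub>R\<^esub> b) = \<zero>\<^bsub>R\<^esub>)}"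

definition loc_frac :: "('a, 'm) ring_scheme \<Rightarrow> 'a set \<Rightarrow> 'a \<Rightarrow> 'a \<Rightarrow> ('a \<times> 'a) set" where
  "loc_frac R S a s = loc_rel R S `` {(a, s)}"

definition localization :: "('a, 'm) ring_scheme \<Rightarrow> 'a set \<Rightarrow> ('a \<times> 'a) set ring" where
  "localization R S =
     \<lparr>carrier = (carrier R \<times> S) // loc_rel R S,
      mult = (\<lambda>X Y. \<Union>(a, s)\<in>X. \<Union>(b, t)\<in>Y. loc_frac R S (a \<otimes>\<^bsub>R\<^esub> b) (s \<otimes>\<^bsub>R\<^esub> t)),
      one = loc_frac R S \<one>\<^bsub>R\<^esub> \<one>\<^bsub>R\<^esub>,
      zero = loc_frac R S \<zero>\<^bsub>R\<^esub> \<one>\<^bsub>R\<^esub>,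
      add = (\<lambda>X Y. \<Union>(a, s)\<in>X. \<Union>(b, t)\<in>Y.
               loc_frac R S (t \<otimes>\<^bsub>R\<^esub> a \<oplus>\<^bsub>R\<^esub> s \<otimes>\<^bsub>R\<^esub> b) (s \<otimes>\<^bsub>R\<^esub> t))\<rparr>"


section \<open>Measures and pseudo-measures on \<open>L\<^sub>p\<close>\<close>

type_synonym 'v func = "('v \<Rightarrow> qp) \<Rightarrow> qp"
type_synonym 'v meas = "'v func \<Rightarrow> qp"

definition cont_space :: "'v set \<Rightarrow> nat \<Rightarrow> 'v func metric" where
  "cont_space B p = cfunspace (subtopology (V_top B p) (L_at B p)) (qp_metric p)"

definition is_measure :: "'v set \<Rightarrow> nat \<Rightarrow> 'v meas \<Rightarrow> bool" where
  "is_measure B p \<mu> \<longleftrightarrow>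
     \<mu> \<in> mspace (cont_space B p) \<rightarrow>\<^sub>E carrier (Qp p) \<and>
     (\<forall>f \<in> mspace (cont_space B p). \<forall>g \<in> mspace (cont_space B p).
        \<mu> (\<lambda>x\<in>L_at B p. f x \<oplus>\<^bsub>Qp p\<^esub> g x) = \<mu> f \<oplus>\<^bsub>Qp p\<^esub> \<mu> g) \<and>
     (\<forall>c \<in> carrier (Qp p). \<forall>f \<in> mspace (cont_space B p).
        \<mu> (\<lambda>x\<in>L_at B p. c \<otimes>\<^bsub>Qp p\<^esub> f x) = c \<otimes>\<^bsub>Qp p\<^esub> \<mu> f) \<and>
     continuous_map (mtopology_of (cont_space B p)) (mtopology_of (qp_metric p)) \<mu>"

definition dirac :: "'v set \<Rightarrow> nat \<Rightarrow> ('v \<Rightarrow> qp) \<Rightarrow> 'v meas" where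
  "dirac B p v = (\<lambda>f\<in>mspace (cont_space B p). f v)"

definition convolution :: "'v set \<Rightarrow> nat \<Rightarrow> 'v meas \<Rightarrow> 'v meas \<Rightarrow> 'v meas" where
  "convolution B p \<mu> \<nu> =
     (\<lambda>f\<in>mspace (cont_space B p).
        \<mu> (\<lambda>v\<in>L_at B p. \<nu> (\<lambda>w\<in>L_at B p. f (V_add B p v w))))"

definition measure_ring :: "'v set \<Rightarrow> nat \<Rightarrow> 'v meas ring" where
  "measure_ring B p =
     \<lparr>carrier = {\<mu>. is_measure B p \<mu>},
      mult = convolution B p,
      one = dirac B p (V_zero B p),
      zero = (\<lambda>f\<in>mspace (cont_space B p). \<zero>\<^bsub>Qp p\<^esub>),
      add = (\<lambda>\<mu> \<nu>. \<lambda>f\<in>mspace (cont_space B p). \<mu> f \<oplus>\<^bsub>Qp p\<^esub> \<nu> f)\<rparr>"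

definition denominators :: "'v set \<Rightarrow> nat \<Rightarrow> 'v meas set" where
  "denominators B p =
     mult_closure (measure_ring B p)
       {dirac B p (V_zero B p) \<ominus>\<^bsub>measure_ring B p\<^esub> dirac B p v | v. v \<in> L_at B p \<and> v \<noteq> V_zero B p}"

definition pseudo_measure_ring :: "'v set \<Rightarrow> nat \<Rightarrow> ('v meas \<times> 'v meas) set ring" where
  "pseudo_measure_ring B p = localization (measure_ring B p) (denominators B p)"

definition of_measure :: "'v set \<Rightarrow> nat \<Rightarrow> 'v meas \<Rightarrow> ('v meas \<times> 'v meas) set" where
  "of_measure B p \<mu> = loc_frac (measure_ring B p) (denominators B p) \<mu> \<one>\<^bsub>measure_ring B p\<^esub>"


section \<open>The pseudo-measure of a cone\<close>

definition admissible_scaling ::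
    "(rat \<Rightarrow> 'v::ab_group_add \<Rightarrow> 'v) \<Rightarrow> 'v set \<Rightarrow> nat \<Rightarrow> ('v \<Rightarrow> int) \<Rightarrow> 'v set \<Rightarrow> ('v \<Rightarrow> rat) \<Rightarrow> bool"
  where
  "admissible_scaling smul B p f D a \<longleftrightarrow>
     (\<forall>u\<in>D. a u > 0 \<and> V_emb smul B p (smul (a u) u) \<in> L_at B p \<and>
            (\<forall>v. f (v + smul (a u) u) = f v))"

definition parallelepiped :: "(rat \<Rightarrow> 'v::ab_group_add \<Rightarrow> 'v) \<Rightarrow> 'v set \<Rightarrow> ('v \<Rightarrow> rat) \<Rightarrow> 'v set" where
  "parallelepiped smul D a = {(\<Sum>u\<in>D. smul (c u) u) | c. \<forall>u\<in>D. 0 < c u \<and> c u \<le> a u}"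

definition open_cone_pseudo_measure ::
    "(rat \<Rightarrow> 'v::ab_group_add \<Rightarrow> 'v) \<Rightarrow> 'v set \<Rightarrow> nat \<Rightarrow> ('v \<Rightarrow> int) \<Rightarrow> 'v set \<Rightarrow> ('v \<Rightarrow> rat) \<Rightarrow>
     ('v meas \<times> 'v meas) set" where
  "open_cone_pseudo_measure smul B p f D a =
     (let M = measure_ring B p; \<delta> = (\<lambda>v. dirac B p (V_emb smul B p v))
      in (\<Otimes>\<^bsub>pseudo_measure_ring B p\<^esub>u\<in>D.
            loc_frac M (denominators B p) \<one>\<^bsub>M\<^esub> (\<delta> 0 \<ominus>\<^bsub>M\<^esub> \<delta> (smul (a u) u)))
         \<otimes>\<^bsub>pseudo_measure_ring B p\<^esub>
         of_measure B p (\<Oplus>\<^bsub>M\<^esub>v\<in>{v \<in> parallelepiped smul D a. f v \<noteq> 0}. [f v] \<cdot>\<^bsub>M\<^esub> \<delta> v))"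

text \<open>
  \<open>\<mu>\<^bsub>f',C,U\<^esub>\<close> is the common value of the sums over all decompositions of \<open>C\<close> into disjoint open
  cones and all choices of the scalings \<open>a\<close>.
\<close>

definition pseudo_measure ::
    "(rat \<Rightarrow> 'v::ab_group_add \<Rightarrow> 'v) \<Rightarrow> 'v set \<Rightarrow> nat \<Rightarrow> ('v adele \<Rightarrow> int) \<Rightarrow> ('v \<Rightarrow> real) set \<Rightarrow>
     ('v \<Rightarrow> qp) set \<Rightarrow> ('v meas \<times> 'v meas) set" where
  "pseudo_measure smul B p f' C U =
     (let f = on_V smul B (tensor_char B p f' U)
      in THE \<Lambda>. \<exists>\<D> a. cone_decomposition smul B \<D> C \<and>
           (\<forall>D\<in>\<D>. admissible_scaling smul B p f D (a D)) \<and>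
           \<Lambda> = (\<Oplus>\<^bsub>pseudo_measure_ring B p\<^esub>D\<in>\<D>. open_cone_pseudo_measure smul B p f D (a D)))"

end

theory Submission
  imports Defs "HOL-Number_Theory.Cong"
begin

text \<open>A function \<open>h\<close> on \<open>V\<close> stands for the formal sum of the \<open>h(v) \<delta>\<^sub>v\<close>. If some product of difference operators
  \<open>1 - t\<^sub>w\<close>, where \<open>t\<^sub>w\<close> is the translation by \<open>w\<close>, makes the support of \<open>h\<close> finite, then dividing by the
  corresponding \<open>\<delta>\<^sub>0 - \<delta>\<^sub>w\<close> gives a pseudo-measure that depends on \<open>h\<close> only; for \<open>h = f \<cdot> [C]\<close> it is
  \<open>\<mu>\<^bsub>f',C\<^esub>\<close>, whatever decomposition and scaling are used. After scaling \<open>u\<close>, the Vanishing Hypothesis for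
  \<open>u\<close> says that the averaging operator \<open>1 + t\<^sub>u + \<dots> + t\<^sub>u\<^bsup>K-1\<^esup>\<close> kills \<open>f\<close> for some period \<open>K\<close> prime to \<open>p\<close>.
  On an open cone the averages along all generators therefore leave a finite support, and averaging
  is multiplication by a geometric sum of Dirac measures, which is a unit of the ring of measures because
  \<open>1 / K \<in> \<int>\<^sub>p\<close>. So no denominators are needed.\<close>

section \<open>The field of p-adic numbers\<close>

text \<open>An average along u looks back only K steps. Far inside the cone in the direction u,
  either all points it sees lie in the cone or none does, so it is an average of the uncut f and
  vanishes. What survives is bounded in the direction of every generator, and f lives on a lattice
  (1/n) L, so finitely many points are left.

  The delicate point is that K must be prime to p. The Haar integral in the hypothesis runs over
  p-integral x, so the x with f' nonzero at v + x u differ by multiples of 1/K0 with K0 prime to p,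
  and the period comes from f', which does not see p. But u may have p in its denominators, so its
  multiples may leave L_p. It is replaced by w = (p^s / K0) u, and the sum over multiples of u / K0
  has to be turned into one over multiples of w.

  \<open>pseudo_measure\<close> is a definite description: a value exists only once an admissible
  choice is exhibited and all choices are shown to agree. The relation \<open>represents\<close>
  settles the agreement, and it also identifies the pseudo-measure of each open cone with a measure,
  since both represent the same function.\<close>

locale padic =
  fixes p :: nat
  assumes p: "prime p"
begin

sublocale Q: cring "Qp p"
  by (rule Qp_cring[OF p])

abbreviation cls :: "(nat \<Rightarrow> rat) \<Rightarrow> qp" where
  "cls X \<equiv> null_seqs p +>\<^bsub>cauchy_ring p\<^esub> X"

abbreviation qnorm :: "qp \<Rightarrow> real" where
  "qnorm \<equiv> qp_norm p"

abbreviation of_Q :: "rat \<Rightarrow> qp" where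
  "of_Q \<equiv> qp_of_rat p"

sublocale H: ring_hom_ring "cauchy_ring p" "Qp p" cls
  unfolding Qp_def by (rule ideal.rcos_ring_hom_ring[OF null_ideal[OF p]])

lemma cls_add: "padic_cauchy p X \<Longrightarrow> padic_cauchy p Y \<Longrightarrow> cls X \<oplus>\<^bsub>Qp p\<^esub> cls Y = cls (\<lambda>n. X n + Y n)"
  using H.hom_add[of X Y] by (simp add: cauchy_ring_def)

lemma cls_mult: "padic_cauchy p X \<Longrightarrow> padic_cauchy p Y \<Longrightarrow> cls X \<otimes>\<^bsub>Qp p\<^esub> cls Y = cls (\<lambda>n. X n * Y n)"
  using H.hom_mult[of X Y] by (simp add: cauchy_ring_def)

lemma cls_zero: "cls (\<lambda>_. 0) = \<zero>\<^bsub>Qp p\<^esub>"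
  using H.hom_zero by (simp add: cauchy_ring_def)

lemma cls_one: "cls (\<lambda>_. 1) = \<one>\<^bsub>Qp p\<^esub>"
  using H.hom_one by (simp add: cauchy_ring_def)

lemma of_Q_cls: "of_Q x = cls (\<lambda>_. x)"
  by (simp add: qp_of_rat_def)

lemma of_Q_closed [simp, intro]: "of_Q x \<in> carrier (Qp p)"
  unfolding of_Q_cls by (rule coset_in_Qp[OF cauchy_const])

lemma of_Q_add: "of_Q (x + y) = of_Q x \<oplus>\<^bsub>Qp p\<^esub> of_Q y"
  unfolding of_Q_cls by (simp add: cls_add cauchy_const)

lemma of_Q_mult: "of_Q (x * y) = of_Q x \<otimes>\<^bsub>Qp p\<^esub> of_Q y"
  unfolding of_Q_cls by (simp add: cls_mult cauchy_const)

lemma of_Q_zero [simp]: "of_Q 0 = \<zero>\<^bsub>Qp p\<^esub>"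
  unfolding of_Q_cls by (rule cls_zero)

lemma of_Q_one [simp]: "of_Q 1 = \<one>\<^bsub>Qp p\<^esub>"
  unfolding of_Q_cls by (rule cls_one)

lemma of_Q_minus: "of_Q (- x) = \<ominus>\<^bsub>Qp p\<^esub> of_Q x"
  by (rule Q.minus_equality[symmetric]) (simp_all flip: of_Q_add)

lemma of_Q_diff: "of_Q (x - y) = of_Q x \<ominus>\<^bsub>Qp p\<^esub> of_Q y"
  unfolding a_minus_def using of_Q_add[of x "- y"] by (simp add: of_Q_minus)

lemma qnorm_lim: "padic_cauchy p X \<Longrightarrow> (\<lambda>n. padic_abs p (X n)) \<longlonglongrightarrow> qnorm (cls X)"
  by (rule qp_norm_coset[OF p])

lemma qnorm_of_Q [simp]: "qnorm (of_Q x) = padic_abs p x"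
  unfolding of_Q_cls using LIMSEQ_unique[OF qnorm_lim[OF cauchy_const] tendsto_const] .

lemma qnorm_nonneg: "x \<in> carrier (Qp p) \<Longrightarrow> 0 \<le> qnorm x"
  by (metis Qp_cases[OF p] LIMSEQ_le_const qnorm_lim padic_abs_nonneg)

lemma qnorm_mult:
  assumes "x \<in> carrier (Qp p)" "y \<in> carrier (Qp p)"
  shows "qnorm (x \<otimes>\<^bsub>Qp p\<^esub> y) = qnorm x * qnorm y"
proof -
  obtain X Y where X: "padic_cauchy p X" "x = cls X" and Y: "padic_cauchy p Y" "y = cls Y"
    using assms by (metis Qp_cases[OF p])
  have "(\<lambda>n. padic_abs p (X n * Y n)) \<longlonglongrightarrow> qnorm (cls X) * qnorm (cls Y)"
    unfolding padic_abs_mult[OF p] by (intro tendsto_mult qnorm_lim X Y)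
  then show ?thesis
    using LIMSEQ_unique qnorm_lim[OF cauchy_mult[OF p X(1) Y(1)]] X Y by (auto simp: cls_mult)
qed

lemma qnorm_ultra:
  assumes "x \<in> carrier (Qp p)" "y \<in> carrier (Qp p)"
  shows "qnorm (x \<oplus>\<^bsub>Qp p\<^esub> y) \<le> max (qnorm x) (qnorm y)"
proof -
  obtain X Y where X: "padic_cauchy p X" "x = cls X" and Y: "padic_cauchy p Y" "y = cls Y"
    using assms by (metis Qp_cases[OF p])
  have "(\<lambda>n. max (padic_abs p (X n)) (padic_abs p (Y n))) \<longlonglongrightarrow> max (qnorm (cls X)) (qnorm (cls Y))"
    by (intro tendsto_max qnorm_lim X Y)
  then have "qnorm (cls (\<lambda>n. X n + Y n)) \<le> max (qnorm (cls X)) (qnorm (cls Y))"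
    using LIMSEQ_le[OF qnorm_lim[OF cauchy_add[OF p X(1) Y(1)]]] padic_abs_ultra[OF p] by blast
  then show ?thesis
    using X Y by (simp add: cls_add)
qed

lemma qnorm_minus: "x \<in> carrier (Qp p) \<Longrightarrow> qnorm (\<ominus>\<^bsub>Qp p\<^esub> x) = qnorm x"
proof -
  assume x: "x \<in> carrier (Qp p)"
  have "\<ominus>\<^bsub>Qp p\<^esub> x = of_Q (-1) \<otimes>\<^bsub>Qp p\<^esub> x"
    using x by (simp add: of_Q_minus Q.l_minus)
  then show ?thesis
    using x by (simp add: qnorm_mult padic_abs_minus[OF p])
qed

lemma qnorm_zero [simp]: "qnorm \<zero>\<^bsub>Qp p\<^esub> = 0"
  using qnorm_of_Q[of 0] by simp

lemma qdist_eq: "x \<in> carrier (Qp p) \<Longrightarrow> y \<in> carrier (Qp p) \<Longrightarrow> qp_dist p x y = qnorm (x \<ominus>\<^bsub>Qp p\<^esub> y)"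
  by (simp add: qp_dist_def)

sublocale QM: Metric_space "carrier (Qp p)" "qp_dist p"
  by (rule Metric_space_Qp[OF p])

lemma qtop_eq: "mtopology_of (qp_metric p) = QM.mtopology"
  by (simp add: mtopology_of_def mspace_qp_metric[OF p] mdist_qp_metric[OF p])

text \<open>Identities between limits are proved by bounding the norm of the difference by every
  positive e; the bounds are non-strict because these are what limits preserve.\<close>

lemma qnorm_le_0:
  assumes "x \<in> carrier (Qp p)" "\<And>e. e > 0 \<Longrightarrow> qnorm x \<le> e" shows "x = \<zero>\<^bsub>Qp p\<^esub>"
proof -
  have "qnorm x \<le> 0"
    using assms(2) field_le_epsilon[of "qnorm x" 0] by simp
  then have "qp_dist p x \<zero>\<^bsub>Qp p\<^esub> = 0"
    using assms(1) qnorm_nonneg[OF assms(1)] by (simp add: qdist_eq a_minus_def)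
  then show ?thesis
    using assms(1) by simp
qed

lemma qdist_ultra:
  assumes "x \<in> carrier (Qp p)" "y \<in> carrier (Qp p)" "z \<in> carrier (Qp p)"
  shows "qp_dist p x z \<le> max (qp_dist p x y) (qp_dist p y z)"
proof -
  have "x \<ominus>\<^bsub>Qp p\<^esub> z = (x \<ominus>\<^bsub>Qp p\<^esub> y) \<oplus>\<^bsub>Qp p\<^esub> (y \<ominus>\<^bsub>Qp p\<^esub> z)"
    using assms by (simp add: a_minus_def Q.a_assoc Q.r_neg1)
  then show ?thesis
    using assms qnorm_ultra[of "x \<ominus>\<^bsub>Qp p\<^esub> y" "y \<ominus>\<^bsub>Qp p\<^esub> z"] by (simp add: qdist_eq)
qed

lemma qdist_add:
  assumes "x \<in> carrier (Qp p)" "y \<in> carrier (Qp p)" "x' \<in> carrier (Qp p)" "y' \<in> carrier (Qp p)"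
  shows "qp_dist p (x \<oplus>\<^bsub>Qp p\<^esub> y) (x' \<oplus>\<^bsub>Qp p\<^esub> y') \<le> max (qp_dist p x x') (qp_dist p y y')"
proof -
  have "(x \<oplus>\<^bsub>Qp p\<^esub> y) \<ominus>\<^bsub>Qp p\<^esub> (x' \<oplus>\<^bsub>Qp p\<^esub> y') = (x \<ominus>\<^bsub>Qp p\<^esub> x') \<oplus>\<^bsub>Qp p\<^esub> (y \<ominus>\<^bsub>Qp p\<^esub> y')"
    using assms by (simp add: a_minus_def Q.minus_add Q.a_ac)
  then show ?thesis
    using assms qnorm_ultra[of "x \<ominus>\<^bsub>Qp p\<^esub> x'" "y \<ominus>\<^bsub>Qp p\<^esub> y'"] by (simp add: qdist_eq)
qed

text \<open>The norm of a class is the limit of the norms of a representing sequence, so a term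
  beyond the Cauchy index for e/2 approximates it; halving e turns the weak inequality of the limit
  into a strict one.\<close>

lemma padic_approx:
  assumes "x \<in> carrier (Qp p)" "e > 0"
  obtains r where "qp_dist p x (of_Q r) < e"
proof -
  obtain X where X: "padic_cauchy p X" "x = cls X"
    using assms by (metis Qp_cases[OF p])
  obtain N where N: "\<And>m n. m \<ge> N \<Longrightarrow> n \<ge> N \<Longrightarrow> padic_abs p (X m - X n) < e / 2"
    using X(1) assms(2) unfolding padic_cauchy_def by (meson half_gt_zero)
  have c: "padic_cauchy p (\<lambda>n. X n - X N)"
    using cauchy_add[OF p X(1) cauchy_const[of p "- X N"]] by simp
  have "qp_dist p x (of_Q (X N)) = qnorm (cls (\<lambda>n. X n - X N))"
    using assms(1) X(2) Qp_diff[OF p X(1) cauchy_const[of p "X N"]] by (simp add: qdist_eq flip: of_Q_cls)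
  moreover have "qnorm (cls (\<lambda>n. X n - X N)) \<le> e / 2"
    using N by (intro LIMSEQ_le_const2[OF qnorm_lim[OF c]] exI[of _ N]) (auto intro: less_imp_le)
  ultimately show ?thesis
    using assms(2) by (intro that[of "X N"]) simp
qed

lemma qdist_of_Q: "qp_dist p (of_Q x) (of_Q y) = padic_abs p (x - y)"
  by (simp add: qdist_eq flip: of_Q_diff)

text \<open>A diagonal argument: each term is replaced by a rational number at distance less than
  1/(n+1); these rationals form a Cauchy sequence, whose class is the limit.\<close>

lemma mcomplete_Qp: "QM.mcomplete"
  unfolding QM.mcomplete_def
proof (intro allI impI)
  fix \<sigma> :: "nat \<Rightarrow> qp" assume \<sigma>: "QM.MCauchy \<sigma>"
  then have in_carr: "\<sigma> n \<in> carrier (Qp p)" for n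
    by (auto simp: QM.MCauchy_def)
  have "\<exists>r. qp_dist p (\<sigma> n) (of_Q r) < 1 / Suc n" for n
    using padic_approx[OF in_carr[of n], of "1 / Suc n"] by auto
  then obtain X where X: "\<And>n. qp_dist p (\<sigma> n) (of_Q (X n)) < 1 / Suc n"
    by metis
  have small: "\<exists>N. \<forall>n\<ge>N. qp_dist p (\<sigma> n) (of_Q (X n)) < e" if "e > 0" for e
  proof -
    obtain N where N: "1 / Suc N < e"
      using \<open>e > 0\<close> nat_approx_posE by blast
    have "qp_dist p (\<sigma> n) (of_Q (X n)) < e" if "n \<ge> N" for n
    proof -
      have "1 / real (Suc n) \<le> 1 / real (Suc N)"
        using that by (simp add: field_simps)
      with X[of n] N show ?thesis by linarith
    qed
    then show ?thesis by blast
  qed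
  have cauchy: "\<exists>N. \<forall>m\<ge>N. \<forall>n\<ge>N. qp_dist p (\<sigma> m) (of_Q (X n)) < e \<and> padic_abs p (X m - X n) < e" if "e > 0" for e
  proof -
    obtain N1 where N1: "\<forall>n\<ge>N1. qp_dist p (\<sigma> n) (of_Q (X n)) < e"
      using small[OF \<open>e > 0\<close>] by blast
    have "\<exists>N. \<forall>m n. N \<le> m \<longrightarrow> N \<le> n \<longrightarrow> qp_dist p (\<sigma> m) (\<sigma> n) < e"
      using \<sigma> \<open>e > 0\<close> by (simp add: QM.MCauchy_def)
    then obtain N2 where N2: "\<And>m n. N2 \<le> m \<Longrightarrow> N2 \<le> n \<Longrightarrow> qp_dist p (\<sigma> m) (\<sigma> n) < e"
      by metis
    have a: "qp_dist p (\<sigma> m) (of_Q (X n)) < e" if "m \<ge> max N1 N2" "n \<ge> max N1 N2" for m n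
      by (rule le_less_trans[OF qdist_ultra[OF in_carr[of m] in_carr[of n] of_Q_closed]]) (use N1 N2 that in simp)
    have b: "padic_abs p (X m - X n) < e" if "m \<ge> max N1 N2" "n \<ge> max N1 N2" for m n
      unfolding qdist_of_Q[symmetric]
      by (rule le_less_trans[OF qdist_ultra[OF of_Q_closed in_carr[of m] of_Q_closed]])
        (use a[OF that] a[OF that(1) that(1)] QM.commute[of "of_Q (X m)"] in simp)
    show ?thesis
      using a b by blast
  qed
  have X_cauchy: "padic_cauchy p X"
    unfolding padic_cauchy_def using cauchy by meson
  have "\<exists>N. \<forall>n\<ge>N. \<sigma> n \<in> carrier (Qp p) \<and> qp_dist p (\<sigma> n) (cls X) < e" if e: "e > 0" for e
  proof -
    obtain N where N: "\<forall>m\<ge>N. \<forall>n\<ge>N. qp_dist p (\<sigma> m) (of_Q (X n)) < e/2 \<and> padic_abs p (X m - X n) < e/2"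
      using cauchy[of "e/2"] e by auto
    have "qp_dist p (\<sigma> n) (cls X) < e" if n: "n \<ge> N" for n
    proof -
      have c: "padic_cauchy p (\<lambda>m. X m - X n)"
        using cauchy_add[OF p X_cauchy cauchy_const[of p "- X n"]] by simp
      have "qnorm (cls (\<lambda>m. X m - X n)) \<le> e/2"
        using N n by (intro LIMSEQ_le_const2[OF qnorm_lim[OF c]] exI[of _ N]) (auto intro: less_imp_le)
      then have "qp_dist p (cls X) (of_Q (X n)) \<le> e/2"
        using Qp_diff[OF p X_cauchy cauchy_const[of p "X n"]] coset_in_Qp[OF X_cauchy]
        by (simp add: qdist_eq flip: of_Q_cls)
      then show ?thesis
        by (intro le_less_trans[OF qdist_ultra[OF in_carr[of n] of_Q_closed[of "X n"] coset_in_Qp[OF X_cauchy]]])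
          (use N[rule_format, OF n n] QM.commute[of "of_Q (X n)" "cls X"] e in auto)
    qed
    then show ?thesis using in_carr by blast
  qed
  then show "\<exists>x. limitin QM.mtopology \<sigma> x sequentially"
    using coset_in_Qp[OF X_cauchy] unfolding QM.limitin_metric eventually_sequentially by blast
qed

lemma Zp_iff: "x \<in> Zp p \<longleftrightarrow> x \<in> carrier (Qp p) \<and> qnorm x \<le> 1"
  by (simp add: Zp_def)

lemma Zp_carrier: "x \<in> Zp p \<Longrightarrow> x \<in> carrier (Qp p)"
  by (simp add: Zp_def)

lemma Zp_add: "x \<in> Zp p \<Longrightarrow> y \<in> Zp p \<Longrightarrow> x \<oplus>\<^bsub>Qp p\<^esub> y \<in> Zp p"
  using qnorm_ultra[of x y] by (auto simp: Zp_iff)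

lemma Zp_zero [simp]: "\<zero>\<^bsub>Qp p\<^esub> \<in> Zp p"
  by (simp add: Zp_iff)

lemma padic_abs_int_le_1: "padic_abs p (of_int n) \<le> 1"
proof (cases "n = 0")
  case False
  have "real p \<ge> 1"
    using prime_ge_1_nat[OF p] by simp
  then show ?thesis
    using padic_abs_frac[OF p False, of 1] power_int_increasing[of "- int (multiplicity (int p) n)" 0 "real p"]
    by (simp del: power_int_minus power_int_of_nat)
qed simp

end

section \<open>Approximation by integers and compactness of the p-adic integers\<close>

context padic
begin

lemma padic_abs_p_power: "padic_abs p (of_nat p ^ n) = 1 / real p ^ n"
proof (induction n)
  case (Suc n)
  have "padic_abs p (of_int (int p)) = 1 / real p"
    using padic_abs_frac[OF p, of "int p" 1] prime_gt_0_nat[OF p] p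
    by (simp add: multiplicity_self multiplicity_unit_right power_int_minus inverse_eq_divide prime_nat_iff not_prime_unit)
  then show ?case
    using Suc by (simp add: padic_abs_mult[OF p])
qed simp

lemma padic_abs_dvd:
  assumes "int p ^ n dvd a" shows "padic_abs p (of_int a) \<le> 1 / real p ^ n"
proof -
  obtain k where "a = int p ^ n * k"
    using assms by blast
  then show ?thesis
    using padic_abs_int_le_1[of k] by (simp add: padic_abs_mult[OF p] padic_abs_p_power divide_right_mono)
qed

lemma padic_abs_coprime:
  assumes "\<not> int p dvd a" shows "padic_abs p (of_int a) = 1"
proof -
  have "a \<noteq> 0"
    using assms by auto
  then show ?thesis
    using padic_abs_frac[OF p, of a 1] assms by (simp add: not_dvd_imp_multiplicity_0)
qed

text \<open>In lowest terms, a denominator divisible by p leaves a numerator of absolute value 1,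
  and then the quotient would have absolute value greater than 1.\<close>

lemma padic_integer_denom:
  assumes "padic_abs p x \<le> 1" shows "\<not> int p dvd snd (quotient_of x)"
proof
  obtain a b where ab: "quotient_of x = (a, b)" by fastforce
  have b: "b > 0" and x: "x = of_int a / of_int b" and cop: "coprime a b"
    using ab quotient_of_denom_pos quotient_of_div quotient_of_coprime by blast+
  assume "int p dvd snd (quotient_of x)"
  then have pb: "int p dvd b" by (simp add: ab)
  have pa: "\<not> int p dvd a"
    using pb cop p by (meson coprime_common_divisor not_prime_unit prime_nat_int_transfer)
  then have "a \<noteq> 0" by auto
  have "padic_abs p (of_int b) < 1"
    by (rule le_less_trans[OF padic_abs_dvd[of 1 b]]) (use pb prime_gt_1_nat[OF p] in simp_all)
  moreover have "padic_abs p x * padic_abs p (of_int b) = 1"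
    using x b padic_abs_coprime[OF pa] by (simp flip: padic_abs_mult[OF p])
  ultimately show False
    using mult_right_mono[OF assms padic_abs_nonneg[of p "of_int b"]] by simp
qed

lemma padic_integer_frac:
  assumes "padic_abs p x \<le> 1"
  obtains a b where "x = of_int a / of_int b" "b > 0" "\<not> int p dvd b"
  using padic_integer_denom[OF assms] quotient_of_denom_pos[of x] quotient_of_div[of x]
  by (cases "quotient_of x") auto

text \<open>For x = a/b with b prime to p, the residue is a times an inverse u of b modulo p^n;
  multiplication by b, a p-adic unit, does not change the distance to x.\<close>

lemma padic_integer_mod_power:
  assumes "padic_abs p x \<le> 1"
  obtains c :: int where "0 \<le> c" "c < int p ^ n" "padic_abs p (x - of_int c) \<le> 1 / real p ^ n"
proof -
  obtain a b where ab: "x = of_int a / of_int b" "b > 0" "\<not> int p dvd b"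
    using padic_integer_frac[OF assms] by blast
  have "coprime b (int p ^ n)"
    using prime_imp_coprime[of "int p" b] ab(3) p by (simp add: coprime_commute)
  then obtain u where "[b * u = 1] (mod int p ^ n)"
    using cong_solve_coprime_int by blast
  then have "[b * (u * a) = 1 * a] (mod int p ^ n)"
    unfolding mult.assoc[symmetric] by (rule cong_mult) simp
  moreover have "[b * (u * a) = b * (u * a mod int p ^ n)] (mod int p ^ n)"
    by (intro cong_mult) (auto simp: cong_def)
  ultimately have "int p ^ n dvd a - b * (u * a mod int p ^ n)"
    by (metis cong_sym cong_trans cong_iff_dvd_diff mult_1)
  then have "padic_abs p (of_int (a - b * (u * a mod int p ^ n))) \<le> 1 / real p ^ n"
    by (rule padic_abs_dvd)
  also have "of_int (a - b * (u * a mod int p ^ n)) = of_int b * (x - of_int (u * a mod int p ^ n))"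
    using ab by (simp add: right_diff_distrib)
  finally have "padic_abs p (x - of_int (u * a mod int p ^ n)) \<le> 1 / real p ^ n"
    by (simp only: padic_abs_mult[OF p] padic_abs_coprime[OF ab(3)] mult_1)
  then show ?thesis
    using prime_gt_0_nat[OF p] by (intro that[of "u * a mod int p ^ n"]) auto
qed

lemma p_power_small: assumes "e > 0" obtains n where "1 / real p ^ n < e"
  using real_arch_pow_inv[OF assms, of "1 / real p"] prime_gt_1_nat[OF p] by (auto simp: power_one_over)

text \<open>A rational number close to a p-adic integer is itself p-integral by the ultrametric
  inequality, so it can be reduced modulo p^n.\<close>

lemma Zp_approx:
  assumes "x \<in> Zp p"
  obtains c :: int where "0 \<le> c" "c < int p ^ n" "qp_dist p x (of_Q (of_int c)) \<le> 1 / real p ^ n"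
proof -
  have pos: "1 / real p ^ n > 0"
    using prime_gt_0_nat[OF p] by simp
  have le1: "1 / real p ^ n \<le> 1"
    using prime_ge_1_nat[OF p] by (simp add: divide_le_eq_1)
  obtain r where r: "qp_dist p x (of_Q r) < 1 / real p ^ n"
    using padic_approx[OF Zp_carrier[OF assms] pos] by blast
  have "qp_dist p \<zero>\<^bsub>Qp p\<^esub> (of_Q r) \<le> max (qp_dist p \<zero>\<^bsub>Qp p\<^esub> x) (qp_dist p x (of_Q r))"
    by (rule qdist_ultra) (use Zp_carrier[OF assms] in auto)
  then have "padic_abs p (0 - r) \<le> 1"
    using r le1 assms Zp_carrier[OF assms] qdist_of_Q[of 0 r] QM.commute[of _ x]
    by (auto simp: Zp_iff qdist_eq[of x] a_minus_def)
  then obtain c where c: "0 \<le> c" "c < int p ^ n" "padic_abs p (r - of_int c) \<le> 1 / real p ^ n"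
    using padic_integer_mod_power[of r n] by (auto simp: padic_abs_minus[OF p])
  have "qp_dist p x (of_Q (of_int c)) \<le> 1 / real p ^ n"
    by (rule order_trans[OF qdist_ultra[of _ "of_Q r"]]) (use c r Zp_carrier[OF assms] in \<open>auto simp: qdist_of_Q\<close>)
  with c that show ?thesis by blast
qed

lemma closedin_Zp: "closedin QM.mtopology (Zp p)"
proof -
  have "Zp p = QM.mcball \<zero>\<^bsub>Qp p\<^esub> 1"
    using QM.commute by (auto simp: Zp_iff QM.mcball_def QM.commute[of "\<zero>\<^bsub>Qp p\<^esub>"] qdist_eq a_minus_def)
  then show ?thesis
    by (simp add: QM.closedin_mcball)
qed

text \<open>In a complete space a closed totally bounded set is compact; the residues modulo p^n
  form a finite net of mesh 1/p^n.\<close>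

lemma compactin_Zp: "compactin QM.mtopology (Zp p)"
proof -
  have "QM.mtotally_bounded (Zp p)"
    unfolding QM.mtotally_bounded_def
  proof (intro allI impI)
    fix e :: real assume "e > 0"
    then obtain n where n: "1 / real p ^ n < e"
      by (rule p_power_small)
    let ?K = "(\<lambda>c. of_Q (of_int c)) ` {0..<int p ^ n}"
    have "Zp p \<subseteq> (\<Union>x\<in>?K. QM.mball x e)"
    proof
      fix x assume x: "x \<in> Zp p"
      obtain c where "0 \<le> c" "c < int p ^ n" "qp_dist p x (of_Q (of_int c)) \<le> 1 / real p ^ n"
        by (rule Zp_approx[OF x])
      with n Zp_carrier[OF x] show "x \<in> (\<Union>x\<in>?K. QM.mball x e)"
        by (auto simp: QM.commute intro!: bexI[of _ c])
    qed
    moreover have "?K \<subseteq> Zp p"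
      by (auto simp: Zp_iff padic_abs_int_le_1)
    ultimately show "\<exists>K. finite K \<and> K \<subseteq> Zp p \<and> Zp p \<subseteq> (\<Union>x\<in>K. QM.mball x e)"
      by (intro exI[of _ ?K]) simp
  qed
  then show ?thesis
    using QM.mtotally_bounded_eq_compact_closure_of[OF mcomplete_Qp, of "Zp p"] closure_of_closedin[OF closedin_Zp]
    by simp
qed

end

section \<open>The topology of the completions of a lattice\<close>

text \<open>Only coordinates: the completions are powers of Q_p and Z_p indexed by a finite set. The
  rational vector space itself enters with \<open>lattice_space\<close>.\<close>

locale padic_lattice = padic p for p +
  fixes B :: "'v set"
  assumes finite_B: "finite B"
begin

abbreviation "V \<equiv> V_at B p"
abbreviation "L \<equiv> L_at B p"
abbreviation vadd (infixl "\<boxplus>" 65) where "vadd \<equiv> V_add B p"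

text \<open>The sup metric enters only through this relation. By the ultrametric inequality it is,
  for fixed d > 0, an equivalence relation on V_p, whose classes are the balls of radius d.\<close>

definition near :: "real \<Rightarrow> ('v \<Rightarrow> qp) \<Rightarrow> ('v \<Rightarrow> qp) \<Rightarrow> bool" where
  "near d x y \<longleftrightarrow> (\<forall>b\<in>B. qp_dist p (x b) (y b) < d)"

lemma L_subset_V: "L \<subseteq> V"
  unfolding L_at_def V_at_def by (rule PiE_mono) (auto simp: Zp_iff)

lemma V_comp: "x \<in> V \<Longrightarrow> b \<in> B \<Longrightarrow> x b \<in> carrier (Qp p)"
  by (auto simp: V_at_def)

lemma near_sym: "near d x y \<Longrightarrow> near d y x"
  by (simp add: near_def QM.commute)

lemma near_refl: "d > 0 \<Longrightarrow> x \<in> V \<Longrightarrow> near d x x"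
  by (simp add: near_def V_comp)

lemma near_trans: "near d x y \<Longrightarrow> near d y z \<Longrightarrow> x \<in> V \<Longrightarrow> y \<in> V \<Longrightarrow> z \<in> V \<Longrightarrow> near d x z"
  unfolding near_def using V_comp by (auto intro!: le_less_trans[OF qdist_ultra[of _ "y b" for b]])

lemma near_mono: "near d x y \<Longrightarrow> d \<le> d' \<Longrightarrow> near d' x y"
  unfolding near_def by (meson less_le_trans)

lemma L_add_closed: "x \<in> L \<Longrightarrow> y \<in> L \<Longrightarrow> x \<boxplus> y \<in> L"
  by (auto simp: L_at_def V_add_def intro: Zp_add)

lemma near_add: "near d x x' \<Longrightarrow> near d y y' \<Longrightarrow> x \<in> V \<Longrightarrow> y \<in> V \<Longrightarrow> x' \<in> V \<Longrightarrow> y' \<in> V \<Longrightarrow> near d (x \<boxplus> y) (x' \<boxplus> y')"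
  unfolding near_def V_add_def
  by (auto intro!: le_less_trans[OF qdist_add] simp: V_comp)

lemma V_Int_L [simp]: "V \<inter> L = L"
  using L_subset_V by blast

lemma topspace_V_top [simp]: "topspace (V_top B p) = V"
  by (simp add: V_top_def V_at_def qtop_eq)

lemma openin_near_ball:
  assumes "x \<in> V" shows "openin (V_top B p) {y \<in> V. near r x y}"
proof -
  have "{y \<in> V. near r x y} = (\<Pi>\<^sub>E b\<in>B. QM.mball (x b) r)"
    using V_comp[OF assms] by (simp add: V_at_def near_def set_eq_iff PiE_iff) blast
  then show ?thesis
    using assms finite_B by (simp add: V_top_def qtop_eq openin_PiE_gen)
qed

text \<open>Trades the product topology for the relation \<open>near\<close>: a basic open set
  restricts each coordinate, and since \<open>B\<close> is finite there is a smallest one among the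
  coordinate radii.\<close>

lemma openin_V_top_iff:
  "openin (V_top B p) U \<longleftrightarrow> U \<subseteq> V \<and> (\<forall>x\<in>U. \<exists>r>0. \<forall>y\<in>V. near r x y \<longrightarrow> y \<in> U)"
proof
  assume U: "openin (V_top B p) U"
  then have sub: "U \<subseteq> V"
    using openin_subset topspace_V_top by metis
  moreover have "\<exists>r>0. \<forall>y\<in>V. near r x y \<longrightarrow> y \<in> U" if x: "x \<in> U" for x
  proof -
    obtain W where W: "\<forall>b\<in>B. openin QM.mtopology (W b)" "x \<in> Pi\<^sub>E B W" "Pi\<^sub>E B W \<subseteq> U"
      using U x unfolding V_top_def openin_product_topology_alt qtop_eq by meson
    have "\<exists>r>0. QM.mball (x b) r \<subseteq> W b" if "b \<in> B" for b
      using W that by (auto simp: QM.openin_mtopology PiE_iff)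
    then obtain r where r: "\<And>b. b \<in> B \<Longrightarrow> r b > 0" "\<And>b. b \<in> B \<Longrightarrow> QM.mball (x b) (r b) \<subseteq> W b"
      by meson
    \<comment> \<open>The extra 1 keeps the minimum meaningful when V = 0 and \<open>B\<close> is
      empty.\<close>
    define d where "d = Min (insert 1 (r ` B))"
    have d: "d > 0" "\<And>b. b \<in> B \<Longrightarrow> d \<le> r b"
      using finite_B r(1) by (auto simp: d_def)
    have "y \<in> U" if y: "y \<in> V" "near d x y" for y
    proof -
      have "y b \<in> W b" if "b \<in> B" for b
      proof -
        have "y b \<in> QM.mball (x b) (r b)"
          using y d(2)[OF that] that x sub V_comp[of _ b] by (auto simp: near_def intro: less_le_trans)
        then show ?thesis
          using r(2)[OF that] by blast
      qed
      then show ?thesis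
        using W(3) y(1) by (auto simp: V_at_def)
    qed
    then show ?thesis using d(1) by blast
  qed
  ultimately show "U \<subseteq> V \<and> (\<forall>x\<in>U. \<exists>r>0. \<forall>y\<in>V. near r x y \<longrightarrow> y \<in> U)"
    by blast
next
  assume *: "U \<subseteq> V \<and> (\<forall>x\<in>U. \<exists>r>0. \<forall>y\<in>V. near r x y \<longrightarrow> y \<in> U)"
  show "openin (V_top B p) U"
  proof (subst openin_subopen, intro ballI)
    fix x assume x: "x \<in> U"
    with * obtain r where "r > 0" "\<forall>y\<in>V. near r x y \<longrightarrow> y \<in> U" by blast
    then show "\<exists>T. openin (V_top B p) T \<and> x \<in> T \<and> T \<subseteq> U"
      using openin_near_ball[of x r] near_refl[of r x] x *
      by (intro exI[of _ "{y \<in> V. near r x y}"]) auto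
  qed
qed

text \<open>Lebesgue numbers: by the ultrametric inequality, points at distance less than \<open>d\<close> lie in a common ball.\<close>

lemma compactin_near_cover:
  assumes K: "compactin (V_top B p) K" and r: "\<And>x. x \<in> K \<Longrightarrow> r x > 0"
  obtains d F where "d > 0" "finite F" "F \<subseteq> K"
    "\<And>x. x \<in> K \<Longrightarrow> \<exists>z\<in>F. near (r z) z x \<and> d \<le> r z"
proof -
  have KV: "K \<subseteq> V"
    using compactin_subset_topspace[OF K] topspace_V_top by simp
  let ?U = "(\<lambda>z. {y \<in> V. near (r z) z y}) ` K"
  have "\<exists>\<F>. finite \<F> \<and> \<F> \<subseteq> ?U \<and> K \<subseteq> \<Union>\<F>"
  proof (rule compactinD[OF K])
    show "openin (V_top B p) W" if "W \<in> ?U" for W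
      using that KV openin_near_ball by auto
    show "K \<subseteq> \<Union>?U"
      using KV near_refl[OF r] by (auto intro!: bexI[of _ x for x])
  qed
  then obtain \<F> where \<F>: "finite \<F>" "\<F> \<subseteq> ?U" "K \<subseteq> \<Union>\<F>"
    by blast
  obtain F where "F \<subseteq> K" "finite F" "\<F> = (\<lambda>z. {y \<in> V. near (r z) z y}) ` F"
    using finite_subset_image[OF \<F>(1,2)] by blast
  with \<F>(3) have F: "finite F" "F \<subseteq> K" "K \<subseteq> (\<Union>z\<in>F. {y \<in> V. near (r z) z y})"
    by auto
  define d where "d = Min (insert 1 (r ` F))"
  have "d > 0" "\<And>z. z \<in> F \<Longrightarrow> d \<le> r z"
    using F r by (auto simp: d_def)
  then show ?thesis
    using F by (intro that[of d F]) blast+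
qed

lemma compactin_L: "compactin (V_top B p) L"
  unfolding V_top_def L_at_def compactin_PiE qtop_eq by (simp add: compactin_Zp)

lemma V_zero_L [simp]: "V_zero B p \<in> L"
  by (auto simp: V_zero_def L_at_def)

end

section \<open>Continuous functions on the completed lattice\<close>

lemma (in abelian_group) diff_eq_zero_iff:
  assumes "x \<in> carrier G" "y \<in> carrier G"
  shows "x \<ominus> y = \<zero> \<longleftrightarrow> x = y"
proof
  assume "x \<ominus> y = \<zero>"
  moreover have "x = (x \<ominus> y) \<oplus> y"
    using assms by (simp add: a_minus_def a_assoc l_neg)
  ultimately show "x = y"
    using assms by simp
qed (use assms in \<open>simp add: a_minus_def r_neg\<close>)

lemma (in abelian_monoid) finsum_swap:
  assumes "finite A" "finite C" "\<And>a c. a \<in> A \<Longrightarrow> c \<in> C \<Longrightarrow> f a c \<in> carrier G"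
  shows "(\<Oplus>a\<in>A. \<Oplus>c\<in>C. f a c) = (\<Oplus>c\<in>C. \<Oplus>a\<in>A. f a c)"
  using assms(1,3)
proof (induction A)
  case (insert a A)
  have "(\<Oplus>c\<in>C. \<Oplus>a\<in>insert a A. f a c) = (\<Oplus>c\<in>C. f a c \<oplus> (\<Oplus>a\<in>A. f a c))"
    using insert by (intro finsum_cong') (auto intro!: finsum_closed finsum_insert)
  also have "\<dots> = (\<Oplus>c\<in>C. f a c) \<oplus> (\<Oplus>c\<in>C. \<Oplus>a\<in>A. f a c)"
    using insert by (intro finsum_addf) (auto intro!: finsum_closed)
  finally show ?case
    using insert by (subst finsum_insert) (auto intro!: finsum_closed)
qed simp

context padic_lattice
begin

abbreviation "CL \<equiv> mspace (cont_space B p)"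

text \<open>\<open>cfunspace\<close> asks for boundedness besides continuity; on the compact space
  L_p the former is automatic.\<close>

lemma CL_continuous:
  "f \<in> CL \<longleftrightarrow> f \<in> L \<rightarrow>\<^sub>E carrier (Qp p) \<and>
     continuous_map (subtopology (V_top B p) L) QM.mtopology f"
proof -
  have "compactin (subtopology (V_top B p) L) (topspace (subtopology (V_top B p) L))"
    using compactin_L by (simp add: compactin_subtopology)
  from compactin_mspace_cfunspace[OF this, of "qp_metric p"] show ?thesis
    by (auto simp: cont_space_def mspace_qp_metric[OF p] qtop_eq PiE_iff)
qed

text \<open>Continuity on a compact space is uniform. With a Lebesgue number d, two d-close points
  lie in one ball around some z; both values of f are within e of the value at z, and the
  ultrametric inequality needs no halving of e.\<close>

lemma CL_iff:
  "f \<in> CL \<longleftrightarrow> f \<in> L \<rightarrow>\<^sub>E carrier (Qp p) \<and>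
     (\<forall>e>0. \<exists>d>0. \<forall>x\<in>L. \<forall>y\<in>L. near d x y \<longrightarrow> qp_dist p (f x) (f y) < e)"
  (is "_ \<longleftrightarrow> _ \<and> ?unif")
proof (cases "f \<in> L \<rightarrow>\<^sub>E carrier (Qp p)")
  case True
  then have f: "\<And>x. x \<in> L \<Longrightarrow> f x \<in> carrier (Qp p)" by auto
  have "continuous_map (subtopology (V_top B p) L) QM.mtopology f \<longleftrightarrow> ?unif"
  proof
    assume cont: "continuous_map (subtopology (V_top B p) L) QM.mtopology f"
    show ?unif
    proof (intro allI impI)
      fix e :: real assume e: "e > 0"
      have "\<exists>r>0. \<forall>y\<in>L. near r x y \<longrightarrow> qp_dist p (f x) (f y) < e" if x: "x \<in> L" for x
      proof -
        have "openin (subtopology (V_top B p) L) {y \<in> L. f y \<in> QM.mball (f x) e}"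
          using openin_continuous_map_preimage[OF cont QM.openin_mball[of "f x" e]] by simp
        then obtain T where T: "openin (V_top B p) T" "{y \<in> L. f y \<in> QM.mball (f x) e} = T \<inter> L"
          unfolding openin_subtopology by blast
        then have "x \<in> T"
          using x e f by auto
        then obtain r where "r > 0" "\<forall>y\<in>V. near r x y \<longrightarrow> y \<in> T"
          using T(1) by (auto simp: openin_V_top_iff)
        then show ?thesis
          using T(2) L_subset_V by (intro exI[of _ r]) auto
      qed
      then have "\<forall>x\<in>L. \<exists>r. r > 0 \<and> (\<forall>y\<in>L. near r x y \<longrightarrow> qp_dist p (f x) (f y) < e)"
        by blast
      from bchoice[OF this] obtain r where r: "\<And>x. x \<in> L \<Longrightarrow> r x > 0"
        "\<And>x y. x \<in> L \<Longrightarrow> y \<in> L \<Longrightarrow> near (r x) x y \<Longrightarrow> qp_dist p (f x) (f y) < e"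
        by blast
      obtain d F where dF: "d > 0" "finite F" "F \<subseteq> L" "\<And>x. x \<in> L \<Longrightarrow> \<exists>z\<in>F. near (r z) z x \<and> d \<le> r z"
        using compactin_near_cover[OF compactin_L, of r] r(1) by metis
      have "qp_dist p (f x) (f y) < e" if xy: "x \<in> L" "y \<in> L" "near d x y" for x y
      proof -
        obtain z where z: "z \<in> F" "near (r z) z x" "d \<le> r z"
          using dF(4)[OF xy(1)] by blast
        then have zL: "z \<in> L" using dF by blast
        have "near (r z) z y"
          using near_trans[OF z(2) near_mono[OF xy(3) z(3)]] zL xy L_subset_V by blast
        then have "qp_dist p (f z) (f y) < e" "qp_dist p (f z) (f x) < e"
          using r(2) zL z xy by blast+
        then show ?thesis
          by (intro le_less_trans[OF qdist_ultra[OF f[OF xy(1)] f[OF zL] f[OF xy(2)]]])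
            (simp add: QM.commute)
      qed
      then show "\<exists>d>0. \<forall>x\<in>L. \<forall>y\<in>L. near d x y \<longrightarrow> qp_dist p (f x) (f y) < e"
        using dF(1) by blast
    qed
  next
    assume unif: ?unif
    show "continuous_map (subtopology (V_top B p) L) QM.mtopology f"
      unfolding QM.continuous_map_to_metric
    proof (intro ballI allI impI)
      fix x and e :: real assume "x \<in> topspace (subtopology (V_top B p) L)" and e: "e > 0"
      then have x: "x \<in> L" by simp
      obtain d where d: "d > 0" "\<forall>x\<in>L. \<forall>y\<in>L. near d x y \<longrightarrow> qp_dist p (f x) (f y) < e"
        using unif e by blast
      have "openin (subtopology (V_top B p) L) (L \<inter> {y \<in> V. near d x y})"
        using openin_near_ball x L_subset_V by (auto intro: openin_subtopology_Int2)
      then show "\<exists>U. openin (subtopology (V_top B p) L) U \<and> x \<in> U \<and> (\<forall>y\<in>U. f y \<in> QM.mball (f x) e)"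
        using d x f near_refl L_subset_V by (intro exI[of _ "L \<inter> {y \<in> V. near d x y}"]) auto
    qed
  qed
  then show ?thesis
    by (simp add: CL_continuous)
qed (simp add: CL_continuous)

lemma CL_I:
  assumes "\<And>x. x \<in> L \<Longrightarrow> f x \<in> carrier (Qp p)"
    and "\<And>e. e > 0 \<Longrightarrow> \<exists>d>0. \<forall>x\<in>L. \<forall>y\<in>L. near d x y \<longrightarrow> qp_dist p (f x) (f y) < e"
  shows "(\<lambda>x\<in>L. f x) \<in> CL"
  unfolding CL_iff using assms by (simp add: restrict_PiE_iff)

lemma CL_carrier [simp]: "f \<in> CL \<Longrightarrow> x \<in> L \<Longrightarrow> f x \<in> carrier (Qp p)"
  by (auto simp: CL_iff)

lemma CL_ext: "f \<in> CL \<Longrightarrow> g \<in> CL \<Longrightarrow> (\<And>x. x \<in> L \<Longrightarrow> f x = g x) \<Longrightarrow> f = g"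
  unfolding CL_iff by (meson PiE_ext)

lemma CL_unif: "f \<in> CL \<Longrightarrow> e > 0 \<Longrightarrow> \<exists>d>0. \<forall>x\<in>L. \<forall>y\<in>L. near d x y \<longrightarrow> qp_dist p (f x) (f y) < e"
  by (auto simp: CL_iff)

lemma CL_add [intro]:
  assumes "f \<in> CL" "g \<in> CL" shows "(\<lambda>x\<in>L. f x \<oplus>\<^bsub>Qp p\<^esub> g x) \<in> CL"
proof (rule CL_I)
  fix e :: real assume e: "e > 0"
  obtain d1 d2 where d: "d1 > 0" "\<forall>x\<in>L. \<forall>y\<in>L. near d1 x y \<longrightarrow> qp_dist p (f x) (f y) < e"
    "d2 > 0" "\<forall>x\<in>L. \<forall>y\<in>L. near d2 x y \<longrightarrow> qp_dist p (g x) (g y) < e"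
    using CL_unif[OF assms(1) e] CL_unif[OF assms(2) e] by blast
  have "qp_dist p (f x \<oplus>\<^bsub>Qp p\<^esub> g x) (f y \<oplus>\<^bsub>Qp p\<^esub> g y) < e"
    if "x \<in> L" "y \<in> L" "near (min d1 d2) x y" for x y
    using d that near_mono[OF that(3)] assms by (intro le_less_trans[OF qdist_add]) auto
  then show "\<exists>d>0. \<forall>x\<in>L. \<forall>y\<in>L. near d x y \<longrightarrow>
      qp_dist p (f x \<oplus>\<^bsub>Qp p\<^esub> g x) (f y \<oplus>\<^bsub>Qp p\<^esub> g y) < e"
    using d by (intro exI[of _ "min d1 d2"]) auto
qed (use assms in simp)

lemma CL_const: "c \<in> carrier (Qp p) \<Longrightarrow> (\<lambda>x\<in>L. c) \<in> CL"
  by (rule CL_I) (auto intro!: exI[of _ 1])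

lemma qdist_scale:
  assumes "c \<in> carrier (Qp p)" "x \<in> carrier (Qp p)" "y \<in> carrier (Qp p)"
  shows "qp_dist p (c \<otimes>\<^bsub>Qp p\<^esub> x) (c \<otimes>\<^bsub>Qp p\<^esub> y) = qnorm c * qp_dist p x y"
proof -
  have "c \<otimes>\<^bsub>Qp p\<^esub> x \<ominus>\<^bsub>Qp p\<^esub> c \<otimes>\<^bsub>Qp p\<^esub> y = c \<otimes>\<^bsub>Qp p\<^esub> (x \<ominus>\<^bsub>Qp p\<^esub> y)"
    using assms by (simp add: a_minus_def Q.r_distr Q.r_minus)
  then show ?thesis
    using assms by (simp add: qdist_eq qnorm_mult)
qed

lemma CL_scale [intro]:
  assumes c: "c \<in> carrier (Qp p)" and f: "f \<in> CL" shows "(\<lambda>x\<in>L. c \<otimes>\<^bsub>Qp p\<^esub> f x) \<in> CL"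
proof (rule CL_I)
  fix e :: real assume e: "e > 0"
  \<comment> \<open>The norm of c may be 0; with 1 added it can serve as a divisor.\<close>
  have pos: "qnorm c + 1 > 0"
    using qnorm_nonneg[OF c] by simp
  obtain d where d: "d > 0" "\<forall>x\<in>L. \<forall>y\<in>L. near d x y \<longrightarrow> qp_dist p (f x) (f y) < e / (qnorm c + 1)"
    using CL_unif[OF f, of "e / (qnorm c + 1)"] e pos by auto
  have "qp_dist p (c \<otimes>\<^bsub>Qp p\<^esub> f x) (c \<otimes>\<^bsub>Qp p\<^esub> f y) < e" if "x \<in> L" "y \<in> L" "near d x y" for x y
  proof -
    have "qp_dist p (f x) (f y) < e / (qnorm c + 1)"
      using d that by blast
    then have "(qnorm c + 1) * qp_dist p (f x) (f y) < e"
      using pos by (simp add: field_simps)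
    moreover have "qnorm c * qp_dist p (f x) (f y) \<le> (qnorm c + 1) * qp_dist p (f x) (f y)"
      by (intro mult_right_mono) auto
    ultimately show ?thesis
      using that c f by (simp add: qdist_scale)
  qed
  then show "\<exists>d>0. \<forall>x\<in>L. \<forall>y\<in>L. near d x y \<longrightarrow> qp_dist p (c \<otimes>\<^bsub>Qp p\<^esub> f x) (c \<otimes>\<^bsub>Qp p\<^esub> f y) < e"
    using d(1) by blast
qed (use assms in simp)

definition transl :: "('v \<Rightarrow> qp) \<Rightarrow> 'v func \<Rightarrow> 'v func" where
  "transl v f = (\<lambda>w\<in>L. f (v \<boxplus> w))"

lemma near_L_refl: "d > 0 \<Longrightarrow> x \<in> L \<Longrightarrow> near d x x"
  using near_refl L_subset_V by blast

lemma near_L_add: "near d x x' \<Longrightarrow> near d y y' \<Longrightarrow> x \<in> L \<Longrightarrow> y \<in> L \<Longrightarrow> x' \<in> L \<Longrightarrow> y' \<in> L \<Longrightarrow> near d (x \<boxplus> y) (x' \<boxplus> y')"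
  using near_add L_subset_V by (meson subset_iff)

lemma CL_transl [intro]:
  assumes v: "v \<in> L" and f: "f \<in> CL" shows "transl v f \<in> CL"
  unfolding transl_def
proof (rule CL_I)
  fix e :: real assume e: "e > 0"
  obtain d where d: "d > 0" "\<forall>x\<in>L. \<forall>y\<in>L. near d x y \<longrightarrow> qp_dist p (f x) (f y) < e"
    using CL_unif[OF f e] by auto
  then show "\<exists>d>0. \<forall>x\<in>L. \<forall>y\<in>L. near d x y \<longrightarrow> qp_dist p (f (v \<boxplus> x)) (f (v \<boxplus> y)) < e"
    using near_L_add near_L_refl L_add_closed v by (intro exI[of _ d]) simp
qed (use assms L_add_closed in simp)

lemma transl_apply [simp]: "w \<in> L \<Longrightarrow> transl v f w = f (v \<boxplus> w)"
  by (simp add: transl_def)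

lemma V_add_comm: "x \<in> V \<Longrightarrow> y \<in> V \<Longrightarrow> x \<boxplus> y = y \<boxplus> x"
  unfolding V_add_def by (auto intro!: restrict_ext simp: V_comp Q.a_comm)

lemma V_add_assoc: "x \<in> V \<Longrightarrow> y \<in> V \<Longrightarrow> z \<in> V \<Longrightarrow> x \<boxplus> y \<boxplus> z = x \<boxplus> (y \<boxplus> z)"
  unfolding V_add_def by (auto intro!: restrict_ext simp: V_comp Q.a_assoc)

lemma V_add_zero [simp]: "x \<in> V \<Longrightarrow> V_zero B p \<boxplus> x = x" "x \<in> V \<Longrightarrow> x \<boxplus> V_zero B p = x"
  unfolding V_add_def V_zero_def V_at_def by (auto simp: PiE_iff extensional_def fun_eq_iff)

lemma L_in_V: "x \<in> L \<Longrightarrow> x \<in> V"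
  using L_subset_V by blast

lemma transl_transl: "v \<in> L \<Longrightarrow> w \<in> L \<Longrightarrow> transl w (transl v f) = transl (v \<boxplus> w) f"
  unfolding transl_def by (auto intro!: restrict_ext simp: L_add_closed V_add_assoc L_in_V)

lemma transl_zero: "f \<in> CL \<Longrightarrow> transl (V_zero B p) f = f"
  by (rule CL_ext) (auto simp: L_in_V)

text \<open>For \<open>d > 0\<close> the balls of radius \<open>d\<close> form a finite partition of \<open>L\<^sub>p\<close>; \<open>r\<close> picks their centres.\<close>

definition is_step :: "real \<Rightarrow> (('v \<Rightarrow> qp) \<Rightarrow> 'v \<Rightarrow> qp) \<Rightarrow> bool" where
  "is_step d r \<longleftrightarrow> d > 0 \<and> r \<in> L \<rightarrow> L \<and> finite (r ` L) \<and> (\<forall>x\<in>L. near d x (r x)) \<and>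
     (\<forall>x\<in>L. \<forall>y\<in>L. near d x y \<longrightarrow> r x = r y)"

text \<open>Finitely many balls cover L_p. The centre is chosen by a description that depends only
  on the ball: d-close points have the same candidates z, hence the same choice.\<close>

lemma step_exists:
  assumes "d > 0" obtains r where "is_step d r"
proof -
  obtain e F where F: "e > 0" "finite F" "F \<subseteq> L" "\<And>x. x \<in> L \<Longrightarrow> \<exists>z\<in>F. near d z x \<and> e \<le> d"
    using compactin_near_cover[OF compactin_L, of "\<lambda>_. d"] assms by metis
  define r where "r x = (SOME z. z \<in> F \<and> near d z x)" for x
  have r: "r x \<in> F \<and> near d (r x) x" if "x \<in> L" for x
    unfolding r_def using someI_ex[of "\<lambda>z. z \<in> F \<and> near d z x"] F(4)[OF that] by blast
  have const: "r x = r y" if "x \<in> L" "y \<in> L" "near d x y" for x y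
  proof -
    have "z \<in> F \<and> near d z x \<longleftrightarrow> z \<in> F \<and> near d z y" for z
      using near_trans[of d z x y] near_trans[of d z y x] near_sym[OF that(3)] that F(3) L_in_V by blast
    then show ?thesis by (simp add: r_def)
  qed
  show ?thesis
  proof (rule that[of r], unfold is_step_def, intro conjI ballI impI)
    show "finite (r ` L)"
      using r by (intro finite_subset[OF _ F(2)]) blast
    show "r \<in> L \<rightarrow> L"
      using r F(3) by blast
    show "near d x (r x)" if "x \<in> L" for x
      using near_sym r[OF that] by blast
  qed (rule assms, rule const)
qed

lemma step_L: "is_step d r \<Longrightarrow> x \<in> L \<Longrightarrow> r x \<in> L"
  unfolding is_step_def by auto

definition loc_const :: "real \<Rightarrow> 'v func \<Rightarrow> bool" where
  "loc_const d g \<longleftrightarrow> d > 0 \<and> g \<in> L \<rightarrow>\<^sub>E carrier (Qp p) \<and> (\<forall>x\<in>L. \<forall>y\<in>L. near d x y \<longrightarrow> g x = g y)"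

lemma loc_const_CL: "loc_const d g \<Longrightarrow> g \<in> CL"
  unfolding loc_const_def CL_iff by (auto simp: PiE_iff intro!: exI[of _ d])

definition ind :: "(('v \<Rightarrow> qp) \<Rightarrow> 'v \<Rightarrow> qp) \<Rightarrow> ('v \<Rightarrow> qp) \<Rightarrow> 'v func" where
  "ind r c = (\<lambda>x\<in>L. if r x = c then \<one>\<^bsub>Qp p\<^esub> else \<zero>\<^bsub>Qp p\<^esub>)"

lemma ind_CL: "is_step d r \<Longrightarrow> ind r c \<in> CL"
  by (rule loc_const_CL[of d]) (auto simp: loc_const_def is_step_def ind_def restrict_PiE_iff)

text \<open>A finite combination of indicators of balls, so that linearity alone evaluates a measure
  on \<open>g\<close>.\<close>

lemma loc_const_expand:
  assumes "loc_const d g" "is_step d r"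
  shows "g = (\<lambda>x\<in>L. \<Oplus>\<^bsub>Qp p\<^esub>c\<in>r ` L. g c \<otimes>\<^bsub>Qp p\<^esub> ind r c x)"
proof (rule ext)
  fix x show "g x = (\<lambda>x\<in>L. \<Oplus>\<^bsub>Qp p\<^esub>c\<in>r ` L. g c \<otimes>\<^bsub>Qp p\<^esub> ind r c x) x"
  proof (cases "x \<in> L")
    case True
    have g: "g c \<in> carrier (Qp p)" if "c \<in> r ` L" for c
      using that assms step_L[OF assms(2)] by (auto simp: loc_const_def)
    have "(\<Oplus>\<^bsub>Qp p\<^esub>c\<in>r ` L. g c \<otimes>\<^bsub>Qp p\<^esub> ind r c x) = (\<Oplus>\<^bsub>Qp p\<^esub>c\<in>r ` L. if r x = c then g c else \<zero>\<^bsub>Qp p\<^esub>)"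
      using True g by (intro Q.finsum_cong') (auto simp: ind_def)
    also have "\<dots> = g (r x)"
      using True g assms by (intro Q.finsum_singleton) (auto simp: is_step_def)
    also have "\<dots> = g x"
      using True assms step_L[OF assms(2) True] near_sym unfolding loc_const_def is_step_def by metis
    finally show ?thesis using True by simp
  next
    case False
    then show ?thesis using assms by (auto simp: loc_const_def)
  qed
qed

end

section \<open>The convolution ring of measures\<close>

context padic_lattice
begin

abbreviation "M \<equiv> measure_ring B p"
abbreviation conv (infixl "\<star>" 70) where "conv \<equiv> convolution B p"
abbreviation "delta \<equiv> dirac B p"

lemma dist_CL_le:
  assumes "f \<in> CL" "g \<in> CL"
  shows "mdist (cont_space B p) f g \<le> e \<longleftrightarrow> (\<forall>x\<in>L. qnorm (f x \<ominus>\<^bsub>Qp p\<^esub> g x) \<le> e)"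
proof -
  have "L \<noteq> {}"
    using V_zero_L by blast
  then show ?thesis
    using cfunspace_mdist_le[of f "subtopology (V_top B p) L" "qp_metric p" g e] assms
    by (simp add: cont_space_def mdist_qp_metric[OF p] qdist_eq CL_carrier[unfolded cont_space_def])
qed

lemma CL_zero: "(\<lambda>x\<in>L. \<zero>\<^bsub>Qp p\<^esub>) \<in> CL"
  by (rule CL_const) simp

lemma CL_diff: "f \<in> CL \<Longrightarrow> g \<in> CL \<Longrightarrow> (\<lambda>x\<in>L. f x \<ominus>\<^bsub>Qp p\<^esub> g x) \<in> CL"
proof -
  assume fg: "f \<in> CL" "g \<in> CL"
  have "(\<lambda>x\<in>L. f x \<oplus>\<^bsub>Qp p\<^esub> (\<lambda>x\<in>L. \<ominus>\<^bsub>Qp p\<^esub> \<one>\<^bsub>Qp p\<^esub> \<otimes>\<^bsub>Qp p\<^esub> g x) x) \<in> CL"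
    using fg by (intro CL_add CL_scale) auto
  moreover have "(\<lambda>x\<in>L. f x \<oplus>\<^bsub>Qp p\<^esub> (\<lambda>x\<in>L. \<ominus>\<^bsub>Qp p\<^esub> \<one>\<^bsub>Qp p\<^esub> \<otimes>\<^bsub>Qp p\<^esub> g x) x) = (\<lambda>x\<in>L. f x \<ominus>\<^bsub>Qp p\<^esub> g x)"
    using fg by (auto simp: a_minus_def Q.l_minus intro!: restrict_ext)
  ultimately show ?thesis by simp
qed

lemma measure_carrier: "is_measure B p \<mu> \<Longrightarrow> f \<in> CL \<Longrightarrow> \<mu> f \<in> carrier (Qp p)"
  by (auto simp: is_measure_def)

lemma measure_add:
  "is_measure B p \<mu> \<Longrightarrow> f \<in> CL \<Longrightarrow> g \<in> CL \<Longrightarrow> \<mu> (\<lambda>x\<in>L. f x \<oplus>\<^bsub>Qp p\<^esub> g x) = \<mu> f \<oplus>\<^bsub>Qp p\<^esub> \<mu> g"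
  by (simp add: is_measure_def)

lemma measure_scale:
  "is_measure B p \<mu> \<Longrightarrow> c \<in> carrier (Qp p) \<Longrightarrow> f \<in> CL \<Longrightarrow> \<mu> (\<lambda>x\<in>L. c \<otimes>\<^bsub>Qp p\<^esub> f x) = c \<otimes>\<^bsub>Qp p\<^esub> \<mu> f"
  by (simp add: is_measure_def)

text \<open>Stated for additive maps, because it serves to characterise continuity in
  \<open>is_measure_iff\<close>, where \<mu> is not yet known to be a measure.\<close>

lemma linear_diff:
  assumes car: "\<And>f. f \<in> CL \<Longrightarrow> \<mu> f \<in> carrier (Qp p)"
    and add: "\<And>f g. f \<in> CL \<Longrightarrow> g \<in> CL \<Longrightarrow> \<mu> (\<lambda>x\<in>L. f x \<oplus>\<^bsub>Qp p\<^esub> g x) = \<mu> f \<oplus>\<^bsub>Qp p\<^esub> \<mu> g"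
    and fg: "f \<in> CL" "g \<in> CL"
  shows "\<mu> (\<lambda>x\<in>L. f x \<ominus>\<^bsub>Qp p\<^esub> g x) = \<mu> f \<ominus>\<^bsub>Qp p\<^esub> \<mu> g"
proof -
  let ?h = "\<lambda>x\<in>L. f x \<ominus>\<^bsub>Qp p\<^esub> g x"
  have "(\<lambda>x\<in>L. ?h x \<oplus>\<^bsub>Qp p\<^esub> g x) = f"
    using fg by (intro CL_ext CL_add CL_diff) (auto simp: a_minus_def Q.a_assoc Q.l_neg)
  then have "\<mu> f = \<mu> ?h \<oplus>\<^bsub>Qp p\<^esub> \<mu> g"
    using add[of ?h g] fg CL_diff by simp
  then show ?thesis
    using car fg CL_diff[OF fg] by (simp add: a_minus_def Q.a_assoc Q.r_neg)
qed

text \<open>An additive map is continuous as soon as it is continuous at 0, since differences of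
  values are values at differences. The bound in terms of norms replaces the metric of the function
  space from here on.\<close>

lemma is_measure_iff:
  "is_measure B p \<mu> \<longleftrightarrow>
     \<mu> \<in> CL \<rightarrow>\<^sub>E carrier (Qp p) \<and>
     (\<forall>f\<in>CL. \<forall>g\<in>CL. \<mu> (\<lambda>x\<in>L. f x \<oplus>\<^bsub>Qp p\<^esub> g x) = \<mu> f \<oplus>\<^bsub>Qp p\<^esub> \<mu> g) \<and>
     (\<forall>c\<in>carrier (Qp p). \<forall>f\<in>CL. \<mu> (\<lambda>x\<in>L. c \<otimes>\<^bsub>Qp p\<^esub> f x) = c \<otimes>\<^bsub>Qp p\<^esub> \<mu> f) \<and>
     (\<forall>e>0. \<exists>d>0. \<forall>f\<in>CL. (\<forall>x\<in>L. qnorm (f x) \<le> d) \<longrightarrow> qnorm (\<mu> f) \<le> e)"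
  (is "_ \<longleftrightarrow> ?A \<and> ?add \<and> ?scale \<and> ?bd")
proof (cases "?A \<and> ?add \<and> ?scale")
  case True
  then have A: "\<And>f. f \<in> CL \<Longrightarrow> \<mu> f \<in> carrier (Qp p)"
    and add: "\<And>f g. f \<in> CL \<Longrightarrow> g \<in> CL \<Longrightarrow> \<mu> (\<lambda>x\<in>L. f x \<oplus>\<^bsub>Qp p\<^esub> g x) = \<mu> f \<oplus>\<^bsub>Qp p\<^esub> \<mu> g"
    by auto
  let ?D = "mdist (cont_space B p)"
  interpret C: Metric_space CL ?D
    by (rule Metric_space_mspace_mdist)
  have eqtop: "mtopology_of (cont_space B p) = C.mtopology"
    by (simp add: mtopology_of_def)
  have cont: "continuous_map (mtopology_of (cont_space B p)) (mtopology_of (qp_metric p)) \<mu> \<longleftrightarrow>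
      (\<forall>f\<in>CL. \<forall>e>0. \<exists>d>0. \<forall>g. g \<in> CL \<and> ?D f g < d \<longrightarrow> qp_dist p (\<mu> f) (\<mu> g) < e)"
    unfolding qtop_eq eqtop
    using C.metric_continuous_map[OF QM.Metric_space_axioms, of \<mu>] A by (auto simp: image_subset_iff)
  also have "\<dots> \<longleftrightarrow> ?bd"
  proof
    assume *: "\<forall>f\<in>CL. \<forall>e>0. \<exists>d>0. \<forall>g. g \<in> CL \<and> ?D f g < d \<longrightarrow> qp_dist p (\<mu> f) (\<mu> g) < e"
    show ?bd
    proof (intro allI impI)
      fix e :: real assume "e > 0"
      let ?z = "\<lambda>x\<in>L. \<zero>\<^bsub>Qp p\<^esub>"
      obtain d where d: "d > 0" "\<And>g. g \<in> CL \<Longrightarrow> ?D ?z g < d \<Longrightarrow> qp_dist p (\<mu> ?z) (\<mu> g) < e"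
        using * CL_zero \<open>e > 0\<close> by meson
      have "qnorm (\<mu> f) \<le> e" if f: "f \<in> CL" "\<forall>x\<in>L. qnorm (f x) \<le> d / 2" for f
      proof -
        have "(\<lambda>x\<in>L. f x \<ominus>\<^bsub>Qp p\<^esub> f x) = ?z"
          using f(1) by (intro restrict_ext) (simp add: Q.diff_eq_zero_iff)
        moreover have "\<mu> (\<lambda>x\<in>L. f x \<ominus>\<^bsub>Qp p\<^esub> f x) = \<mu> f \<ominus>\<^bsub>Qp p\<^esub> \<mu> f"
          by (rule linear_diff[of \<mu> f f]) (fact A add f)+
        moreover have "\<mu> f \<ominus>\<^bsub>Qp p\<^esub> \<mu> f = \<zero>\<^bsub>Qp p\<^esub>"
          using A[OF f(1)] by (simp add: Q.diff_eq_zero_iff)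
        ultimately have z: "\<mu> ?z = \<zero>\<^bsub>Qp p\<^esub>"
          by metis
        have "?D ?z f \<le> d / 2"
          using f CL_zero by (subst dist_CL_le) (auto simp: a_minus_def qnorm_minus)
        then have "?D ?z f < d"
          using d(1) by simp
        from d(2)[OF f(1) this] show ?thesis
          using A[OF f(1)] by (simp add: z qdist_eq a_minus_def qnorm_minus)
      qed
      then show "\<exists>d>0. \<forall>f\<in>CL. (\<forall>x\<in>L. qnorm (f x) \<le> d) \<longrightarrow> qnorm (\<mu> f) \<le> e"
        using d(1) by (intro exI[of _ "d/2"]) auto
    qed
  next
    assume bd: ?bd
    show "\<forall>f\<in>CL. \<forall>e>0. \<exists>d>0. \<forall>g. g \<in> CL \<and> ?D f g < d \<longrightarrow> qp_dist p (\<mu> f) (\<mu> g) < e"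
    proof (intro ballI allI impI)
      fix f and e :: real assume f: "f \<in> CL" and e: "e > 0"
      have "e / 2 > 0" using e by simp
      from bd[rule_format, OF this] obtain d where d: "d > 0" "\<forall>f\<in>CL. (\<forall>x\<in>L. qnorm (f x) \<le> d) \<longrightarrow> qnorm (\<mu> f) \<le> e / 2"
        by blast
      have "qp_dist p (\<mu> f) (\<mu> g) < e" if g: "g \<in> CL" "?D f g < d" for g
      proof -
        have "\<forall>x\<in>L. qnorm (f x \<ominus>\<^bsub>Qp p\<^esub> g x) \<le> d"
          using dist_CL_le[OF f g(1), of d] g by simp
        then have "qnorm (\<mu> (\<lambda>x\<in>L. f x \<ominus>\<^bsub>Qp p\<^esub> g x)) \<le> e / 2"
          using d(2) CL_diff[OF f g(1)] by simp
        moreover have "\<mu> (\<lambda>x\<in>L. f x \<ominus>\<^bsub>Qp p\<^esub> g x) = \<mu> f \<ominus>\<^bsub>Qp p\<^esub> \<mu> g"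
          by (rule linear_diff[of \<mu> f g]) (fact A add f g)+
        ultimately have "qnorm (\<mu> f \<ominus>\<^bsub>Qp p\<^esub> \<mu> g) \<le> e / 2"
          by metis
        then show ?thesis
          unfolding qdist_eq[OF A[OF f] A[OF g(1)]] using e by linarith
      qed
      then show "\<exists>d>0. \<forall>g. g \<in> CL \<and> ?D f g < d \<longrightarrow> qp_dist p (\<mu> f) (\<mu> g) < e"
        using d(1) by blast
    qed
  qed
  finally show ?thesis
    using True by (simp add: is_measure_def)
qed (auto simp: is_measure_def)

lemma measure_bd:
  "is_measure B p \<mu> \<Longrightarrow> e > 0 \<Longrightarrow> \<exists>d>0. \<forall>f\<in>CL. (\<forall>x\<in>L. qnorm (f x) \<le> d) \<longrightarrow> qnorm (\<mu> f) \<le> e"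
  by (simp add: is_measure_iff)

lemma measureI:
  assumes "\<And>f. f \<in> CL \<Longrightarrow> \<mu> f \<in> carrier (Qp p)"
    "\<And>f g. f \<in> CL \<Longrightarrow> g \<in> CL \<Longrightarrow> \<mu> (\<lambda>x\<in>L. f x \<oplus>\<^bsub>Qp p\<^esub> g x) = \<mu> f \<oplus>\<^bsub>Qp p\<^esub> \<mu> g"
    "\<And>c f. c \<in> carrier (Qp p) \<Longrightarrow> f \<in> CL \<Longrightarrow> \<mu> (\<lambda>x\<in>L. c \<otimes>\<^bsub>Qp p\<^esub> f x) = c \<otimes>\<^bsub>Qp p\<^esub> \<mu> f"
    "\<And>e. e > 0 \<Longrightarrow> \<exists>d>0. \<forall>f\<in>CL. (\<forall>x\<in>L. qnorm (f x) \<le> d) \<longrightarrow> qnorm (\<mu> f) \<le> e"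
  shows "is_measure B p (\<lambda>f\<in>CL. \<mu> f)"
  unfolding is_measure_iff
proof (intro conjI ballI allI impI)
  show "restrict \<mu> CL \<in> CL \<rightarrow>\<^sub>E carrier (Qp p)"
    by (simp add: restrict_PiE_iff assms(1))
  show "restrict \<mu> CL (\<lambda>x\<in>L. f x \<oplus>\<^bsub>Qp p\<^esub> g x) = restrict \<mu> CL f \<oplus>\<^bsub>Qp p\<^esub> restrict \<mu> CL g"
    if "f \<in> CL" "g \<in> CL" for f g
    unfolding restrict_apply'[OF CL_add[OF that]] restrict_apply'[OF that(1)] restrict_apply'[OF that(2)]
    by (rule assms(2)[OF that])
  show "restrict \<mu> CL (\<lambda>x\<in>L. c \<otimes>\<^bsub>Qp p\<^esub> f x) = c \<otimes>\<^bsub>Qp p\<^esub> restrict \<mu> CL f"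
    if "c \<in> carrier (Qp p)" "f \<in> CL" for c f
    unfolding restrict_apply'[OF CL_scale[OF that]] restrict_apply'[OF that(2)]
    by (rule assms(3)[OF that])
  show "\<exists>d>0. \<forall>f\<in>CL. (\<forall>x\<in>L. qnorm (f x) \<le> d) \<longrightarrow> qnorm (restrict \<mu> CL f) \<le> e" if "e > 0" for e
    using assms(4)[OF that] by (simp only: restrict_apply' cong: ball_cong)
qed

lemma measure_diff:
  assumes "is_measure B p \<mu>" "f \<in> CL" "g \<in> CL"
  shows "\<mu> (\<lambda>x\<in>L. f x \<ominus>\<^bsub>Qp p\<^esub> g x) = \<mu> f \<ominus>\<^bsub>Qp p\<^esub> \<mu> g"
  using linear_diff[of \<mu> f g, OF measure_carrier[OF assms(1)] measure_add[OF assms(1)] assms(2,3)] .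

lemma measure_eqI:
  assumes "is_measure B p \<mu>" "is_measure B p \<nu>" "\<And>f. f \<in> CL \<Longrightarrow> \<mu> f = \<nu> f"
  shows "\<mu> = \<nu>"
proof (rule PiE_ext)
  show "\<mu> \<in> CL \<rightarrow>\<^sub>E carrier (Qp p)" "\<nu> \<in> CL \<rightarrow>\<^sub>E carrier (Qp p)"
    using assms(1,2) by (auto simp only: is_measure_iff)
qed (rule assms(3))

lemma measure_finsum:
  assumes \<mu>: "is_measure B p \<mu>" and "finite A" "\<And>a. a \<in> A \<Longrightarrow> c a \<in> carrier (Qp p)" "\<And>a. a \<in> A \<Longrightarrow> g a \<in> CL"
  shows "(\<lambda>x\<in>L. \<Oplus>\<^bsub>Qp p\<^esub>a\<in>A. c a \<otimes>\<^bsub>Qp p\<^esub> g a x) \<in> CL \<and>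
    \<mu> (\<lambda>x\<in>L. \<Oplus>\<^bsub>Qp p\<^esub>a\<in>A. c a \<otimes>\<^bsub>Qp p\<^esub> g a x) = (\<Oplus>\<^bsub>Qp p\<^esub>a\<in>A. c a \<otimes>\<^bsub>Qp p\<^esub> \<mu> (g a))"
  using assms(2-)
proof (induction A)
  case empty
  \<comment> \<open>Additivity is given for two summands only; the value 0 of the empty sum comes
    from homogeneity with the scalar 0.\<close>
  have "(\<lambda>x\<in>L. \<zero>\<^bsub>Qp p\<^esub> \<otimes>\<^bsub>Qp p\<^esub> (\<lambda>x\<in>L. \<zero>\<^bsub>Qp p\<^esub>) x) = (\<lambda>x\<in>L. \<zero>\<^bsub>Qp p\<^esub>)"
    by (rule restrict_ext) simp
  with measure_scale[OF \<mu> Q.zero_closed CL_zero]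
  have "\<mu> (\<lambda>x\<in>L. \<zero>\<^bsub>Qp p\<^esub>) = \<zero>\<^bsub>Qp p\<^esub> \<otimes>\<^bsub>Qp p\<^esub> \<mu> (\<lambda>x\<in>L. \<zero>\<^bsub>Qp p\<^esub>)"
    by metis
  also have "\<dots> = \<zero>\<^bsub>Qp p\<^esub>"
    by (rule Q.l_null[OF measure_carrier[OF \<mu> CL_zero]])
  finally show ?case
    unfolding Q.finsum_empty using CL_zero by (rule conjI[rotated])
next
  case (insert a A)
  let ?f = "\<lambda>x\<in>L. c a \<otimes>\<^bsub>Qp p\<^esub> g a x" and ?h = "\<lambda>x\<in>L. \<Oplus>\<^bsub>Qp p\<^esub>a\<in>A. c a \<otimes>\<^bsub>Qp p\<^esub> g a x"
  have eq: "(\<lambda>x\<in>L. \<Oplus>\<^bsub>Qp p\<^esub>a\<in>insert a A. c a \<otimes>\<^bsub>Qp p\<^esub> g a x) = (\<lambda>x\<in>L. ?f x \<oplus>\<^bsub>Qp p\<^esub> ?h x)"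
    using insert by (intro restrict_ext) (simp add: Pi_iff)
  have IH: "?h \<in> CL \<and> \<mu> ?h = (\<Oplus>\<^bsub>Qp p\<^esub>a\<in>A. c a \<otimes>\<^bsub>Qp p\<^esub> \<mu> (g a))"
    by (rule insert.IH) (use insert.prems in blast)+
  have ca: "c a \<in> carrier (Qp p)" and ga: "g a \<in> CL"
    using insert.prems by blast+
  have f: "?f \<in> CL" and h: "?h \<in> CL"
    using CL_scale[OF ca ga] IH by blast+
  have "\<mu> (\<lambda>x\<in>L. ?f x \<oplus>\<^bsub>Qp p\<^esub> ?h x) = \<mu> ?f \<oplus>\<^bsub>Qp p\<^esub> \<mu> ?h"
    by (rule measure_add[OF \<mu> f h])
  also have "\<dots> = c a \<otimes>\<^bsub>Qp p\<^esub> \<mu> (g a) \<oplus>\<^bsub>Qp p\<^esub> (\<Oplus>\<^bsub>Qp p\<^esub>a\<in>A. c a \<otimes>\<^bsub>Qp p\<^esub> \<mu> (g a))"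
    using IH measure_scale[OF \<mu> ca ga] by metis
  also have "\<dots> = (\<Oplus>\<^bsub>Qp p\<^esub>a\<in>insert a A. c a \<otimes>\<^bsub>Qp p\<^esub> \<mu> (g a))"
    using insert.hyps insert.prems measure_carrier[OF \<mu>] by (intro Q.finsum_insert[symmetric]) auto
  finally show ?case
    unfolding eq using CL_add[OF f h] by (rule conjI[rotated])
qed

lemma measure_loc_const:
  assumes "is_measure B p \<mu>" "loc_const d g" "is_step d r"
  shows "\<mu> g = (\<Oplus>\<^bsub>Qp p\<^esub>c\<in>r ` L. g c \<otimes>\<^bsub>Qp p\<^esub> \<mu> (ind r c))"
proof -
  have "finite (r ` L)" "\<And>c. c \<in> r ` L \<Longrightarrow> g c \<in> carrier (Qp p)"
    using assms(2) step_L[OF assms(3)] assms(3) by (auto simp: loc_const_def is_step_def)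
  from measure_finsum[where g = "ind r", OF assms(1) this ind_CL[OF assms(3)]]
  have "\<mu> (\<lambda>x\<in>L. \<Oplus>\<^bsub>Qp p\<^esub>c\<in>r ` L. g c \<otimes>\<^bsub>Qp p\<^esub> ind r c x) = (\<Oplus>\<^bsub>Qp p\<^esub>c\<in>r ` L. g c \<otimes>\<^bsub>Qp p\<^esub> \<mu> (ind r c))"
    by (rule conjunct2)
  with arg_cong[of _ _ \<mu>, OF loc_const_expand[OF assms(2,3)]] show ?thesis
    by (rule trans)
qed

text \<open>Locally constant functions are dense, by uniform continuity.\<close>

lemma measure_eqI_loc_const:
  assumes \<mu>: "is_measure B p \<mu>" and \<nu>: "is_measure B p \<nu>"
    and eq: "\<And>d g. loc_const d g \<Longrightarrow> \<mu> g = \<nu> g"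
  shows "\<mu> = \<nu>"
proof (rule measure_eqI[OF \<mu> \<nu>])
  fix f assume f: "f \<in> CL"
  have "\<mu> f \<ominus>\<^bsub>Qp p\<^esub> \<nu> f = \<zero>\<^bsub>Qp p\<^esub>"
  proof (rule qnorm_le_0)
    fix e :: real assume e: "e > 0"
    obtain d1 where d1: "d1 > 0" "\<forall>f\<in>CL. (\<forall>x\<in>L. qnorm (f x) \<le> d1) \<longrightarrow> qnorm (\<mu> f) \<le> e"
      using measure_bd[OF \<mu> e] by blast
    obtain d2 where d2: "d2 > 0" "\<forall>f\<in>CL. (\<forall>x\<in>L. qnorm (f x) \<le> d2) \<longrightarrow> qnorm (\<nu> f) \<le> e"
      using measure_bd[OF \<nu> e] by blast
    obtain t where t: "t > 0" "\<forall>x\<in>L. \<forall>y\<in>L. near t x y \<longrightarrow> qp_dist p (f x) (f y) < min d1 d2"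
      using CL_unif[OF f, of "min d1 d2"] d1(1) d2(1) by auto
    obtain r where r: "is_step t r"
      using step_exists[OF t(1)] by blast
    \<comment> \<open>The approximation takes the value of f at the centre of each ball of radius t,
      on which f varies by less than both d1 and d2.\<close>
    define g where "g = (\<lambda>x\<in>L. f (r x))"
    have g: "loc_const t g"
      unfolding loc_const_def
    proof (intro conjI ballI impI)
      show "g \<in> L \<rightarrow>\<^sub>E carrier (Qp p)"
        using CL_carrier[OF f step_L[OF r]] by (simp add: g_def restrict_PiE_iff)
      fix x y assume "x \<in> L" "y \<in> L" "near t x y"
      moreover from this have "r x = r y"
        using r unfolding is_step_def by blast
      ultimately show "g x = g y"
        by (simp add: g_def)
    qed (rule t(1))
    have gC: "g \<in> CL" using loc_const_CL[OF g] .
    have "qnorm (f x \<ominus>\<^bsub>Qp p\<^esub> g x) \<le> min d1 d2" if x: "x \<in> L" for x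
    proof -
      have "near t x (r x)" "r x \<in> L"
        using r x step_L[OF r x] unfolding is_step_def by blast+
      then have "qp_dist p (f x) (f (r x)) < min d1 d2"
        using t(2) x by blast
      then show ?thesis
        using x CL_carrier[OF f x] CL_carrier[OF f \<open>r x \<in> L\<close>] by (simp add: g_def qdist_eq)
    qed
    then have small: "\<forall>x\<in>L. qnorm ((\<lambda>x\<in>L. f x \<ominus>\<^bsub>Qp p\<^esub> g x) x) \<le> d1"
      "\<forall>x\<in>L. qnorm ((\<lambda>x\<in>L. f x \<ominus>\<^bsub>Qp p\<^esub> g x) x) \<le> d2"
      by simp_all
    have 1: "qnorm (\<mu> f \<ominus>\<^bsub>Qp p\<^esub> \<mu> g) \<le> e"
      unfolding measure_diff[OF \<mu> f gC, symmetric] using d1(2) CL_diff[OF f gC] small(1) by blast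
    have "qnorm (\<nu> f \<ominus>\<^bsub>Qp p\<^esub> \<nu> g) \<le> e"
      unfolding measure_diff[OF \<nu> f gC, symmetric] using d2(2) CL_diff[OF f gC] small(2) by blast
    then have 2: "qnorm (\<nu> f \<ominus>\<^bsub>Qp p\<^esub> \<mu> g) \<le> e"
      unfolding eq[OF g] .
    have c: "\<mu> f \<in> carrier (Qp p)" "\<nu> f \<in> carrier (Qp p)" "\<mu> g \<in> carrier (Qp p)"
      by (rule measure_carrier[OF \<mu> f] measure_carrier[OF \<nu> f] measure_carrier[OF \<mu> gC])+
    have "qp_dist p (\<mu> f) (\<nu> f) \<le> e"
      using 1 2 qdist_ultra[OF c(1,3,2)] QM.commute[of "\<mu> g" "\<nu> f"]
      unfolding qdist_eq[OF c(1,3)] qdist_eq[OF c(2,3)] by linarith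
    then show "qnorm (\<mu> f \<ominus>\<^bsub>Qp p\<^esub> \<nu> f) \<le> e"
      unfolding qdist_eq[OF c(1,2)] .
  qed (use measure_carrier[OF \<mu> f] measure_carrier[OF \<nu> f] in \<open>rule Q.minus_closed\<close>)
  then show "\<mu> f = \<nu> f"
    unfolding Q.diff_eq_zero_iff[OF measure_carrier[OF \<mu> f] measure_carrier[OF \<nu> f]] .
qed

end

section \<open>Convolution: continuity of the inner integral, commutativity, associativity\<close>

context padic_lattice
begin

lemma CL_PiE: "f \<in> CL \<Longrightarrow> f \<in> L \<rightarrow>\<^sub>E carrier (Qp p)"
  by (simp only: CL_iff)

lemma loc_const_eq:
  assumes "loc_const d g" "x \<in> L" "y \<in> L" "near d x y" shows "g x = g y"
proof -
  have "\<forall>x\<in>L. \<forall>y\<in>L. near d x y \<longrightarrow> g x = g y"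
    using assms(1) unfolding loc_const_def by (elim conjE)
  from this[rule_format, OF assms(2-4)] show ?thesis .
qed

definition integ :: "'v meas \<Rightarrow> 'v func \<Rightarrow> 'v func" where
  "integ \<nu> f = (\<lambda>v\<in>L. \<nu> (transl v f))"

lemma conv_apply: "f \<in> CL \<Longrightarrow> (\<mu> \<star> \<nu>) f = \<mu> (integ \<nu> f)"
  unfolding convolution_def integ_def transl_def by (rule restrict_apply')

lemma integ_apply: "v \<in> L \<Longrightarrow> integ \<nu> f v = \<nu> (transl v f)"
  unfolding integ_def by (rule restrict_apply')

lemma transl_add:
  "v \<in> L \<Longrightarrow> transl v (\<lambda>x\<in>L. f x \<oplus>\<^bsub>Qp p\<^esub> g x) = (\<lambda>x\<in>L. transl v f x \<oplus>\<^bsub>Qp p\<^esub> transl v g x)"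
  unfolding transl_def by (rule restrict_ext) (simp add: L_add_closed)

lemma transl_scale:
  "v \<in> L \<Longrightarrow> transl v (\<lambda>x\<in>L. c \<otimes>\<^bsub>Qp p\<^esub> f x) = (\<lambda>x\<in>L. c \<otimes>\<^bsub>Qp p\<^esub> transl v f x)"
  unfolding transl_def by (rule restrict_ext) (simp add: L_add_closed)

text \<open>By uniform continuity of f, translates by nearby vectors are uniformly close, and
  continuity of \<nu> at 0 makes their integrals close.\<close>

lemma integ_CL:
  assumes \<nu>: "is_measure B p \<nu>" and f: "f \<in> CL" shows "integ \<nu> f \<in> CL"
  unfolding integ_def
proof (rule CL_I)
  show "\<nu> (transl x f) \<in> carrier (Qp p)" if "x \<in> L" for x
    by (rule measure_carrier[OF \<nu> CL_transl[OF that f]])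
  fix e :: real assume "e > 0"
  then have e2: "e / 2 > 0" by simp
  obtain d where d: "d > 0" "\<forall>f\<in>CL. (\<forall>x\<in>L. qnorm (f x) \<le> d) \<longrightarrow> qnorm (\<nu> f) \<le> e / 2"
    using measure_bd[OF \<nu> e2] by blast
  obtain t where t: "t > 0" "\<forall>x\<in>L. \<forall>y\<in>L. near t x y \<longrightarrow> qp_dist p (f x) (f y) < d"
    using CL_unif[OF f d(1)] by blast
  have "qp_dist p (\<nu> (transl x f)) (\<nu> (transl y f)) < e" if xy: "x \<in> L" "y \<in> L" "near t x y" for x y
  proof -
    have X: "transl x f \<in> CL" "transl y f \<in> CL"
      using CL_transl f xy by blast+
    have "qnorm ((\<lambda>w\<in>L. transl x f w \<ominus>\<^bsub>Qp p\<^esub> transl y f w) w) \<le> d" if w: "w \<in> L" for w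
    proof -
      have "near t (x \<boxplus> w) (y \<boxplus> w)"
        by (rule near_L_add[OF xy(3) near_L_refl[OF t(1) w] xy(1) w xy(2) w])
      then have "qp_dist p (f (x \<boxplus> w)) (f (y \<boxplus> w)) < d"
        using t(2) L_add_closed xy w by blast
      then show ?thesis
        using w xy L_add_closed f by (simp add: qdist_eq)
    qed
    then have "qnorm (\<nu> (\<lambda>w\<in>L. transl x f w \<ominus>\<^bsub>Qp p\<^esub> transl y f w)) \<le> e / 2"
      using d(2) CL_diff[OF X] by blast
    then have "qnorm (\<nu> (transl x f) \<ominus>\<^bsub>Qp p\<^esub> \<nu> (transl y f)) \<le> e / 2"
      unfolding measure_diff[OF \<nu> X] .
    then show ?thesis
      unfolding qdist_eq[OF measure_carrier[OF \<nu> X(1)] measure_carrier[OF \<nu> X(2)]] using e2 by linarith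
  qed
  then show "\<exists>d>0. \<forall>x\<in>L. \<forall>y\<in>L. near d x y \<longrightarrow> qp_dist p (\<nu> (transl x f)) (\<nu> (transl y f)) < e"
    using t(1) by blast
qed

lemma integ_add:
  assumes "is_measure B p \<nu>" "f \<in> CL" "g \<in> CL"
  shows "integ \<nu> (\<lambda>x\<in>L. f x \<oplus>\<^bsub>Qp p\<^esub> g x) = (\<lambda>v\<in>L. integ \<nu> f v \<oplus>\<^bsub>Qp p\<^esub> integ \<nu> g v)"
  unfolding integ_def[of _ "restrict _ _"]
proof (rule restrict_ext)
  fix v assume v: "v \<in> L"
  show "\<nu> (transl v (\<lambda>x\<in>L. f x \<oplus>\<^bsub>Qp p\<^esub> g x)) = integ \<nu> f v \<oplus>\<^bsub>Qp p\<^esub> integ \<nu> g v"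
    unfolding transl_add[OF v] integ_apply[OF v] by (intro measure_add assms CL_transl v)
qed

lemma integ_scale:
  assumes "is_measure B p \<nu>" "f \<in> CL" "c \<in> carrier (Qp p)"
  shows "integ \<nu> (\<lambda>x\<in>L. c \<otimes>\<^bsub>Qp p\<^esub> f x) = (\<lambda>v\<in>L. c \<otimes>\<^bsub>Qp p\<^esub> integ \<nu> f v)"
  unfolding integ_def[of _ "restrict _ _"]
proof (rule restrict_ext)
  fix v assume v: "v \<in> L"
  show "\<nu> (transl v (\<lambda>x\<in>L. c \<otimes>\<^bsub>Qp p\<^esub> f x)) = c \<otimes>\<^bsub>Qp p\<^esub> integ \<nu> f v"
    unfolding transl_scale[OF v] integ_apply[OF v] by (intro measure_scale assms CL_transl v)
qed

lemma conv_measure: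
  assumes \<mu>: "is_measure B p \<mu>" and \<nu>: "is_measure B p \<nu>"
  shows "is_measure B p (\<mu> \<star> \<nu>)"
proof -
  have "is_measure B p (\<lambda>f\<in>CL. \<mu> (integ \<nu> f))"
  proof (rule measureI)
    show "\<mu> (integ \<nu> f) \<in> carrier (Qp p)" if "f \<in> CL" for f
      by (rule measure_carrier[OF \<mu> integ_CL[OF \<nu> that]])
    show "\<mu> (integ \<nu> (\<lambda>x\<in>L. f x \<oplus>\<^bsub>Qp p\<^esub> g x)) = \<mu> (integ \<nu> f) \<oplus>\<^bsub>Qp p\<^esub> \<mu> (integ \<nu> g)"
      if "f \<in> CL" "g \<in> CL" for f g
      unfolding integ_add[OF \<nu> that] by (intro measure_add[OF \<mu>] integ_CL[OF \<nu>] that)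
    show "\<mu> (integ \<nu> (\<lambda>x\<in>L. c \<otimes>\<^bsub>Qp p\<^esub> f x)) = c \<otimes>\<^bsub>Qp p\<^esub> \<mu> (integ \<nu> f)"
      if "c \<in> carrier (Qp p)" "f \<in> CL" for c f
      unfolding integ_scale[OF \<nu> that(2,1)] by (intro measure_scale[OF \<mu>] integ_CL[OF \<nu>] that)
    fix e :: real assume e: "e > 0"
    obtain d where d: "d > 0" "\<forall>f\<in>CL. (\<forall>x\<in>L. qnorm (f x) \<le> d) \<longrightarrow> qnorm (\<mu> f) \<le> e"
      using measure_bd[OF \<mu> e] by blast
    obtain d' where d': "d' > 0" "\<forall>f\<in>CL. (\<forall>x\<in>L. qnorm (f x) \<le> d') \<longrightarrow> qnorm (\<nu> f) \<le> d"
      using measure_bd[OF \<nu> d(1)] by blast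
    have "qnorm (\<mu> (integ \<nu> f)) \<le> e" if f: "f \<in> CL" "\<forall>x\<in>L. qnorm (f x) \<le> d'" for f
    proof -
      have "qnorm (integ \<nu> f v) \<le> d" if v: "v \<in> L" for v
      proof -
        have "\<forall>x\<in>L. qnorm (transl v f x) \<le> d'"
          using f(2) L_add_closed[OF v] by simp
        then show ?thesis
          unfolding integ_apply[OF v] using d'(2) CL_transl[OF v f(1)] by blast
      qed
      then show ?thesis
        using d(2) integ_CL[OF \<nu> f(1)] by blast
    qed
    then show "\<exists>d>0. \<forall>f\<in>CL. (\<forall>x\<in>L. qnorm (f x) \<le> d) \<longrightarrow> qnorm (\<mu> (integ \<nu> f)) \<le> e"
      using d'(1) by blast
  qed
  then show ?thesis
    by (simp only: convolution_def integ_def transl_def)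
qed

text \<open>If g is constant on d-balls, then so are its translates and the inner integral, since
  adding a vector preserves d-closeness. Both integrations become finite sums over the same system
  of centres.\<close>

lemma conv_loc_const:
  assumes \<mu>: "is_measure B p \<mu>" and \<nu>: "is_measure B p \<nu>" and g: "loc_const d g" and r: "is_step d r"
  shows "(\<mu> \<star> \<nu>) g =
    (\<Oplus>\<^bsub>Qp p\<^esub>a\<in>r ` L. \<Oplus>\<^bsub>Qp p\<^esub>b\<in>r ` L. g (a \<boxplus> b) \<otimes>\<^bsub>Qp p\<^esub> (\<nu> (ind r b) \<otimes>\<^bsub>Qp p\<^esub> \<mu> (ind r a)))"
proof -
  have gC: "g \<in> CL" using loc_const_CL[OF g] .
  have d: "d > 0" using g by (simp add: loc_const_def)
  have fin: "finite (r ` L)"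
    using r by (simp add: is_step_def)
  have rL: "r ` L \<subseteq> L"
    using step_L[OF r] by blast
  note gnear = loc_const_eq[OF g]
  have tl: "loc_const d (transl v g)" if v: "v \<in> L" for v
    unfolding loc_const_def
  proof (intro conjI ballI impI)
    show "transl v g \<in> L \<rightarrow>\<^sub>E carrier (Qp p)"
      using CL_transl[OF v gC] by (rule CL_PiE)
    show "transl v g x = transl v g y" if "x \<in> L" "y \<in> L" "near d x y" for x y
      unfolding transl_apply[OF that(1)] transl_apply[OF that(2)]
      by (rule gnear[OF L_add_closed[OF v that(1)] L_add_closed[OF v that(2)]
          near_L_add[OF near_L_refl[OF d v] that(3) v that(1) v that(2)]])
  qed (rule d)
  have il: "loc_const d (integ \<nu> g)"
    unfolding loc_const_def
  proof (intro conjI ballI impI)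
    show "integ \<nu> g \<in> L \<rightarrow>\<^sub>E carrier (Qp p)"
      using integ_CL[OF \<nu> gC] by (rule CL_PiE)
    fix x y assume xy: "x \<in> L" "y \<in> L" "near d x y"
    have "transl x g = transl y g"
      unfolding transl_def
    proof (rule restrict_ext)
      fix w assume w: "w \<in> L"
      show "g (x \<boxplus> w) = g (y \<boxplus> w)"
        by (rule gnear[OF L_add_closed[OF xy(1) w] L_add_closed[OF xy(2) w]
            near_L_add[OF xy(3) near_L_refl[OF d w] xy(1) w xy(2) w]])
    qed
    then show "integ \<nu> g x = integ \<nu> g y"
      unfolding integ_apply[OF xy(1)] integ_apply[OF xy(2)] by (rule arg_cong)
  qed (rule d)
  have ci: "\<mu> (ind r a) \<in> carrier (Qp p)" "\<nu> (ind r a) \<in> carrier (Qp p)" for a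
    by (rule measure_carrier[OF \<mu> ind_CL[OF r]] measure_carrier[OF \<nu> ind_CL[OF r]])+
  have cg: "g (a \<boxplus> b) \<in> carrier (Qp p)" if "a \<in> r ` L" "b \<in> r ` L" for a b
    using that rL by (intro CL_carrier[OF gC] L_add_closed) blast+
  have "(\<mu> \<star> \<nu>) g = (\<Oplus>\<^bsub>Qp p\<^esub>a\<in>r ` L. integ \<nu> g a \<otimes>\<^bsub>Qp p\<^esub> \<mu> (ind r a))"
    unfolding conv_apply[OF gC] by (rule measure_loc_const[OF \<mu> il r])
  also have "\<dots> = (\<Oplus>\<^bsub>Qp p\<^esub>a\<in>r ` L. \<Oplus>\<^bsub>Qp p\<^esub>b\<in>r ` L. g (a \<boxplus> b) \<otimes>\<^bsub>Qp p\<^esub> (\<nu> (ind r b) \<otimes>\<^bsub>Qp p\<^esub> \<mu> (ind r a)))"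
  proof (rule Q.finsum_cong')
    fix a assume a: "a \<in> r ` L"
    then have aL: "a \<in> L" using rL by blast
    have "integ \<nu> g a = (\<Oplus>\<^bsub>Qp p\<^esub>b\<in>r ` L. transl a g b \<otimes>\<^bsub>Qp p\<^esub> \<nu> (ind r b))"
      unfolding integ_apply[OF aL] by (rule measure_loc_const[OF \<nu> tl[OF aL] r])
    also have "\<dots> = (\<Oplus>\<^bsub>Qp p\<^esub>b\<in>r ` L. g (a \<boxplus> b) \<otimes>\<^bsub>Qp p\<^esub> \<nu> (ind r b))"
    proof (rule Q.finsum_cong')
      fix b assume "b \<in> r ` L"
      with rL have "b \<in> L" by blast
      then show "transl a g b \<otimes>\<^bsub>Qp p\<^esub> \<nu> (ind r b) = g (a \<boxplus> b) \<otimes>\<^bsub>Qp p\<^esub> \<nu> (ind r b)"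
        by (simp only: transl_apply)
    qed (use cg[OF a] ci in \<open>auto intro!: Q.m_closed\<close>)
    finally have "integ \<nu> g a \<otimes>\<^bsub>Qp p\<^esub> \<mu> (ind r a) =
        (\<Oplus>\<^bsub>Qp p\<^esub>b\<in>r ` L. g (a \<boxplus> b) \<otimes>\<^bsub>Qp p\<^esub> \<nu> (ind r b)) \<otimes>\<^bsub>Qp p\<^esub> \<mu> (ind r a)"
      by (rule arg_cong)
    also have "\<dots> = (\<Oplus>\<^bsub>Qp p\<^esub>b\<in>r ` L. g (a \<boxplus> b) \<otimes>\<^bsub>Qp p\<^esub> \<nu> (ind r b) \<otimes>\<^bsub>Qp p\<^esub> \<mu> (ind r a))"
      using cg[OF a] ci by (intro Q.finsum_ldistr fin) (auto intro!: Q.m_closed)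
    also have "\<dots> = (\<Oplus>\<^bsub>Qp p\<^esub>b\<in>r ` L. g (a \<boxplus> b) \<otimes>\<^bsub>Qp p\<^esub> (\<nu> (ind r b) \<otimes>\<^bsub>Qp p\<^esub> \<mu> (ind r a)))"
      using cg[OF a] ci by (intro Q.finsum_cong') (auto intro!: Q.m_closed simp only: Q.m_assoc)
    finally show "integ \<nu> g a \<otimes>\<^bsub>Qp p\<^esub> \<mu> (ind r a) =
        (\<Oplus>\<^bsub>Qp p\<^esub>b\<in>r ` L. g (a \<boxplus> b) \<otimes>\<^bsub>Qp p\<^esub> (\<nu> (ind r b) \<otimes>\<^bsub>Qp p\<^esub> \<mu> (ind r a)))" .
  qed (use cg ci in \<open>auto intro!: Q.finsum_closed Q.m_closed\<close>)
  finally show ?thesis .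
qed

text \<open>Fubini's theorem: for locally constant functions it is an exchange of two finite sums,
  and these functions determine a measure.\<close>

lemma conv_comm:
  assumes \<mu>: "is_measure B p \<mu>" and \<nu>: "is_measure B p \<nu>"
  shows "\<mu> \<star> \<nu> = \<nu> \<star> \<mu>"
proof (rule measure_eqI_loc_const[OF conv_measure[OF \<mu> \<nu>] conv_measure[OF \<nu> \<mu>]])
  fix d g assume g: "loc_const d g"
  then have "d > 0" by (simp add: loc_const_def)
  then obtain r where r: "is_step d r" using step_exists by blast
  have gC: "g \<in> CL" using loc_const_CL[OF g] .
  have fin: "finite (r ` L)"
    using r by (simp add: is_step_def)
  have rL: "r ` L \<subseteq> L"
    using step_L[OF r] by blast
  have ci: "\<mu> (ind r a) \<in> carrier (Qp p)" "\<nu> (ind r a) \<in> carrier (Qp p)" for a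
    by (rule measure_carrier[OF \<mu> ind_CL[OF r]] measure_carrier[OF \<nu> ind_CL[OF r]])+
  have cg: "g (a \<boxplus> b) \<in> carrier (Qp p)" if "a \<in> r ` L" "b \<in> r ` L" for a b
    using that rL by (intro CL_carrier[OF gC] L_add_closed) blast+
  have sym: "g (a \<boxplus> b) \<otimes>\<^bsub>Qp p\<^esub> (\<nu> (ind r b) \<otimes>\<^bsub>Qp p\<^esub> \<mu> (ind r a)) =
      g (b \<boxplus> a) \<otimes>\<^bsub>Qp p\<^esub> (\<mu> (ind r a) \<otimes>\<^bsub>Qp p\<^esub> \<nu> (ind r b))" if "a \<in> r ` L" "b \<in> r ` L" for a b
  proof -
    have "a \<boxplus> b = b \<boxplus> a"
      using that rL L_in_V by (intro V_add_comm) blast+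
    then show ?thesis
      using Q.m_comm[OF ci(2) ci(1)] by simp
  qed
  have "(\<mu> \<star> \<nu>) g =
      (\<Oplus>\<^bsub>Qp p\<^esub>b\<in>r ` L. \<Oplus>\<^bsub>Qp p\<^esub>a\<in>r ` L. g (a \<boxplus> b) \<otimes>\<^bsub>Qp p\<^esub> (\<nu> (ind r b) \<otimes>\<^bsub>Qp p\<^esub> \<mu> (ind r a)))"
    unfolding conv_loc_const[OF \<mu> \<nu> g r]
    using cg ci by (intro Q.finsum_swap fin) (auto intro!: Q.m_closed)
  also have "\<dots> = (\<Oplus>\<^bsub>Qp p\<^esub>b\<in>r ` L. \<Oplus>\<^bsub>Qp p\<^esub>a\<in>r ` L. g (b \<boxplus> a) \<otimes>\<^bsub>Qp p\<^esub> (\<mu> (ind r a) \<otimes>\<^bsub>Qp p\<^esub> \<nu> (ind r b)))"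
    using sym cg ci by (intro Q.finsum_cong' Q.finsum_closed) (auto intro!: Q.m_closed Q.finsum_closed)
  also have "\<dots> = (\<nu> \<star> \<mu>) g"
    by (rule conv_loc_const[OF \<nu> \<mu> g r, symmetric])
  finally show "(\<mu> \<star> \<nu>) g = (\<nu> \<star> \<mu>) g" .
qed

text \<open>Integration along translates commutes with translation, so
  \<open>integ (\<nu> \<star> \<rho>)\<close> is the composition of \<open>integ \<nu>\<close> and
  \<open>integ \<rho>\<close>.\<close>

lemma conv_assoc:
  assumes \<mu>: "is_measure B p \<mu>" and \<nu>: "is_measure B p \<nu>" and \<rho>: "is_measure B p \<rho>"
  shows "\<mu> \<star> \<nu> \<star> \<rho> = \<mu> \<star> (\<nu> \<star> \<rho>)"
proof (rule measure_eqI)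
  fix f assume f: "f \<in> CL"
  have 1: "integ \<rho> (transl v f) = transl v (integ \<rho> f)" if v: "v \<in> L" for v
    unfolding integ_def[of _ "transl v f"] transl_def[of v "integ \<rho> f"]
  proof (rule restrict_ext)
    fix w assume "w \<in> L"
    then show "\<rho> (transl w (transl v f)) = integ \<rho> f (v \<boxplus> w)"
      by (simp only: transl_transl[OF v] integ_apply[OF L_add_closed[OF v]])
  qed
  have "integ (\<nu> \<star> \<rho>) f = integ \<nu> (integ \<rho> f)"
    unfolding integ_def[of _ f] integ_def[of \<nu> "restrict _ _"]
  proof (rule restrict_ext)
    fix v assume v: "v \<in> L"
    show "(\<nu> \<star> \<rho>) (transl v f) = \<nu> (transl v (\<lambda>v\<in>L. \<rho> (transl v f)))"
      unfolding conv_apply[OF CL_transl[OF v f]] 1[OF v] integ_def[of \<rho> f] ..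
  qed
  then show "(\<mu> \<star> \<nu> \<star> \<rho>) f = (\<mu> \<star> (\<nu> \<star> \<rho>)) f"
    unfolding conv_apply[OF f] conv_apply[OF integ_CL[OF \<rho> f]] by simp
qed (intro conv_measure \<mu> \<nu> \<rho>)+

lemma delta_apply: "f \<in> CL \<Longrightarrow> delta v f = f v"
  unfolding dirac_def by (rule restrict_apply')

lemma delta_measure: "v \<in> L \<Longrightarrow> is_measure B p (delta v)"
  unfolding dirac_def
proof (rule measureI)
  assume v: "v \<in> L"
  show "\<exists>d>0. \<forall>f\<in>CL. (\<forall>x\<in>L. qnorm (f x) \<le> d) \<longrightarrow> qnorm (f v) \<le> e" if "e > 0" for e
    using v that by blast
qed (simp_all only: CL_carrier restrict_apply')

lemma conv_delta: "v \<in> L \<Longrightarrow> is_measure B p \<mu> \<Longrightarrow> f \<in> CL \<Longrightarrow> (delta v \<star> \<mu>) f = \<mu> (transl v f)"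
  by (simp only: conv_apply delta_apply integ_CL integ_apply)

lemma M_simps [simp]:
  "carrier M = {\<mu>. is_measure B p \<mu>}" "mult M = (\<star>)" "one M = delta (V_zero B p)"
  "zero M = (\<lambda>f\<in>CL. \<zero>\<^bsub>Qp p\<^esub>)" "add M = (\<lambda>\<mu> \<nu>. \<lambda>f\<in>CL. \<mu> f \<oplus>\<^bsub>Qp p\<^esub> \<nu> f)"
  by (simp_all add: measure_ring_def)

lemma add_measure:
  assumes \<mu>: "is_measure B p \<mu>" and \<nu>: "is_measure B p \<nu>"
  shows "is_measure B p (\<lambda>f\<in>CL. \<mu> f \<oplus>\<^bsub>Qp p\<^esub> \<nu> f)"
proof (rule measureI)
  fix f g assume fg: "f \<in> CL" "g \<in> CL"
  have c: "\<mu> f \<in> carrier (Qp p)" "\<nu> f \<in> carrier (Qp p)" "\<mu> g \<in> carrier (Qp p)" "\<nu> g \<in> carrier (Qp p)"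
    by (rule measure_carrier[OF \<mu> fg(1)] measure_carrier[OF \<mu> fg(2)] measure_carrier[OF \<nu> fg(1)] measure_carrier[OF \<nu> fg(2)])+
  show "\<mu> (\<lambda>x\<in>L. f x \<oplus>\<^bsub>Qp p\<^esub> g x) \<oplus>\<^bsub>Qp p\<^esub> \<nu> (\<lambda>x\<in>L. f x \<oplus>\<^bsub>Qp p\<^esub> g x) =
      (\<mu> f \<oplus>\<^bsub>Qp p\<^esub> \<nu> f) \<oplus>\<^bsub>Qp p\<^esub> (\<mu> g \<oplus>\<^bsub>Qp p\<^esub> \<nu> g)"
    unfolding measure_add[OF \<mu> fg] measure_add[OF \<nu> fg] using c by (simp add: Q.a_ac)
next
  fix c f assume c: "c \<in> carrier (Qp p)" and f: "f \<in> CL"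
  show "\<mu> (\<lambda>x\<in>L. c \<otimes>\<^bsub>Qp p\<^esub> f x) \<oplus>\<^bsub>Qp p\<^esub> \<nu> (\<lambda>x\<in>L. c \<otimes>\<^bsub>Qp p\<^esub> f x) = c \<otimes>\<^bsub>Qp p\<^esub> (\<mu> f \<oplus>\<^bsub>Qp p\<^esub> \<nu> f)"
    unfolding measure_scale[OF \<mu> c f] measure_scale[OF \<nu> c f]
    using Q.r_distr[OF measure_carrier[OF \<mu> f] measure_carrier[OF \<nu> f] c] ..
next
  fix e :: real assume e: "e > 0"
  obtain d where d: "d > 0" "\<forall>f\<in>CL. (\<forall>x\<in>L. qnorm (f x) \<le> d) \<longrightarrow> qnorm (\<mu> f) \<le> e"
    using measure_bd[OF \<mu> e] by blast
  obtain d' where d': "d' > 0" "\<forall>f\<in>CL. (\<forall>x\<in>L. qnorm (f x) \<le> d') \<longrightarrow> qnorm (\<nu> f) \<le> e"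
    using measure_bd[OF \<nu> e] by blast
  have "qnorm (\<mu> f \<oplus>\<^bsub>Qp p\<^esub> \<nu> f) \<le> e" if f: "f \<in> CL" "\<forall>x\<in>L. qnorm (f x) \<le> min d d'" for f
  proof -
    have "qnorm (\<mu> f) \<le> e" "qnorm (\<nu> f) \<le> e"
      using d(2) d'(2) f by simp_all
    then show ?thesis
      using qnorm_ultra[OF measure_carrier[OF \<mu> f(1)] measure_carrier[OF \<nu> f(1)]] by linarith
  qed
  then show "\<exists>d>0. \<forall>f\<in>CL. (\<forall>x\<in>L. qnorm (f x) \<le> d) \<longrightarrow> qnorm (\<mu> f \<oplus>\<^bsub>Qp p\<^esub> \<nu> f) \<le> e"
    using d(1) d'(1) by (intro exI[of _ "min d d'"]) simp
qed (intro Q.add.m_closed measure_carrier[OF \<mu>] measure_carrier[OF \<nu>])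

lemma scale_measure:
  assumes \<mu>: "is_measure B p \<mu>"
  shows "is_measure B p (\<lambda>f\<in>CL. \<ominus>\<^bsub>Qp p\<^esub> \<mu> f)"
proof (rule measureI)
  fix f g assume fg: "f \<in> CL" "g \<in> CL"
  show "\<ominus>\<^bsub>Qp p\<^esub> \<mu> (\<lambda>x\<in>L. f x \<oplus>\<^bsub>Qp p\<^esub> g x) = \<ominus>\<^bsub>Qp p\<^esub> \<mu> f \<oplus>\<^bsub>Qp p\<^esub> \<ominus>\<^bsub>Qp p\<^esub> \<mu> g"
    unfolding measure_add[OF \<mu> fg] by (rule Q.minus_add[OF measure_carrier[OF \<mu> fg(1)] measure_carrier[OF \<mu> fg(2)]])
next
  fix c f assume c: "c \<in> carrier (Qp p)" and f: "f \<in> CL"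
  show "\<ominus>\<^bsub>Qp p\<^esub> \<mu> (\<lambda>x\<in>L. c \<otimes>\<^bsub>Qp p\<^esub> f x) = c \<otimes>\<^bsub>Qp p\<^esub> \<ominus>\<^bsub>Qp p\<^esub> \<mu> f"
    unfolding measure_scale[OF \<mu> c f] by (rule Q.r_minus[OF c measure_carrier[OF \<mu> f], symmetric])
next
  fix e :: real assume e: "e > 0"
  show "\<exists>d>0. \<forall>f\<in>CL. (\<forall>x\<in>L. qnorm (f x) \<le> d) \<longrightarrow> qnorm (\<ominus>\<^bsub>Qp p\<^esub> \<mu> f) \<le> e"
    using measure_bd[OF \<mu> e] by (simp only: qnorm_minus[OF measure_carrier[OF \<mu>]] cong: ball_cong)
qed (intro Q.a_inv_closed measure_carrier[OF \<mu>])

lemma zero_measure: "is_measure B p (\<lambda>f\<in>CL. \<zero>\<^bsub>Qp p\<^esub>)"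
  by (rule measureI) (simp_all, force)

lemma measure_ring_cring: "cring M"
proof (rule cringI)
  have ext: "\<mu> = \<nu>" if "is_measure B p \<mu>" "is_measure B p \<nu>" "\<And>f. f \<in> CL \<Longrightarrow> \<mu> f = \<nu> f" for \<mu> \<nu>
    using that by (rule measure_eqI)
  show "abelian_group M"
  proof (rule abelian_groupI)
    fix x assume "x \<in> carrier M"
    then have x: "is_measure B p x" by simp
    have "(\<lambda>f\<in>CL. \<ominus>\<^bsub>Qp p\<^esub> x f) \<oplus>\<^bsub>M\<^esub> x = \<zero>\<^bsub>M\<^esub>"
      unfolding M_simps
      by (rule restrict_ext) (simp add: Q.l_neg measure_carrier[OF x])
    then show "\<exists>y\<in>carrier M. y \<oplus>\<^bsub>M\<^esub> x = \<zero>\<^bsub>M\<^esub>"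
      using scale_measure[OF x] by (intro bexI[of _ "\<lambda>f\<in>CL. \<ominus>\<^bsub>Qp p\<^esub> x f"]) simp_all
    show "\<zero>\<^bsub>M\<^esub> \<oplus>\<^bsub>M\<^esub> x = x"
      unfolding M_simps
      by (rule ext[OF add_measure[OF zero_measure x] x]) (simp add: measure_carrier[OF x])
  next
    fix x y assume "x \<in> carrier M" "y \<in> carrier M"
    then show "x \<oplus>\<^bsub>M\<^esub> y \<in> carrier M"
      by (simp add: add_measure)
    have xy: "is_measure B p x" "is_measure B p y"
      using \<open>x \<in> carrier M\<close> \<open>y \<in> carrier M\<close> by simp_all
    show "x \<oplus>\<^bsub>M\<^esub> y = y \<oplus>\<^bsub>M\<^esub> x"
      unfolding M_simps
      by (rule restrict_ext) (rule Q.a_comm[OF measure_carrier[OF xy(1)] measure_carrier[OF xy(2)]])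
  next
    fix x y z assume xyz: "x \<in> carrier M" "y \<in> carrier M" "z \<in> carrier M"
    show "x \<oplus>\<^bsub>M\<^esub> y \<oplus>\<^bsub>M\<^esub> z = x \<oplus>\<^bsub>M\<^esub> (y \<oplus>\<^bsub>M\<^esub> z)"
      unfolding M_simps
      by (rule restrict_ext) (use xyz in \<open>simp add: measure_carrier Q.a_assoc\<close>)
  qed (simp add: zero_measure)
  show "comm_monoid M"
  proof (rule comm_monoidI)
    fix x assume "x \<in> carrier M"
    then have x: "is_measure B p x" by simp
    show "\<one>\<^bsub>M\<^esub> \<otimes>\<^bsub>M\<^esub> x = x"
      unfolding M_simps
      by (rule ext[OF conv_measure[OF delta_measure[OF V_zero_L] x] x])
        (simp only: conv_delta[OF V_zero_L x] transl_zero)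
  next
    fix x y assume "x \<in> carrier M" "y \<in> carrier M"
    then show "x \<otimes>\<^bsub>M\<^esub> y \<in> carrier M" "x \<otimes>\<^bsub>M\<^esub> y = y \<otimes>\<^bsub>M\<^esub> x"
      by (simp_all only: M_simps mem_Collect_eq conv_measure conv_comm[of x y])
  qed (simp_all add: delta_measure conv_assoc)
  fix x y z assume "x \<in> carrier M" "y \<in> carrier M" "z \<in> carrier M"
  then have x: "is_measure B p x" and y: "is_measure B p y" and z: "is_measure B p z" by simp_all
  show "(x \<oplus>\<^bsub>M\<^esub> y) \<otimes>\<^bsub>M\<^esub> z = x \<otimes>\<^bsub>M\<^esub> z \<oplus>\<^bsub>M\<^esub> y \<otimes>\<^bsub>M\<^esub> z"
    unfolding M_simps
    by (rule ext[OF conv_measure[OF add_measure[OF x y] z] add_measure[OF conv_measure[OF x z] conv_measure[OF y z]]])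
      (simp add: conv_apply integ_CL[OF z])
qed

end

section \<open>Geometric sums of Dirac measures\<close>

text \<open>Recursion on the length instead of \<open>finsum\<close> over an interval: the estimates
  below go by induction and regroup the terms into blocks.\<close>

primrec psum :: "('a, 'm) ring_scheme \<Rightarrow> (nat \<Rightarrow> 'a) \<Rightarrow> nat \<Rightarrow> 'a" where
  "psum R f 0 = \<zero>\<^bsub>R\<^esub>"
| "psum R f (Suc n) = psum R f n \<oplus>\<^bsub>R\<^esub> f n"

lemma (in abelian_monoid) psum_closed [simp]:
  "(\<And>i. f i \<in> carrier G) \<Longrightarrow> psum G f n \<in> carrier G"
  by (induction n) auto

lemma (in abelian_monoid) psum_split:
  "(\<And>i. f i \<in> carrier G) \<Longrightarrow> psum G f (m + n) = psum G f m \<oplus> psum G (\<lambda>i. f (m + i)) n"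
  by (induction n) (simp_all add: a_assoc)

lemma (in abelian_monoid) psum_add:
  "(\<And>i. f i \<in> carrier G) \<Longrightarrow> (\<And>i. g i \<in> carrier G) \<Longrightarrow>
    psum G (\<lambda>i. f i \<oplus> g i) n = psum G f n \<oplus> psum G g n"
  by (induction n) (simp_all add: a_ac)

lemma (in cring) psum_scale:
  "(\<And>i. f i \<in> carrier R) \<Longrightarrow> c \<in> carrier R \<Longrightarrow> psum R (\<lambda>i. c \<otimes> f i) n = c \<otimes> psum R f n"
  by (induction n) (simp_all add: r_distr)

text \<open>Indices below K s are sorted by their residue modulo K. For geometric series: (1 + ... +
  t^(K-1)) (1 + t^K + ... + t^(K(s-1))) = 1 + ... + t^(Ks-1).\<close>

lemma (in abelian_monoid) psum_psum:
  assumes "\<And>i. g i \<in> carrier G"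
  shows "psum G (\<lambda>j. psum G (\<lambda>i. g (K * i + j)) s) K = psum G g (K * s)"
proof (induction s)
  case 0
  have "psum G (\<lambda>j. \<zero>) K = \<zero>"
    by (induction K) simp_all
  then show ?case by simp
next
  case (Suc s)
  have "psum G (\<lambda>j. psum G (\<lambda>i. g (K * i + j)) (Suc s)) K =
      psum G (\<lambda>j. psum G (\<lambda>i. g (K * i + j)) s) K \<oplus> psum G (\<lambda>j. g (K * s + j)) K"
    unfolding psum.simps by (intro psum_add psum_closed assms)
  then show ?case
    unfolding Suc using psum_split[of g "K * s" K] assms by (simp add: add.commute)
qed

context padic_lattice
begin

sublocale M: cring M
  by (rule measure_ring_cring)

lemma psum_close:
  assumes "\<And>i. g i \<in> carrier (Qp p)" "\<And>i. h i \<in> carrier (Qp p)"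
    "\<And>i. i < n \<Longrightarrow> qp_dist p (g i) (h i) \<le> e" "e \<ge> 0"
  shows "qp_dist p (psum (Qp p) g n) (psum (Qp p) h n) \<le> e"
  using assms(3)
proof (induction n)
  case (Suc n)
  have "qp_dist p (psum (Qp p) g (Suc n)) (psum (Qp p) h (Suc n))
      \<le> max (qp_dist p (psum (Qp p) g n) (psum (Qp p) h n)) (qp_dist p (g n) (h n))"
    unfolding psum.simps using assms(1,2) by (intro qdist_add) simp_all
  also have "\<dots> \<le> e"
    using Suc by simp
  finally show ?case .
qed (use assms(4) in simp)

definition nmul :: "nat \<Rightarrow> ('v \<Rightarrow> qp) \<Rightarrow> 'v \<Rightarrow> qp" where
  "nmul n w = (\<lambda>b\<in>B. of_Q (of_nat n) \<otimes>\<^bsub>Qp p\<^esub> w b)"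

lemma L_comp: "w \<in> L \<Longrightarrow> b \<in> B \<Longrightarrow> w b \<in> carrier (Qp p) \<and> qnorm (w b) \<le> 1"
  unfolding L_at_def by (drule (1) PiE_mem) (simp add: Zp_iff)

lemma nmul_L: "w \<in> L \<Longrightarrow> nmul n w \<in> L"
  unfolding nmul_def L_at_def[of B p]
proof (subst restrict_PiE_iff, intro ballI)
  fix b assume w: "w \<in> B \<rightarrow>\<^sub>E Zp p" and b: "b \<in> B"
  then have "w b \<in> carrier (Qp p)" "qnorm (w b) \<le> 1"
    using L_comp[of w b] by (simp_all add: L_at_def)
  then show "of_Q (of_nat n) \<otimes>\<^bsub>Qp p\<^esub> w b \<in> Zp p"
    using padic_abs_int_le_1[of "int n"] padic_abs_nonneg[of p "of_nat n"] qnorm_nonneg[of "w b"]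
    by (simp add: Zp_iff qnorm_mult mult_le_one)
qed

lemma nmul_add: "w \<in> L \<Longrightarrow> nmul (m + n) w = nmul m w \<boxplus> nmul n w"
  unfolding nmul_def V_add_def
  by (rule restrict_ext) (use L_comp in \<open>simp add: of_Q_add Q.l_distr\<close>)

lemma nmul_0: "w \<in> L \<Longrightarrow> nmul 0 w = V_zero B p"
  unfolding nmul_def V_zero_def by (rule restrict_ext) (use L_comp in simp)

lemma nmul_nmul: "w \<in> L \<Longrightarrow> nmul m (nmul n w) = nmul (n * m) w"
  unfolding nmul_def
  by (rule restrict_ext) (use L_comp in \<open>simp add: of_Q_mult Q.m_ac\<close>)

lemma near_nmul:
  assumes "w \<in> L" "1 / real p ^ k < d"
  shows "near d (nmul (p ^ k * m + n) w) (nmul n w)"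
  unfolding near_def
proof
  fix b assume b: "b \<in> B"
  have wb: "w b \<in> carrier (Qp p)" "qnorm (w b) \<le> 1"
    using L_comp assms(1) b by blast+
  have "qp_dist p (nmul (p ^ k * m + n) w b) (nmul n w b)
     = qp_dist p (w b \<otimes>\<^bsub>Qp p\<^esub> of_Q (of_nat (p ^ k * m + n))) (w b \<otimes>\<^bsub>Qp p\<^esub> of_Q (of_nat n))"
    using b wb by (simp only: nmul_def restrict_apply' Q.m_comm[OF of_Q_closed])
  also have "\<dots> = qnorm (w b) * padic_abs p (of_nat (p ^ k * m))"
    using wb by (simp add: qdist_scale qdist_of_Q)
  also have "\<dots> \<le> 1 * (1 / real p ^ k)"
    using padic_abs_dvd[of k "int (p ^ k * m)"] wb qnorm_nonneg[OF wb(1)] padic_abs_nonneg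
    by (intro mult_mono) simp_all
  also have "\<dots> < d" using assms(2) by simp
  finally show "qp_dist p (nmul (p ^ k * m + n) w b) (nmul n w b) < d" .
qed

text \<open>Sums over full blocks of length \<open>p\<^sup>k\<close> are nearly divisible by a high power of \<open>p\<close>.\<close>

lemma psum_cong_power:
  assumes f: "f \<in> CL" and w: "w \<in> L" and e: "e > 0"
  obtains k where "\<And>m n. [m = n] (mod p ^ k) \<Longrightarrow>
    qp_dist p (psum (Qp p) (\<lambda>j. f (nmul j w)) m) (psum (Qp p) (\<lambda>j. f (nmul j w)) n) \<le> e"
proof -
  define g where "g j = f (nmul j w)" for j
  have g: "g j \<in> carrier (Qp p)" for j
    unfolding g_def by (rule CL_carrier[OF f nmul_L[OF w]])
  obtain d where d: "d > 0" "\<forall>x\<in>L. \<forall>y\<in>L. near d x y \<longrightarrow> qp_dist p (f x) (f y) < e"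
    using CL_unif[OF f e] by blast
  obtain k0 where k0: "1 / real p ^ k0 < d"
    using p_power_small[OF d(1)] .
  have near_g: "qp_dist p (g (p ^ k0 * N + i)) (g i) \<le> e" for N i
    unfolding g_def using d(2) nmul_L[OF w] near_nmul[OF w k0, of N i] by (meson less_imp_le)
  have gp: "psum (Qp p) g n \<in> carrier (Qp p)" for n
    by (rule Q.psum_closed) (rule g)
  define S where "S = psum (Qp p) g (p ^ k0)"
  have S: "S \<in> carrier (Qp p)"
    unfolding S_def by (rule gp)
  \<comment> \<open>Each block of p^k0 terms differs from the first one termwise by at most e, and
    in an ultrametric these errors do not add up over N blocks.\<close>
  have block: "qp_dist p (psum (Qp p) g (p ^ k0 * N)) (of_Q (of_nat N) \<otimes>\<^bsub>Qp p\<^esub> S) \<le> e" for N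
  proof (induction N)
    case 0
    show ?case using e S by simp
  next
    case (Suc N)
    have 1: "psum (Qp p) g (p ^ k0 * Suc N) = psum (Qp p) g (p ^ k0 * N) \<oplus>\<^bsub>Qp p\<^esub> psum (Qp p) (\<lambda>i. g (p ^ k0 * N + i)) (p ^ k0)"
      unfolding mult_Suc_right add.commute[of "p ^ k0"] by (rule Q.psum_split[OF g])
    have 2: "of_Q (of_nat (Suc N)) \<otimes>\<^bsub>Qp p\<^esub> S = of_Q (of_nat N) \<otimes>\<^bsub>Qp p\<^esub> S \<oplus>\<^bsub>Qp p\<^esub> S"
      using S by (simp add: of_Q_add Q.l_distr Q.a_comm)
    have "qp_dist p (psum (Qp p) (\<lambda>i. g (p ^ k0 * N + i)) (p ^ k0)) S \<le> e"
      unfolding S_def using e near_g by (intro psum_close g) simp_all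
    with Suc show ?case
      unfolding 1 2 using g S by (intro order_trans[OF qdist_add]) simp_all
  qed
  \<comment> \<open>S need not be small, but p^l S is for large l; taking k = k0 + l makes the
    number of blocks divisible by p^l.\<close>
  have "0 < e / (qnorm S + 1)"
    using e qnorm_nonneg[OF S] by simp
  then obtain l where l: "1 / real p ^ l < e / (qnorm S + 1)"
    by (rule p_power_small)
  define k where "k = k0 + l"
  have multiple: "qp_dist p (psum (Qp p) g (p ^ k * a)) \<zero>\<^bsub>Qp p\<^esub> \<le> e" for a
  proof -
    have "padic_abs p (of_nat (p ^ l * a)) * qnorm S \<le> 1 / real p ^ l * (qnorm S + 1)"
      using padic_abs_dvd[of l "int (p ^ l * a)"] qnorm_nonneg[OF S] padic_abs_nonneg
      by (intro mult_mono) simp_all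
    also have "\<dots> \<le> e"
      using l qnorm_nonneg[OF S] by (simp add: pos_less_divide_eq)
    finally have "qp_dist p (of_Q (of_nat (p ^ l * a)) \<otimes>\<^bsub>Qp p\<^esub> S) \<zero>\<^bsub>Qp p\<^esub> \<le> e"
      using S by (simp add: qdist_eq qnorm_mult a_minus_def)
    moreover have "qp_dist p (psum (Qp p) g (p ^ k * a)) (of_Q (of_nat (p ^ l * a)) \<otimes>\<^bsub>Qp p\<^esub> S) \<le> e"
      using block[of "p ^ l * a"] by (simp only: k_def power_add mult.assoc)
    ultimately show ?thesis
      using qdist_ultra[OF gp[of "p ^ k * a"] Q.m_closed[OF of_Q_closed[of "of_nat (p ^ l * a)"] S] Q.zero_closed]
      by linarith
  qed
  have shift: "qp_dist p (psum (Qp p) g (p ^ k * a + r)) (psum (Qp p) g r) \<le> e" for a r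
  proof -
    have "qp_dist p (psum (Qp p) (\<lambda>i. g (p ^ k * a + i)) r) (psum (Qp p) g r) \<le> e"
      using near_g[of "p ^ l * a"] e by (intro psum_close g) (simp_all add: k_def power_add mult.assoc)
    then have "qp_dist p (psum (Qp p) g (p ^ k * a) \<oplus>\<^bsub>Qp p\<^esub> psum (Qp p) (\<lambda>i. g (p ^ k * a + i)) r)
        (\<zero>\<^bsub>Qp p\<^esub> \<oplus>\<^bsub>Qp p\<^esub> psum (Qp p) g r) \<le> e"
      using multiple g by (intro order_trans[OF qdist_add]) simp_all
    then show ?thesis
      using g by (simp add: Q.psum_split)
  qed
  have "qp_dist p (psum (Qp p) g m) (psum (Qp p) g n) \<le> e" if "[m = n] (mod p ^ k)" for m n
  proof -
    have "qp_dist p (psum (Qp p) g m) (psum (Qp p) g (m mod p ^ k)) \<le> e" for m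
      using shift[of "m div p ^ k" "m mod p ^ k"] by simp
    from this[of m] this[of n] that have 1: "qp_dist p (psum (Qp p) g m) (psum (Qp p) g (m mod p ^ k)) \<le> e"
      "qp_dist p (psum (Qp p) g n) (psum (Qp p) g (m mod p ^ k)) \<le> e"
      by (simp_all add: cong_def)
    then show ?thesis
      using g QM.commute[of "psum (Qp p) g n"]
      by (intro order_trans[OF qdist_ultra[of _ "psum (Qp p) g (m mod p ^ k)"]]) simp_all
  qed
  then show ?thesis
    using that unfolding g_def by blast
qed

lemma psum_M_apply:
  assumes "\<And>i. is_measure B p (\<mu> i)" "f \<in> CL"
  shows "psum M \<mu> n f = psum (Qp p) (\<lambda>i. \<mu> i f) n"
  using assms(2) by (induction n) simp_all

lemma psum_M_measure: "(\<And>i. is_measure B p (\<mu> i)) \<Longrightarrow> is_measure B p (psum M \<mu> n)"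
  using M.psum_closed[of \<mu> n] by simp

text \<open>The inverse of \<open>1 + t + \<dots> + t\<^bsup>K-1\<^esup>\<close> is the limit of \<open>1 + t\<^sup>K + \<dots> + t\<^bsup>K(s-1)\<^esup>\<close> for natural
  numbers \<open>s\<close> tending to \<open>1 / K\<close> in \<open>\<int>\<^sub>p\<close>.\<close>

lemma geometric_sum_unit:
  assumes w: "w \<in> L" and K: "coprime K p"
  shows "psum M (\<lambda>j. delta (nmul j w)) K \<in> Units M"
proof -
  define u where "u = nmul K w"
  have u: "u \<in> L" unfolding u_def by (rule nmul_L[OF w])
  have "\<exists>s. [K * s = 1] (mod p ^ n)" for n
    using cong_solve_coprime_nat[of K "p ^ n"] K by (auto simp: coprime_commute)
  then obtain s where s: "\<And>n. [K * s n = 1] (mod p ^ n)"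
    by metis
  have s_cong: "[s m = s n] (mod p ^ k)" if "k \<le> m" "k \<le> n" for k m n
  proof -
    have "[K * s m = 1] (mod p ^ k)" "[K * s n = 1] (mod p ^ k)"
      using s that by (meson cong_dvd_modulus_nat le_imp_power_dvd)+
    then have "[K * s m = K * s n] (mod p ^ k)"
      by (metis cong_sym cong_trans)
    then show ?thesis
      using K by (simp add: cong_mult_lcancel_nat coprime_commute)
  qed
  define \<sigma> where "\<sigma> n f = psum (Qp p) (\<lambda>j. f (nmul j u)) (s n)" for n and f :: "'v func"
  have fc: "f (nmul j u) \<in> carrier (Qp p)" if "f \<in> CL" for f j
    by (rule CL_carrier[OF that nmul_L[OF u]])
  have \<sigma>c: "\<sigma> n f \<in> carrier (Qp p)" if "f \<in> CL" for n f
    unfolding \<sigma>_def by (rule Q.psum_closed) (rule fc[OF that])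
  define is_lim where "is_lim f \<xi> \<longleftrightarrow> \<xi> \<in> carrier (Qp p) \<and> (\<forall>e>0. \<exists>N. \<forall>n\<ge>N. qp_dist p (\<sigma> n f) \<xi> \<le> e)"
    for f \<xi>
  have lim_ex: "\<exists>\<xi>. is_lim f \<xi>" if f: "f \<in> CL" for f
  proof -
    have "QM.MCauchy (\<lambda>n. \<sigma> n f)"
      unfolding QM.MCauchy_def
    proof (intro conjI allI impI)
      fix e :: real assume "e > 0"
      then have e2: "e / 2 > 0" by simp
      obtain k where k: "\<And>m n. [m = n] (mod p ^ k) \<Longrightarrow>
          qp_dist p (psum (Qp p) (\<lambda>j. f (nmul j u)) m) (psum (Qp p) (\<lambda>j. f (nmul j u)) n) \<le> e / 2"
        using psum_cong_power[OF f u e2] by blast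
      show "\<exists>N. \<forall>n n'. N \<le> n \<longrightarrow> N \<le> n' \<longrightarrow> qp_dist p (\<sigma> n f) (\<sigma> n' f) < e"
      proof (intro exI[of _ k] allI impI)
        fix n n' assume "k \<le> n" "k \<le> n'"
        then show "qp_dist p (\<sigma> n f) (\<sigma> n' f) < e"
          using k[OF s_cong[of k n n']] e2 unfolding \<sigma>_def by linarith
      qed
    qed (use \<sigma>c[OF f] in blast)
    from mcomplete_Qp[unfolded QM.mcomplete_def, rule_format, OF this]
    obtain \<xi> where "limitin QM.mtopology (\<lambda>n. \<sigma> n f) \<xi> sequentially"
      by blast
    then show ?thesis
      unfolding QM.limitin_metric eventually_sequentially is_lim_def by (meson less_imp_le)
  qed
  then obtain I where I: "\<And>f. f \<in> CL \<Longrightarrow> is_lim f (I f)"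
    by metis
  have Ic: "I f \<in> carrier (Qp p)" if "f \<in> CL" for f
    using I[OF that] by (simp add: is_lim_def)
  have Ilim: "\<exists>N. \<forall>n\<ge>N. qp_dist p (\<sigma> n f) (I f) \<le> e" if "f \<in> CL" "e > 0" for f e
    using I[OF that(1)] that(2) by (simp add: is_lim_def)
  \<comment> \<open>\<open>I\<close> picks a limit by choice; uniqueness of limits is what makes it
    additive and homogeneous.\<close>
  have unique: "I f = \<xi>" if f: "f \<in> CL" and x: "\<xi> \<in> carrier (Qp p)" and
    lim: "\<And>e. e > 0 \<Longrightarrow> \<exists>N. \<forall>n\<ge>N. qp_dist p (\<sigma> n f) \<xi> \<le> e" for f \<xi>
  proof -
    have "I f \<ominus>\<^bsub>Qp p\<^esub> \<xi> = \<zero>\<^bsub>Qp p\<^esub>"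
    proof (rule qnorm_le_0)
      fix e :: real assume e: "e > 0"
      obtain N1 where N1: "\<forall>n\<ge>N1. qp_dist p (\<sigma> n f) (I f) \<le> e"
        using Ilim[OF f e] by blast
      obtain N2 where N2: "\<forall>n\<ge>N2. qp_dist p (\<sigma> n f) \<xi> \<le> e"
        using lim[OF e] by blast
      have "qp_dist p (I f) (\<sigma> (max N1 N2) f) \<le> e" "qp_dist p (\<sigma> (max N1 N2) f) \<xi> \<le> e"
        using N1 N2 QM.commute[of "I f"] by simp_all
      then have "qp_dist p (I f) \<xi> \<le> e"
        using qdist_ultra[OF Ic[OF f] \<sigma>c[OF f] x, of "max N1 N2"] by linarith
      then show "qnorm (I f \<ominus>\<^bsub>Qp p\<^esub> \<xi>) \<le> e"
        unfolding qdist_eq[OF Ic[OF f] x] .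
    qed (rule Q.minus_closed[OF Ic[OF f] x])
    then show ?thesis
      unfolding Q.diff_eq_zero_iff[OF Ic[OF f] x] .
  qed
  have I_measure: "is_measure B p (\<lambda>f\<in>CL. I f)"
  proof (rule measureI)
    fix f g assume f: "f \<in> CL" and g: "g \<in> CL"
    show "I (\<lambda>x\<in>L. f x \<oplus>\<^bsub>Qp p\<^esub> g x) = I f \<oplus>\<^bsub>Qp p\<^esub> I g"
    proof (rule unique[OF CL_add[OF f g] Q.add.m_closed[OF Ic[OF f] Ic[OF g]]])
      fix e :: real assume e: "e > 0"
      obtain N1 where N1: "\<forall>n\<ge>N1. qp_dist p (\<sigma> n f) (I f) \<le> e"
        using Ilim[OF f e] by blast
      obtain N2 where N2: "\<forall>n\<ge>N2. qp_dist p (\<sigma> n g) (I g) \<le> e"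
        using Ilim[OF g e] by blast
      have "\<sigma> n (\<lambda>x\<in>L. f x \<oplus>\<^bsub>Qp p\<^esub> g x) = \<sigma> n f \<oplus>\<^bsub>Qp p\<^esub> \<sigma> n g" for n
        unfolding \<sigma>_def restrict_apply'[OF nmul_L[OF u]]
        by (rule Q.psum_add) (rule fc[OF f] fc[OF g])+
      then have "qp_dist p (\<sigma> n (\<lambda>x\<in>L. f x \<oplus>\<^bsub>Qp p\<^esub> g x)) (I f \<oplus>\<^bsub>Qp p\<^esub> I g) \<le> e" if "n \<ge> max N1 N2" for n
        using qdist_add[OF \<sigma>c[OF f, of n] \<sigma>c[OF g, of n] Ic[OF f] Ic[OF g]] N1 N2 that by fastforce
      then show "\<exists>N. \<forall>n\<ge>N. qp_dist p (\<sigma> n (\<lambda>x\<in>L. f x \<oplus>\<^bsub>Qp p\<^esub> g x)) (I f \<oplus>\<^bsub>Qp p\<^esub> I g) \<le> e"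
        by blast
    qed
  next
    fix c f assume c: "c \<in> carrier (Qp p)" and f: "f \<in> CL"
    show "I (\<lambda>x\<in>L. c \<otimes>\<^bsub>Qp p\<^esub> f x) = c \<otimes>\<^bsub>Qp p\<^esub> I f"
    proof (rule unique[OF CL_scale[OF c f] Q.m_closed[OF c Ic[OF f]]])
      fix e :: real assume e: "e > 0"
      have pos: "qnorm c + 1 > 0"
        using qnorm_nonneg[OF c] by simp
      obtain N where N: "\<forall>n\<ge>N. qp_dist p (\<sigma> n f) (I f) \<le> e / (qnorm c + 1)"
        using Ilim[OF f, of "e / (qnorm c + 1)"] e pos by auto
      have eq: "\<sigma> n (\<lambda>x\<in>L. c \<otimes>\<^bsub>Qp p\<^esub> f x) = c \<otimes>\<^bsub>Qp p\<^esub> \<sigma> n f" for n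
        unfolding \<sigma>_def restrict_apply'[OF nmul_L[OF u]] by (rule Q.psum_scale) (rule fc[OF f] c)+
      have "qp_dist p (\<sigma> n (\<lambda>x\<in>L. c \<otimes>\<^bsub>Qp p\<^esub> f x)) (c \<otimes>\<^bsub>Qp p\<^esub> I f) \<le> e" if n: "n \<ge> N" for n
      proof -
        have "qnorm c * qp_dist p (\<sigma> n f) (I f) \<le> (qnorm c + 1) * (e / (qnorm c + 1))"
          using N n pos qnorm_nonneg[OF c] by (intro mult_mono) simp_all
        then show ?thesis
          unfolding eq qdist_scale[OF c \<sigma>c[OF f] Ic[OF f]] using pos by simp
      qed
      then show "\<exists>N. \<forall>n\<ge>N. qp_dist p (\<sigma> n (\<lambda>x\<in>L. c \<otimes>\<^bsub>Qp p\<^esub> f x)) (c \<otimes>\<^bsub>Qp p\<^esub> I f) \<le> e"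
        by blast
    qed
  next
    fix e :: real assume e: "e > 0"
    have "qnorm (I f) \<le> e" if f: "f \<in> CL" "\<forall>x\<in>L. qnorm (f x) \<le> e" for f
    proof -
      obtain N where N: "\<forall>n\<ge>N. qp_dist p (\<sigma> n f) (I f) \<le> e"
        using Ilim[OF f(1) e] by blast
      have "qp_dist p (\<sigma> N f) (psum (Qp p) (\<lambda>j. \<zero>\<^bsub>Qp p\<^esub>) (s N)) \<le> e"
        unfolding \<sigma>_def
        by (rule psum_close) (use f(2) nmul_L[OF u] e fc[OF f(1)] in \<open>simp_all add: qdist_eq a_minus_def\<close>)
      moreover have "psum (Qp p) (\<lambda>j. \<zero>\<^bsub>Qp p\<^esub>) m = \<zero>\<^bsub>Qp p\<^esub>" for m
        by (induction m) simp_all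
      ultimately have "qp_dist p (\<sigma> N f) \<zero>\<^bsub>Qp p\<^esub> \<le> e"
        by simp
      moreover have "qp_dist p (I f) (\<sigma> N f) \<le> e"
        using N QM.commute[of "I f"] by simp
      ultimately have "qp_dist p (I f) \<zero>\<^bsub>Qp p\<^esub> \<le> e"
        using qdist_ultra[OF Ic[OF f(1)] \<sigma>c[OF f(1)] Q.zero_closed, of N] by linarith
      then show ?thesis
        using Ic[OF f(1)] by (simp add: qdist_eq a_minus_def)
    qed
    then show "\<exists>d>0. \<forall>f\<in>CL. (\<forall>x\<in>L. qnorm (f x) \<le> d) \<longrightarrow> qnorm (I f) \<le> e"
      using e by blast
  qed (rule Ic)
  define A where "A = psum M (\<lambda>j. delta (nmul j w)) K"
  have dm: "is_measure B p (delta (nmul j w))" for j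
    by (rule delta_measure[OF nmul_L[OF w]])
  have A: "is_measure B p A"
    unfolding A_def by (rule psum_M_measure[OF dm])
  let ?I = "\<lambda>f\<in>CL. I f"
  have "A \<otimes>\<^bsub>M\<^esub> ?I = \<one>\<^bsub>M\<^esub>"
    unfolding M_simps
  proof (rule measure_eqI[OF conv_measure[OF A I_measure] delta_measure[OF V_zero_L]])
    fix f assume f: "f \<in> CL"
    define h where "h j = transl (nmul j w) f" for j
    have h: "h j \<in> CL" for j
      unfolding h_def by (rule CL_transl[OF nmul_L[OF w] f])
    have "(A \<star> ?I) f = psum (Qp p) (\<lambda>j. delta (nmul j w) (integ ?I f)) K"
      unfolding conv_apply[OF f] A_def by (rule psum_M_apply[OF dm integ_CL[OF I_measure f]])
    also have "\<dots> = psum (Qp p) (\<lambda>j. I (h j)) K"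
      unfolding delta_apply[OF integ_CL[OF I_measure f]] integ_apply[OF nmul_L[OF w]]
        h_def[symmetric] restrict_apply'[OF h] ..
    finally have lhs: "(A \<star> ?I) f = psum (Qp p) (\<lambda>j. I (h j)) K" .
    have f0: "f (V_zero B p) \<in> carrier (Qp p)"
      by (rule CL_carrier[OF f V_zero_L])
    have ps: "psum (Qp p) (\<lambda>j. I (h j)) K \<in> carrier (Qp p)"
      by (rule Q.psum_closed) (rule Ic[OF h])
    have ps\<sigma>: "psum (Qp p) (\<lambda>j. \<sigma> n (h j)) K \<in> carrier (Qp p)" for n
      by (rule Q.psum_closed) (rule \<sigma>c[OF h])
    have "psum (Qp p) (\<lambda>j. I (h j)) K \<ominus>\<^bsub>Qp p\<^esub> f (V_zero B p) = \<zero>\<^bsub>Qp p\<^esub>"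
    proof (rule qnorm_le_0)
      fix e :: real assume e: "e > 0"
      obtain k where k: "\<And>m n. [m = n] (mod p ^ k) \<Longrightarrow>
          qp_dist p (psum (Qp p) (\<lambda>j. f (nmul j w)) m) (psum (Qp p) (\<lambda>j. f (nmul j w)) n) \<le> e"
        using psum_cong_power[OF f w e] by blast
      have "\<forall>j. \<exists>N. \<forall>n\<ge>N. qp_dist p (\<sigma> n (h j)) (I (h j)) \<le> e"
        using Ilim[OF h e] by blast
      then obtain N where N: "\<And>j n. n \<ge> N j \<Longrightarrow> qp_dist p (\<sigma> n (h j)) (I (h j)) \<le> e"
        by metis
      \<comment> \<open>One index that is large enough for k and for the convergence of all K
        sequences \<open>\<sigma> n (h j)\<close>.\<close>
      define n where "n = Max (insert k (N ` {..<K}))"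
      have n: "n \<ge> k" "\<And>j. j < K \<Longrightarrow> n \<ge> N j"
        by (simp_all add: n_def)
      have gc: "f (nmul i w) \<in> carrier (Qp p)" for i
        by (rule CL_carrier[OF f nmul_L[OF w]])
      have "\<sigma> n (h j) = psum (Qp p) (\<lambda>i. f (nmul (K * i + j) w)) (s n)" for j
      proof -
        have "h j (nmul i u) = f (nmul (K * i + j) w)" for i
          unfolding h_def transl_apply[OF nmul_L[OF u]] unfolding u_def nmul_nmul[OF w]
            nmul_add[OF w, symmetric] by (simp add: add.commute)
        then show ?thesis
          by (simp add: \<sigma>_def)
      qed
      \<comment> \<open>The two geometric sums multiply to one of length K s n, and this length is 1
        modulo p^k: up to e it is the sum of length 1, that is the value at 0.\<close>
      then have "psum (Qp p) (\<lambda>j. \<sigma> n (h j)) K = psum (Qp p) (\<lambda>j. f (nmul j w)) (K * s n)"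
        using Q.psum_psum[of "\<lambda>i. f (nmul i w)" K "s n"] gc by simp
      moreover have "psum (Qp p) (\<lambda>j. f (nmul j w)) 1 = f (V_zero B p)"
        using f0 by (simp add: nmul_0[OF w])
      moreover have "[K * s n = 1] (mod p ^ k)"
        using s[of n] n(1) by (meson cong_dvd_modulus_nat le_imp_power_dvd)
      ultimately have 1: "qp_dist p (psum (Qp p) (\<lambda>j. \<sigma> n (h j)) K) (f (V_zero B p)) \<le> e"
        using k[of "K * s n" 1] by simp
      have "qp_dist p (psum (Qp p) (\<lambda>j. \<sigma> n (h j)) K) (psum (Qp p) (\<lambda>j. I (h j)) K) \<le> e"
        by (rule psum_close) (use \<sigma>c[OF h] Ic[OF h] N n(2) e in simp_all)
      then have "qp_dist p (psum (Qp p) (\<lambda>j. I (h j)) K) (f (V_zero B p)) \<le> e"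
        using 1 qdist_ultra[OF ps ps\<sigma>[of n] f0]
          QM.commute[of "psum (Qp p) (\<lambda>j. I (h j)) K"] by simp
      then show "qnorm (psum (Qp p) (\<lambda>j. I (h j)) K \<ominus>\<^bsub>Qp p\<^esub> f (V_zero B p)) \<le> e"
        unfolding qdist_eq[OF ps f0] .
    qed (rule Q.minus_closed[OF ps f0])
    then show "(A \<star> ?I) f = delta (V_zero B p) f"
      unfolding lhs delta_apply[OF f] Q.diff_eq_zero_iff[OF ps f0] .
  qed
  moreover have "?I \<otimes>\<^bsub>M\<^esub> A = A \<otimes>\<^bsub>M\<^esub> ?I"
    using A I_measure by (intro M.m_comm) simp_all
  ultimately show ?thesis
    unfolding A_def[symmetric] Units_def using A I_measure by auto
qed

end

section \<open>Localizations\<close>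

locale cring_localization = cring R for R (structure) +
  fixes S
  assumes S_subset: "S \<subseteq> carrier R" and one_S: "\<one> \<in> S"
    and mult_S: "s \<in> S \<Longrightarrow> t \<in> S \<Longrightarrow> s \<otimes> t \<in> S"
begin

lemma S_carrier [simp]: "s \<in> S \<Longrightarrow> s \<in> carrier R"
  using S_subset by blast

abbreviation "Loc \<equiv> localization R S"
abbreviation "fract \<equiv> loc_frac R S"

text \<open>The form without subtraction, in which equality of fractions is mostly a matter of
  associativity and commutativity.\<close>

lemma loc_rel_iff:
  "((a, s), (b, t)) \<in> loc_rel R S \<longleftrightarrow> a \<in> carrier R \<and> s \<in> S \<and> b \<in> carrier R \<and> t \<in> S \<and>
     (\<exists>u\<in>S. u \<otimes> (t \<otimes> a) = u \<otimes> (s \<otimes> b))"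
proof -
  have "u \<otimes> (t \<otimes> a \<ominus> s \<otimes> b) = \<zero> \<longleftrightarrow> u \<otimes> (t \<otimes> a) = u \<otimes> (s \<otimes> b)"
    if "a \<in> carrier R" "s \<in> S" "b \<in> carrier R" "t \<in> S" "u \<in> S" for u
  proof -
    have "u \<otimes> (t \<otimes> a \<ominus> s \<otimes> b) = u \<otimes> (t \<otimes> a) \<ominus> u \<otimes> (s \<otimes> b)"
      using that by (simp add: a_minus_def r_distr r_minus)
    then show ?thesis
      using that by (simp add: diff_eq_zero_iff)
  qed
  then show ?thesis
    unfolding loc_rel_def by auto
qed

lemma equiv_loc_rel: "equiv (carrier R \<times> S) (loc_rel R S)"
proof (rule equivI)
  show "loc_rel R S \<subseteq> (carrier R \<times> S) \<times> carrier R \<times> S"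
    by (auto simp: loc_rel_def)
  show "refl_on (carrier R \<times> S) (loc_rel R S)"
    using one_S by (auto simp: refl_on_def loc_rel_iff)
  show "sym (loc_rel R S)"
    unfolding sym_def by (auto simp: loc_rel_iff) metis
  show "trans (loc_rel R S)"
    unfolding trans_def
  proof (clarify)
    fix a s b t c r
    assume "((a, s), (b, t)) \<in> loc_rel R S" "((b, t), (c, r)) \<in> loc_rel R S"
    then obtain u v where uv: "u \<in> S" "u \<otimes> (t \<otimes> a) = u \<otimes> (s \<otimes> b)" "v \<in> S" "v \<otimes> (r \<otimes> b) = v \<otimes> (t \<otimes> c)"
      and c: "a \<in> carrier R" "s \<in> S" "b \<in> carrier R" "t \<in> S" "c \<in> carrier R" "r \<in> S"
      by (auto simp: loc_rel_iff)
    \<comment> \<open>The witness contains t besides u and v, because the middle denominator need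
      not be cancellable.\<close>
    have "u \<otimes> v \<otimes> t \<otimes> (r \<otimes> a) = v \<otimes> r \<otimes> (u \<otimes> (t \<otimes> a))"
      using uv(1,3) c by (simp add: m_ac)
    also have "\<dots> = u \<otimes> s \<otimes> (v \<otimes> (r \<otimes> b))"
      unfolding uv(2) using uv(1,3) c by (simp add: m_ac)
    also have "\<dots> = u \<otimes> v \<otimes> t \<otimes> (s \<otimes> c)"
      unfolding uv(4) using uv(1,3) c by (simp add: m_ac)
    finally show "((a, s), (c, r)) \<in> loc_rel R S"
      using uv(1,3) c mult_S unfolding loc_rel_iff by blast
  qed
qed

lemma frac_eq_iff:
  assumes "a \<in> carrier R" "s \<in> S" "b \<in> carrier R" "t \<in> S"
  shows "fract a s = fract b t \<longleftrightarrow> (\<exists>u\<in>S. u \<otimes> (t \<otimes> a) = u \<otimes> (s \<otimes> b))"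
  unfolding loc_frac_def using eq_equiv_class_iff[OF equiv_loc_rel, of "(a, s)" "(b, t)"] assms
  by (simp add: loc_rel_iff)

lemma frac_eqI:
  assumes "a \<in> carrier R" "s \<in> S" "b \<in> carrier R" "t \<in> S" "t \<otimes> a = s \<otimes> b"
  shows "fract a s = fract b t"
  using assms one_S by (auto simp: frac_eq_iff intro!: bexI[of _ \<one>])

lemma frac_cancel:
  assumes "a \<in> carrier R" "s \<in> S" "t \<in> S"
  shows "fract (t \<otimes> a) (t \<otimes> s) = fract a s"
  by (rule frac_eqI) (use assms mult_S in \<open>simp_all add: m_ac\<close>)

lemma frac_closed: "a \<in> carrier R \<Longrightarrow> s \<in> S \<Longrightarrow> fract a s \<in> carrier Loc"
  unfolding localization_def loc_frac_def by (auto intro!: quotientI)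

lemma Loc_cases:
  assumes "X \<in> carrier Loc" obtains a s where "a \<in> carrier R" "s \<in> S" "X = fract a s"
  using assms unfolding localization_def loc_frac_def by (auto elim!: quotientE)

lemma frac_mem: "a \<in> carrier R \<Longrightarrow> s \<in> S \<Longrightarrow> x \<in> fract a s \<Longrightarrow>
  \<exists>b t. x = (b, t) \<and> b \<in> carrier R \<and> t \<in> S \<and> fract b t = fract a s"
  using equiv_class_eq[OF equiv_loc_rel, of "(a, s)" x]
  by (cases x) (auto simp: loc_frac_def loc_rel_iff)

lemma frac_self: "a \<in> carrier R \<Longrightarrow> s \<in> S \<Longrightarrow> (a, s) \<in> fract a s"
  using one_S by (auto simp: loc_frac_def loc_rel_iff)

text \<open>The ring operations are unions over all representatives. If the result does not depend
  on the representatives, every member of the union is the same set and the union collapses to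
  it.\<close>

lemma union_fracs:
  assumes X: "a \<in> carrier R" "s \<in> S" and Y: "b \<in> carrier R" "t \<in> S"
    and eq: "\<And>a' s' b' t'. a' \<in> carrier R \<Longrightarrow> s' \<in> S \<Longrightarrow> b' \<in> carrier R \<Longrightarrow> t' \<in> S \<Longrightarrow>
      fract a' s' = fract a s \<Longrightarrow> fract b' t' = fract b t \<Longrightarrow> F a' s' b' t' = F a s b t"
  shows "(\<Union>(a, s)\<in>fract a s. \<Union>(b, t)\<in>fract b t. F a s b t) = F a s b t"
proof
  show "(\<Union>(a, s)\<in>fract a s. \<Union>(b, t)\<in>fract b t. F a s b t) \<subseteq> F a s b t"
  proof (clarify)
    fix a' s' b' t' z assume "(a', s') \<in> fract a s" "(b', t') \<in> fract b t" and z: "z \<in> F a' s' b' t'"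
    then have "F a' s' b' t' = F a s b t"
      using frac_mem[OF X] frac_mem[OF Y] by (intro eq) blast+
    with z show "z \<in> F a s b t" by simp
  qed
  show "F a s b t \<subseteq> (\<Union>(a, s)\<in>fract a s. \<Union>(b, t)\<in>fract b t. F a s b t)"
    using frac_self[OF X] frac_self[OF Y] by blast
qed

lemma frac_mult:
  assumes "a \<in> carrier R" "s \<in> S" "b \<in> carrier R" "t \<in> S"
  shows "fract a s \<otimes>\<^bsub>Loc\<^esub> fract b t = fract (a \<otimes> b) (s \<otimes> t)"
proof -
  have "fract (a' \<otimes> b') (s' \<otimes> t') = fract (a \<otimes> b) (s \<otimes> t)"
    if c: "a' \<in> carrier R" "s' \<in> S" "b' \<in> carrier R" "t' \<in> S"
      and fe: "fract a' s' = fract a s" "fract b' t' = fract b t" for a' s' b' t'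
  proof -
    obtain u v where uv: "u \<in> S" "u \<otimes> (s \<otimes> a') = u \<otimes> (s' \<otimes> a)" "v \<in> S" "v \<otimes> (t \<otimes> b') = v \<otimes> (t' \<otimes> b)"
      using fe unfolding frac_eq_iff[OF c(1,2) assms(1,2)] frac_eq_iff[OF c(3,4) assms(3,4)] by blast
    have "u \<otimes> v \<otimes> (s \<otimes> t \<otimes> (a' \<otimes> b')) = (u \<otimes> (s \<otimes> a')) \<otimes> (v \<otimes> (t \<otimes> b'))"
      using uv(1,3) c assms by (simp add: m_ac)
    also have "\<dots> = u \<otimes> v \<otimes> (s' \<otimes> t' \<otimes> (a \<otimes> b))"
      unfolding uv(2,4) using uv(1,3) c assms by (simp add: m_ac)
    finally show ?thesis
      using uv(1,3) c assms mult_S by (subst frac_eq_iff) (simp_all, blast)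
  qed
  then show ?thesis
    using union_fracs[OF assms, of "\<lambda>a s b t. fract (a \<otimes> b) (s \<otimes> t)"]
    by (simp add: localization_def)
qed

lemma frac_add:
  assumes "a \<in> carrier R" "s \<in> S" "b \<in> carrier R" "t \<in> S"
  shows "fract a s \<oplus>\<^bsub>Loc\<^esub> fract b t = fract (t \<otimes> a \<oplus> s \<otimes> b) (s \<otimes> t)"
proof -
  have "fract (t' \<otimes> a' \<oplus> s' \<otimes> b') (s' \<otimes> t') = fract (t \<otimes> a \<oplus> s \<otimes> b) (s \<otimes> t)"
    if c: "a' \<in> carrier R" "s' \<in> S" "b' \<in> carrier R" "t' \<in> S"
      and fe: "fract a' s' = fract a s" "fract b' t' = fract b t" for a' s' b' t'
  proof -
    obtain u v where uv: "u \<in> S" "u \<otimes> (s \<otimes> a') = u \<otimes> (s' \<otimes> a)" "v \<in> S" "v \<otimes> (t \<otimes> b') = v \<otimes> (t' \<otimes> b)"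
      using fe unfolding frac_eq_iff[OF c(1,2) assms(1,2)] frac_eq_iff[OF c(3,4) assms(3,4)] by blast
    have "u \<otimes> v \<otimes> (s \<otimes> t \<otimes> (t' \<otimes> a' \<oplus> s' \<otimes> b')) =
        v \<otimes> t \<otimes> t' \<otimes> (u \<otimes> (s \<otimes> a')) \<oplus> u \<otimes> s \<otimes> s' \<otimes> (v \<otimes> (t \<otimes> b'))"
      using uv(1,3) c assms by (simp add: m_ac r_distr)
    also have "\<dots> = u \<otimes> v \<otimes> (s' \<otimes> t' \<otimes> (t \<otimes> a \<oplus> s \<otimes> b))"
      unfolding uv(2,4) using uv(1,3) c assms by (simp add: m_ac r_distr)
    finally show ?thesis
      using uv(1,3) c assms mult_S by (subst frac_eq_iff) (simp_all, blast)
  qed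
  then show ?thesis
    using union_fracs[OF assms, of "\<lambda>a s b t. fract (t \<otimes> a \<oplus> s \<otimes> b) (s \<otimes> t)"]
    by (simp add: localization_def)
qed

lemma frac_add_same:
  assumes "a \<in> carrier R" "b \<in> carrier R" "s \<in> S"
  shows "fract a s \<oplus>\<^bsub>Loc\<^esub> fract b s = fract (a \<oplus> b) s"
  using assms frac_cancel[of "a \<oplus> b" s s] by (simp add: frac_add r_distr)

lemma Loc_one: "\<one>\<^bsub>Loc\<^esub> = fract \<one> \<one>" and Loc_zero: "\<zero>\<^bsub>Loc\<^esub> = fract \<zero> \<one>"
  by (simp_all add: localization_def)

lemma Loc_comm_monoid: "comm_monoid Loc"
proof (rule comm_monoidI)
  fix X Y assume X: "X \<in> carrier Loc" and Y: "Y \<in> carrier Loc"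
  obtain a s where a: "a \<in> carrier R" "s \<in> S" "X = fract a s" by (rule Loc_cases[OF X])
  obtain b t where b: "b \<in> carrier R" "t \<in> S" "Y = fract b t" by (rule Loc_cases[OF Y])
  show "X \<otimes>\<^bsub>Loc\<^esub> Y \<in> carrier Loc"
    using a b by (simp add: frac_mult frac_closed mult_S)
  show "X \<otimes>\<^bsub>Loc\<^esub> Y = Y \<otimes>\<^bsub>Loc\<^esub> X"
    using a b by (simp add: frac_mult m_comm)
  show "\<one>\<^bsub>Loc\<^esub> \<otimes>\<^bsub>Loc\<^esub> X = X"
    using a one_S by (simp add: Loc_one frac_mult)
  fix Z assume Z: "Z \<in> carrier Loc"
  obtain c r where c: "c \<in> carrier R" "r \<in> S" "Z = fract c r" by (rule Loc_cases[OF Z])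
  show "X \<otimes>\<^bsub>Loc\<^esub> Y \<otimes>\<^bsub>Loc\<^esub> Z = X \<otimes>\<^bsub>Loc\<^esub> (Y \<otimes>\<^bsub>Loc\<^esub> Z)"
    using a b c by (simp add: frac_mult mult_S m_assoc)
qed (simp add: Loc_one frac_closed one_S)

lemma Loc_abelian_monoid: "abelian_monoid Loc"
proof (rule abelian_monoidI)
  fix X Y assume X: "X \<in> carrier Loc" and Y: "Y \<in> carrier Loc"
  obtain a s where a: "a \<in> carrier R" "s \<in> S" "X = fract a s" by (rule Loc_cases[OF X])
  obtain b t where b: "b \<in> carrier R" "t \<in> S" "Y = fract b t" by (rule Loc_cases[OF Y])
  show "X \<oplus>\<^bsub>Loc\<^esub> Y \<in> carrier Loc"
    using a b by (simp add: frac_add frac_closed mult_S)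
  show "X \<oplus>\<^bsub>Loc\<^esub> Y = Y \<oplus>\<^bsub>Loc\<^esub> X"
    using a b by (simp add: frac_add m_comm a_comm)
  show "\<zero>\<^bsub>Loc\<^esub> \<oplus>\<^bsub>Loc\<^esub> X = X"
    using a one_S by (simp add: Loc_zero frac_add)
  fix Z assume Z: "Z \<in> carrier Loc"
  obtain c r where c: "c \<in> carrier R" "r \<in> S" "Z = fract c r" by (rule Loc_cases[OF Z])
  show "X \<oplus>\<^bsub>Loc\<^esub> Y \<oplus>\<^bsub>Loc\<^esub> Z = X \<oplus>\<^bsub>Loc\<^esub> (Y \<oplus>\<^bsub>Loc\<^esub> Z)"
    using a b c by (simp add: frac_add mult_S m_ac a_ac r_distr)
qed (simp add: Loc_zero frac_closed one_S)

sublocale Loc: comm_monoid Loc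
  by (rule Loc_comm_monoid)

sublocale LocA: abelian_monoid Loc
  by (rule Loc_abelian_monoid)

lemma finprod_frac:
  assumes "finite D" "\<And>u. u \<in> D \<Longrightarrow> d u \<in> S"
  shows "(\<Otimes>\<^bsub>Loc\<^esub>u\<in>D. fract \<one> (d u)) = fract \<one> (\<Otimes>u\<in>D. d u) \<and> (\<Otimes>u\<in>D. d u) \<in> S"
  using assms
proof (induction D)
  case empty
  then show ?case using one_S by (simp add: Loc_one)
next
  case (insert u D)
  then have "(\<Otimes>\<^bsub>Loc\<^esub>u\<in>insert u D. fract \<one> (d u)) = fract \<one> (d u) \<otimes>\<^bsub>Loc\<^esub> (\<Otimes>\<^bsub>Loc\<^esub>u\<in>D. fract \<one> (d u))"
    by (intro Loc.finprod_insert) (auto simp: frac_closed)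
  then show ?case
    using insert by (simp add: frac_mult mult_S Pi_iff)
qed

end

lemma mult_closure_localization:
  assumes "cring R" "G \<subseteq> carrier R"
  shows "cring_localization R (mult_closure R G)"
proof -
  interpret cring R by fact
  have sub: "mult_closure R G \<subseteq> carrier R"
  proof
    show "x \<in> carrier R" if "x \<in> mult_closure R G" for x
      using that by induction (use assms(2) in auto)
  qed
  have "s \<otimes>\<^bsub>R\<^esub> t \<in> mult_closure R G" if "s \<in> mult_closure R G" "t \<in> mult_closure R G" for s t
    using that(1)
  proof induction
    case one
    then show ?case using that(2) sub by auto
  next
    case (mult x y)
    then have "x \<otimes>\<^bsub>R\<^esub> y \<otimes>\<^bsub>R\<^esub> t = x \<otimes>\<^bsub>R\<^esub> (y \<otimes>\<^bsub>R\<^esub> t)"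
      using assms(2) sub that(2) by (intro m_assoc) auto
    then show ?case
      using mult by (simp add: mult_closure.mult)
  qed
  then show ?thesis
    using sub by unfold_locales (auto intro: mult_closure.one)
qed

section \<open>Functions on the vector space as formal sums of Dirac measures\<close>

text \<open>The induction step in the factorisation of 1 - x^K by 1 - x, with t the power reached so
  far.\<close>

lemma (in cring) one_minus_mult:
  assumes "t \<in> carrier R" "x \<in> carrier R"
  shows "\<one> \<ominus> t \<otimes> x = (\<one> \<ominus> t) \<oplus> (\<one> \<ominus> x) \<otimes> t"
proof -
  have "(\<one> \<ominus> x) \<otimes> t = t \<ominus> t \<otimes> x"
    using assms by (simp add: a_minus_def l_distr l_minus m_comm[of x t])
  then show ?thesis
    using assms by (simp add: a_minus_def a_assoc r_neg1)
qed

text \<open>The prime is a parameter because the locale is interpreted at several primes: at p, at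
  the primes q where the test function lives, and with Q in place of V for pullbacks to
  lines.\<close>

locale lattice_space = padic p + vs: finite_dimensional_vector_space smul B
  for p :: nat and smul :: "rat \<Rightarrow> 'v::ab_group_add \<Rightarrow> 'v" and B :: "'v set"
begin

sublocale padic_lattice p B
  by unfold_locales (rule vs.finite_Basis)

declare M_simps [simp del]

abbreviation "crd \<equiv> coord smul B"
abbreviation "emb \<equiv> V_emb smul B p"

lemma in_span_B: "v \<in> vs.span B"
  using vs.span_Basis by simp

lemma coord_add: "crd (v + w) b = crd v b + crd w b"
  by (simp add: vs.representation_add[OF vs.independent_Basis in_span_B in_span_B])

lemma coord_diff: "crd (v - w) b = crd v b - crd w b"
  by (simp add: vs.representation_diff[OF vs.independent_Basis in_span_B in_span_B])

lemma coord_scale: "crd (smul c v) b = c * crd v b"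
  by (simp add: vs.representation_scale[OF vs.independent_Basis in_span_B])

lemma coord_zero: "crd 0 b = 0"
  by (simp add: vs.representation_zero)

lemma coord_ext:
  assumes "\<And>b. b \<in> B \<Longrightarrow> crd v b = crd w b" shows "v = w"
proof -
  have "(\<Sum>b\<in>B. smul (crd v b) b) = (\<Sum>b\<in>B. smul (crd w b) b)"
    by (rule sum.cong) (simp_all add: assms)
  then show ?thesis
    by (simp only: vs.sum_representation_eq[OF vs.independent_Basis in_span_B vs.finite_Basis order_refl])
qed

lemma emb_V: "emb v \<in> V"
  unfolding V_emb_def V_at_def by (simp add: restrict_PiE_iff)

lemma emb_add: "emb (v + w) = emb v \<boxplus> emb w"
  unfolding V_emb_def V_add_def by (rule restrict_ext) (simp add: coord_add of_Q_add)

lemma emb_0: "emb 0 = V_zero B p"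
  unfolding V_emb_def V_zero_def by (rule restrict_ext) (simp add: coord_zero)

lemma of_Q_eq_0: "of_Q x = \<zero>\<^bsub>Qp p\<^esub> \<Longrightarrow> x = 0"
  using qnorm_of_Q[of x] padic_abs_eq_0[OF p, of x] by simp

lemma emb_eq_0: "emb v = V_zero B p \<Longrightarrow> v = 0"
proof (rule coord_ext)
  fix b assume eq: "emb v = V_zero B p" and b: "b \<in> B"
  have "of_Q (crd v b) = \<zero>\<^bsub>Qp p\<^esub>"
    using fun_cong[OF eq, of b] b by (simp add: V_emb_def V_zero_def)
  then show "crd v b = crd 0 b"
    by (simp add: of_Q_eq_0 coord_zero)
qed

lemma emb_L_iff: "emb v \<in> L \<longleftrightarrow> (\<forall>b\<in>B. padic_abs p (crd v b) \<le> 1)"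
  unfolding V_emb_def L_at_def by (simp add: Pi_iff Zp_iff)

lemma emb_nmul: "emb (smul (of_nat n) w) = nmul n (emb w)"
  unfolding V_emb_def nmul_def by (rule restrict_ext) (simp add: coord_scale of_Q_mult)

text \<open>The localization of the lattice L at the prime p: coordinates with denominators prime to
  p. Dirac measures at these vectors live on L_p.\<close>

definition LQ :: "'v set" where
  "LQ = {v. emb v \<in> L}"

lemma LQ_add: "v \<in> LQ \<Longrightarrow> w \<in> LQ \<Longrightarrow> v + w \<in> LQ"
  by (simp add: LQ_def emb_add L_add_closed)

lemma LQ_diff: "v \<in> LQ \<Longrightarrow> w \<in> LQ \<Longrightarrow> v - w \<in> LQ"
  unfolding LQ_def emb_L_iff using padic_abs_diff_ultra[OF p]
  by (simp add: coord_diff) (meson max.boundedI order_trans)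

lemma LQ_nmul: "w \<in> LQ \<Longrightarrow> smul (of_nat n) w \<in> LQ"
  by (simp add: LQ_def emb_nmul nmul_L)

definition dl :: "'v \<Rightarrow> 'v meas" where
  "dl v = delta (emb v)"

lemma dl_carrier [simp]: "v \<in> LQ \<Longrightarrow> dl v \<in> carrier M"
  by (simp add: dl_def LQ_def delta_measure M_simps)

lemma dl_0: "dl 0 = \<one>\<^bsub>M\<^esub>"
  by (simp add: dl_def emb_0 M_simps)

lemma dl_add: "v \<in> LQ \<Longrightarrow> w \<in> LQ \<Longrightarrow> dl (v + w) = dl v \<otimes>\<^bsub>M\<^esub> dl w"
proof -
  assume "v \<in> LQ" "w \<in> LQ"
  then have v: "emb v \<in> L" and w: "emb w \<in> L" by (simp_all add: LQ_def)
  show ?thesis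
    unfolding dl_def emb_add M_simps
  proof (rule measure_eqI[OF delta_measure[OF L_add_closed[OF v w]] conv_measure[OF delta_measure[OF v] delta_measure[OF w]]])
    fix f assume f: "f \<in> CL"
    show "delta (emb v \<boxplus> emb w) f = (delta (emb v) \<star> delta (emb w)) f"
      by (simp only: conv_delta[OF v delta_measure[OF w] f] delta_apply[OF f] delta_apply[OF CL_transl[OF v f]]
          transl_apply[OF w])
  qed
qed

section \<open>Finite formal sums; translations, differences and averages\<close>

definition supp :: "('v \<Rightarrow> int) \<Rightarrow> 'v set" where
  "supp h = {v. h v \<noteq> 0}"

definition supported :: "('v \<Rightarrow> int) \<Rightarrow> bool" where
  "supported h \<longleftrightarrow> finite (supp h) \<and> supp h \<subseteq> LQ"

definition formal_sum :: "('v \<Rightarrow> int) \<Rightarrow> 'v meas" where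
  "formal_sum h = (\<Oplus>\<^bsub>M\<^esub>v\<in>supp h. [h v] \<cdot>\<^bsub>M\<^esub> dl v)"

lemma add_pow_zero: "[(0 :: int)] \<cdot>\<^bsub>M\<^esub> \<mu> = \<zero>\<^bsub>M\<^esub>"
  by (simp add: add_pow_def)

lemma add_pow_dl_closed: "v \<in> LQ \<Longrightarrow> [(k :: int)] \<cdot>\<^bsub>M\<^esub> dl v \<in> carrier M"
  by (rule M.add.int_pow_closed) simp

lemma formal_sum_superset:
  assumes "finite A" "A \<subseteq> LQ" "supp h \<subseteq> A"
  shows "formal_sum h = (\<Oplus>\<^bsub>M\<^esub>v\<in>A. [h v] \<cdot>\<^bsub>M\<^esub> dl v)"
  unfolding formal_sum_def
proof (rule M.add.finprod_mono_neutral_cong_left[OF assms(1,3)])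
  show "[h v] \<cdot>\<^bsub>M\<^esub> dl v = \<zero>\<^bsub>M\<^esub>" if "v \<in> A - supp h" for v
    using that by (simp add: supp_def add_pow_zero)
  show "(\<lambda>v. [h v] \<cdot>\<^bsub>M\<^esub> dl v) \<in> A \<rightarrow> carrier M"
    using assms(2) add_pow_dl_closed by blast
qed simp

lemma formal_sum_closed [simp]: "supported h \<Longrightarrow> formal_sum h \<in> carrier M"
  unfolding formal_sum_def supported_def by (intro M.finsum_closed) auto

text \<open>Values may cancel, so the three supports differ; all sums are extended by zeros to the
  union of the supports of h and g.\<close>

lemma formal_sum_add:
  assumes "supported h" "supported g"
  shows "supported (\<lambda>v. h v + g v) \<and> formal_sum (\<lambda>v. h v + g v) = formal_sum h \<oplus>\<^bsub>M\<^esub> formal_sum g"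
proof -
  let ?A = "supp h \<union> supp g"
  have A: "finite ?A" "?A \<subseteq> LQ" "supp (\<lambda>v. h v + g v) \<subseteq> ?A"
    using assms by (auto simp: supported_def supp_def)
  have "formal_sum (\<lambda>v. h v + g v) = (\<Oplus>\<^bsub>M\<^esub>v\<in>?A. [h v] \<cdot>\<^bsub>M\<^esub> dl v \<oplus>\<^bsub>M\<^esub> [g v] \<cdot>\<^bsub>M\<^esub> dl v)"
    unfolding formal_sum_superset[OF A]
    using A(2) by (intro M.finsum_cong') (auto simp: M.add.int_pow_mult)
  also have "\<dots> = (\<Oplus>\<^bsub>M\<^esub>v\<in>?A. [h v] \<cdot>\<^bsub>M\<^esub> dl v) \<oplus>\<^bsub>M\<^esub> (\<Oplus>\<^bsub>M\<^esub>v\<in>?A. [g v] \<cdot>\<^bsub>M\<^esub> dl v)"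
    using A(2) by (intro M.finsum_addf) auto
  also have "\<dots> = formal_sum h \<oplus>\<^bsub>M\<^esub> formal_sum g"
    using formal_sum_superset[OF A(1,2), of h] formal_sum_superset[OF A(1,2), of g] by simp
  finally show ?thesis
    using A by (meson finite_subset order_trans supported_def)
qed

definition shift :: "'v \<Rightarrow> ('v \<Rightarrow> int) \<Rightarrow> 'v \<Rightarrow> int" where
  "shift w h v = h (v - w)"

lemma supp_shift: "supp (shift w h) = (\<lambda>v. v + w) ` supp h"
  by (force simp: supp_def shift_def image_iff)

lemma formal_sum_shift:
  assumes "supported h" "w \<in> LQ"
  shows "supported (shift w h) \<and> formal_sum (shift w h) = dl w \<otimes>\<^bsub>M\<^esub> formal_sum h"
proof -
  have h: "finite (supp h)" "\<And>v. v \<in> supp h \<Longrightarrow> v \<in> LQ"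
    using assms(1) by (auto simp: supported_def)
  have sup: "supported (shift w h)"
    using h assms(2) by (auto simp: supported_def supp_shift LQ_add)
  have "formal_sum (shift w h) = (\<Oplus>\<^bsub>M\<^esub>v\<in>supp h. [shift w h (v + w)] \<cdot>\<^bsub>M\<^esub> dl (v + w))"
    unfolding formal_sum_def supp_shift
    using h assms(2) by (intro M.finsum_reindex) (auto simp: LQ_add)
  also have "\<dots> = (\<Oplus>\<^bsub>M\<^esub>v\<in>supp h. dl w \<otimes>\<^bsub>M\<^esub> ([h v] \<cdot>\<^bsub>M\<^esub> dl v))"
    using h assms(2)
    by (intro M.finsum_cong') (auto simp: shift_def dl_add M.m_comm[of "dl w"] M.add_pow_rdistr_int)
  also have "\<dots> = dl w \<otimes>\<^bsub>M\<^esub> formal_sum h"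
    unfolding formal_sum_def using h assms(2) by (intro M.finsum_rdistr[symmetric]) auto
  finally show ?thesis using sup by blast
qed

definition dop :: "'v \<Rightarrow> ('v \<Rightarrow> int) \<Rightarrow> 'v \<Rightarrow> int" where
  "dop w h v = h v - h (v - w)"

lemma supported_subset:
  "supported h \<Longrightarrow> supported g \<Longrightarrow> supp k \<subseteq> supp h \<union> supp g \<Longrightarrow> supported k"
  unfolding supported_def by (meson finite_Un finite_subset le_sup_iff order_trans)

lemma formal_sum_dop:
  assumes h: "supported h" and w: "w \<in> LQ"
  shows "supported (dop w h) \<and> formal_sum (dop w h) = (\<one>\<^bsub>M\<^esub> \<ominus>\<^bsub>M\<^esub> dl w) \<otimes>\<^bsub>M\<^esub> formal_sum h"
proof -
  note sh = formal_sum_shift[OF h w]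
  have sup: "supported (dop w h)"
    by (rule supported_subset[OF h conjunct1[OF sh]]) (auto simp: supp_def dop_def shift_def)
  \<comment> \<open>Written as a sum, so that additivity of \<open>formal_sum\<close> applies; the
    difference is then solved for in the ring.\<close>
  have "(\<lambda>v. dop w h v + shift w h v) = h"
    by (simp add: dop_def shift_def)
  then have "formal_sum h = formal_sum (dop w h) \<oplus>\<^bsub>M\<^esub> (dl w \<otimes>\<^bsub>M\<^esub> formal_sum h)"
    using formal_sum_add[OF sup conjunct1[OF sh]] sh by simp
  then have "formal_sum h \<ominus>\<^bsub>M\<^esub> (dl w \<otimes>\<^bsub>M\<^esub> formal_sum h) = formal_sum (dop w h)"
    using h w sup M.add.inv_solve_right'[of "formal_sum (dop w h)" "formal_sum h" "dl w \<otimes>\<^bsub>M\<^esub> formal_sum h"]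
    by (simp add: a_minus_def)
  then show ?thesis
    using sup h w by (simp add: a_minus_def M.l_distr M.l_minus)
qed

definition avg :: "'v \<Rightarrow> nat \<Rightarrow> ('v \<Rightarrow> int) \<Rightarrow> 'v \<Rightarrow> int" where
  "avg w K h v = (\<Sum>j<K. h (v - smul (of_nat j) w))"

definition geo :: "'v \<Rightarrow> nat \<Rightarrow> 'v meas" where
  "geo w K = psum M (\<lambda>j. dl (smul (of_nat j) w)) K"

lemma geo_unit: "w \<in> LQ \<Longrightarrow> coprime K p \<Longrightarrow> geo w K \<in> Units M"
  unfolding geo_def dl_def emb_nmul by (rule geometric_sum_unit) (simp_all add: LQ_def)

lemma smul_Suc: "smul (of_nat (Suc n)) w = smul (of_nat n) w + w"
  using vs.scale_left_distrib[of "of_nat n" 1 w] by (simp add: add.commute)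

text \<open>Closedness is carried along in the same induction. \<open>dop_telescope\<close> is the
  counterpart for functions: the two factorisations run in parallel for denominators and
  numerators.\<close>

lemma telescope:
  assumes w: "w \<in> LQ"
  shows "geo w K \<in> carrier M \<and>
    \<one>\<^bsub>M\<^esub> \<ominus>\<^bsub>M\<^esub> dl (smul (of_nat K) w) = (\<one>\<^bsub>M\<^esub> \<ominus>\<^bsub>M\<^esub> dl w) \<otimes>\<^bsub>M\<^esub> geo w K"
proof (induction K)
  case 0
  then show ?case
    using w by (simp add: geo_def dl_0 M.diff_eq_zero_iff)
next
  case (Suc K)
  let ?t = "dl (smul (of_nat K) w)"
  have t: "?t \<in> carrier M" and dw: "dl w \<in> carrier M" and g: "geo w K \<in> carrier M"
    using w Suc by (simp_all add: LQ_nmul)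
  have S: "geo w (Suc K) = geo w K \<oplus>\<^bsub>M\<^esub> ?t"
    by (simp add: geo_def)
  have "dl (smul (of_nat (Suc K)) w) = ?t \<otimes>\<^bsub>M\<^esub> dl w"
    unfolding smul_Suc by (rule dl_add[OF LQ_nmul[OF w] w])
  then have "\<one>\<^bsub>M\<^esub> \<ominus>\<^bsub>M\<^esub> dl (smul (of_nat (Suc K)) w) = (\<one>\<^bsub>M\<^esub> \<ominus>\<^bsub>M\<^esub> ?t) \<oplus>\<^bsub>M\<^esub> (\<one>\<^bsub>M\<^esub> \<ominus>\<^bsub>M\<^esub> dl w) \<otimes>\<^bsub>M\<^esub> ?t"
    using M.one_minus_mult[OF t dw] by (simp only:)
  also have "\<dots> = (\<one>\<^bsub>M\<^esub> \<ominus>\<^bsub>M\<^esub> dl w) \<otimes>\<^bsub>M\<^esub> geo w K \<oplus>\<^bsub>M\<^esub> (\<one>\<^bsub>M\<^esub> \<ominus>\<^bsub>M\<^esub> dl w) \<otimes>\<^bsub>M\<^esub> ?t"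
    using Suc by (simp only:)
  also have "\<dots> = (\<one>\<^bsub>M\<^esub> \<ominus>\<^bsub>M\<^esub> dl w) \<otimes>\<^bsub>M\<^esub> geo w (Suc K)"
    unfolding S using t dw g by (simp only: M.r_distr M.minus_closed M.one_closed)
  finally show ?case
    unfolding S using t g by simp
qed

lemma dop_telescope: "dop (smul (of_nat K) w) h = dop w (avg w K h)"
proof
  fix v
  have shift: "v - smul (of_nat (Suc K)) w = v - w - smul (of_nat K) w" for K
    unfolding smul_Suc by (simp add: algebra_simps)
  show "dop (smul (of_nat K) w) h v = dop w (avg w K h) v"
    unfolding dop_def avg_def
  proof (induction K)
    case (Suc K)
    then show ?case
      unfolding shift sum.lessThan_Suc by linarith
  qed simp
qed

section \<open>Iterated differences and the pseudo-measure represented by a function\<close>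

definition dops :: "'v list \<Rightarrow> ('v \<Rightarrow> int) \<Rightarrow> 'v \<Rightarrow> int" where
  "dops ws h = foldr dop ws h"

lemma dops_simps [simp]: "dops [] h = h" "dops (w # ws) h = dop w (dops ws h)"
  "dops (ws @ ws') h = dops ws (dops ws' h)"
  by (simp_all add: dops_def)

definition den :: "'v list \<Rightarrow> 'v meas" where
  "den ws = foldr (\<lambda>w x. (\<one>\<^bsub>M\<^esub> \<ominus>\<^bsub>M\<^esub> dl w) \<otimes>\<^bsub>M\<^esub> x) ws \<one>\<^bsub>M\<^esub>"

lemma den_simps [simp]: "den [] = \<one>\<^bsub>M\<^esub>" "den (w # ws) = (\<one>\<^bsub>M\<^esub> \<ominus>\<^bsub>M\<^esub> dl w) \<otimes>\<^bsub>M\<^esub> den ws"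
  by (simp_all add: den_def)

definition good :: "'v list \<Rightarrow> bool" where
  "good ws \<longleftrightarrow> (\<forall>w\<in>set ws. w \<in> LQ \<and> w \<noteq> 0)"

sublocale PM: cring_localization M "denominators B p"
  unfolding denominators_def
proof (rule mult_closure_localization[OF measure_ring_cring], clarify)
  fix v assume "v \<in> L"
  then show "delta (V_zero B p) \<ominus>\<^bsub>M\<^esub> delta v \<in> carrier M"
    by (intro M.minus_closed) (simp_all add: M_simps delta_measure)
qed

lemma denominator_dl:
  assumes "w \<in> LQ" "w \<noteq> 0" shows "\<one>\<^bsub>M\<^esub> \<ominus>\<^bsub>M\<^esub> dl w \<in> denominators B p"
proof -
  let ?G = "{delta (V_zero B p) \<ominus>\<^bsub>M\<^esub> delta v | v. v \<in> L \<and> v \<noteq> V_zero B p}"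
  have "\<one>\<^bsub>M\<^esub> \<ominus>\<^bsub>M\<^esub> dl w \<in> ?G"
    using assms emb_eq_0 by (auto simp: M_simps(3) dl_def LQ_def)
  from mult_closure.mult[OF this mult_closure.one[of M ?G]]
  show ?thesis
    using assms(1) by (simp add: denominators_def)
qed

lemma den_in: "good ws \<Longrightarrow> den ws \<in> denominators B p"
  by (induction ws) (simp_all add: good_def PM.one_S PM.mult_S denominator_dl)

lemma den_closed [simp]: "good ws \<Longrightarrow> den ws \<in> carrier M"
  by (rule PM.S_carrier[OF den_in])

lemma den_append: "good ws \<Longrightarrow> good ws' \<Longrightarrow> den (ws @ ws') = den ws \<otimes>\<^bsub>M\<^esub> den ws'"
  by (induction ws) (simp_all add: good_def M.m_assoc[symmetric] den_closed[unfolded good_def])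

lemma formal_sum_dops:
  assumes "supported h" "good ws"
  shows "supported (dops ws h) \<and> formal_sum (dops ws h) = den ws \<otimes>\<^bsub>M\<^esub> formal_sum h"
  using assms(2)
proof (induction ws)
  case (Cons w ws)
  then have w: "w \<in> LQ" and ws: "good ws" by (simp_all add: good_def)
  from formal_sum_dop[OF conjunct1[OF Cons.IH[OF ws]] w] Cons.IH[OF ws] w ws assms(1)
  show ?case
    by (simp add: M.m_assoc)
qed (use assms(1) in simp)

lemma dop_commute: "dop w (dop w' h) = dop w' (dop w h)"
  by (rule ext) (simp add: dop_def algebra_simps)

lemma dops_dop: "dops ws (dop w h) = dop w (dops ws h)"
  by (induction ws) (simp_all add: dop_commute)

lemma dops_commute: "dops ws (dops ws' h) = dops ws' (dops ws h)"
  by (induction ws) (simp_all add: dops_dop)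

lemma dops_add: "dops ws (\<lambda>v. h v + g v) = (\<lambda>v. dops ws h v + dops ws g v)"
  by (induction ws) (simp_all add: dop_def fun_eq_iff)

text \<open>A relation, since any list of differences that makes the support finite may be used;
  with lists, two choices are combined by concatenation.\<close>

definition represents :: "('v \<Rightarrow> int) \<Rightarrow> ('v meas \<times> 'v meas) set \<Rightarrow> bool" where
  "represents h \<Lambda> \<longleftrightarrow> (\<exists>ws. good ws \<and> supported (dops ws h) \<and> \<Lambda> = PM.fract (formal_sum (dops ws h)) (den ws))"

text \<open>Further differences multiply the numerator and the denominator by the same
  \<open>den ws'\<close>, so the fraction does not change.\<close>

lemma represents_extend:
  assumes "good ws" "supported (dops ws h)" "good ws'"
  shows "supported (dops (ws' @ ws) h) \<and>
    PM.fract (formal_sum (dops ws h)) (den ws) = PM.fract (formal_sum (dops (ws' @ ws) h)) (den ws' \<otimes>\<^bsub>M\<^esub> den ws)"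
  using formal_sum_dops[OF assms(2,3)] PM.frac_cancel[of "formal_sum (dops ws h)" "den ws" "den ws'"]
    den_in[OF assms(1)] den_in[OF assms(3)] assms(2) by simp

text \<open>Both fractions are expanded to the concatenation of the two lists, where they agree
  because difference operators commute, as do the factors of the denominators. This yields
  independence of decompositions and scalings as well as the comparison with a measure.\<close>

lemma represents_unique:
  assumes "represents h \<Lambda>" "represents h \<Lambda>'" shows "\<Lambda> = \<Lambda>'"
proof -
  obtain ws where ws: "good ws" "supported (dops ws h)" "\<Lambda> = PM.fract (formal_sum (dops ws h)) (den ws)"
    using assms(1) unfolding represents_def by blast
  obtain ws' where ws': "good ws'" "supported (dops ws' h)" "\<Lambda>' = PM.fract (formal_sum (dops ws' h)) (den ws')"
    using assms(2) unfolding represents_def by blast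
  have "dops (ws' @ ws) h = dops (ws @ ws') h"
    using dops_commute by simp
  moreover have "den ws' \<otimes>\<^bsub>M\<^esub> den ws = den ws \<otimes>\<^bsub>M\<^esub> den ws'"
    using ws(1) ws'(1) by (simp add: M.m_comm)
  ultimately show ?thesis
    using represents_extend[OF ws(1,2) ws'(1)] represents_extend[OF ws'(1,2) ws(1)] ws(3) ws'(3) by simp
qed

lemma represents_closed: "represents h \<Lambda> \<Longrightarrow> \<Lambda> \<in> carrier PM.Loc"
  unfolding represents_def by (auto intro!: PM.frac_closed den_in)

lemma represents_add:
  assumes "represents h \<Lambda>" "represents g \<Lambda>'"
  shows "represents (\<lambda>v. h v + g v) (\<Lambda> \<oplus>\<^bsub>PM.Loc\<^esub> \<Lambda>')"
proof -
  obtain ws where ws: "good ws" "supported (dops ws h)" "\<Lambda> = PM.fract (formal_sum (dops ws h)) (den ws)"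
    using assms(1) unfolding represents_def by blast
  obtain ws' where ws': "good ws'" "supported (dops ws' g)" "\<Lambda>' = PM.fract (formal_sum (dops ws' g)) (den ws')"
    using assms(2) unfolding represents_def by blast
  have g: "good (ws' @ ws)"
    using ws(1) ws'(1) by (auto simp: good_def)
  have d: "den ws \<otimes>\<^bsub>M\<^esub> den ws' = den ws' \<otimes>\<^bsub>M\<^esub> den ws" "den (ws' @ ws) = den ws' \<otimes>\<^bsub>M\<^esub> den ws"
    using ws(1) ws'(1) by (simp_all add: M.m_comm den_append)
  have e: "supported (dops (ws' @ ws) h)" "\<Lambda> = PM.fract (formal_sum (dops (ws' @ ws) h)) (den (ws' @ ws))"
    using represents_extend[OF ws(1,2) ws'(1)] ws(3) d(2) by simp_all
  have e': "supported (dops (ws' @ ws) g)" "\<Lambda>' = PM.fract (formal_sum (dops (ws' @ ws) g)) (den (ws' @ ws))"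
    using represents_extend[OF ws'(1,2) ws(1)] ws'(3) d dops_commute[of ws ws' g] by simp_all
  have f: "supported (dops (ws' @ ws) (\<lambda>v. h v + g v))"
    "formal_sum (dops (ws' @ ws) (\<lambda>v. h v + g v)) = formal_sum (dops (ws' @ ws) h) \<oplus>\<^bsub>M\<^esub> formal_sum (dops (ws' @ ws) g)"
    using formal_sum_add[OF e(1) e'(1)] unfolding dops_add[of "ws' @ ws"] by blast+
  have "\<Lambda> \<oplus>\<^bsub>PM.Loc\<^esub> \<Lambda>' = PM.fract (formal_sum (dops (ws' @ ws) (\<lambda>v. h v + g v))) (den (ws' @ ws))"
    unfolding f(2) e(2) e'(2)
    by (rule PM.frac_add_same[OF formal_sum_closed[OF e(1)] formal_sum_closed[OF e'(1)] den_in[OF g]])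
  then show ?thesis
    using g f(1) unfolding represents_def by blast
qed

lemma supported_zero: "supported (\<lambda>_. 0)"
  by (simp add: supported_def supp_def)

lemma formal_sum_zero: "formal_sum (\<lambda>_. 0) = \<zero>\<^bsub>M\<^esub>"
  by (simp add: formal_sum_def supp_def)

lemma represents_zero: "represents (\<lambda>_. 0) \<zero>\<^bsub>PM.Loc\<^esub>"
  unfolding represents_def
  by (rule exI[of _ "[]"]) (simp add: good_def supported_zero formal_sum_zero PM.Loc_zero)

lemma represents_sum:
  assumes "finite A" "\<And>a. a \<in> A \<Longrightarrow> represents (h a) (\<Lambda> a)"
  shows "represents (\<lambda>v. \<Sum>a\<in>A. h a v) (\<Oplus>\<^bsub>PM.Loc\<^esub>a\<in>A. \<Lambda> a)"
  using assms
proof (induction A)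
  case (insert a A)
  have "(\<Oplus>\<^bsub>PM.Loc\<^esub>a\<in>insert a A. \<Lambda> a) = \<Lambda> a \<oplus>\<^bsub>PM.Loc\<^esub> (\<Oplus>\<^bsub>PM.Loc\<^esub>a\<in>A. \<Lambda> a)"
    using insert by (intro PM.LocA.finsum_insert) (auto intro: represents_closed)
  then show ?case
    using represents_add[of "h a" "\<Lambda> a" "\<lambda>v. \<Sum>a\<in>A. h a v"] insert by simp
qed (simp add: represents_zero)

lemma of_measure_fract: "of_measure B p \<mu> = PM.fract \<mu> \<one>\<^bsub>M\<^esub>"
  by (simp add: of_measure_def)

section \<open>Iterated averages and a criterion for representing a measure\<close>

lemma avg_dop: "avg w K (dop w' h) = dop w' (avg w K h)"
proof (rule ext)
  fix v
  have eq: "v - smul (of_nat j) w - w' = v - w' - smul (of_nat j) w" for j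
    by (simp add: algebra_simps)
  then show "avg w K (dop w' h) v = dop w' (avg w K h) v"
    by (simp only: avg_def dop_def sum_subtractf eq)
qed

definition avgs :: "('v \<times> nat) list \<Rightarrow> ('v \<Rightarrow> int) \<Rightarrow> 'v \<Rightarrow> int" where
  "avgs xs h = foldr (\<lambda>(w, K). avg w K) xs h"

lemma avgs_simps [simp]: "avgs [] h = h" "avgs ((w, K) # xs) h = avg w K (avgs xs h)"
  "avgs (xs @ ys) h = avgs xs (avgs ys h)"
  by (simp_all add: avgs_def)

lemma avg_dops: "avg w K (dops ws h) = dops ws (avg w K h)"
  by (induction ws) (simp_all add: avg_dop)

abbreviation "multiples xs \<equiv> map (\<lambda>(w, K). smul (of_nat K) w) xs"

text \<open>Differences with the long steps K w are differences with the short steps w applied to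
  averages, because averages and differences commute.\<close>

lemma dops_multiples: "dops (multiples xs) h = dops (map fst xs) (avgs xs h)"
proof (induction xs)
  case (Cons x xs)
  then show ?case
    by (cases x) (simp add: dop_telescope avg_dops)
qed simp

text \<open>The unit is the product of the geometric sums, one for each entry of the list.\<close>

lemma den_multiples:
  assumes "\<And>w K. (w, K) \<in> set xs \<Longrightarrow> w \<in> LQ \<and> w \<noteq> 0 \<and> coprime K p"
  shows "\<exists>u\<in>Units M. den (multiples xs) = den (map fst xs) \<otimes>\<^bsub>M\<^esub> u"
  using assms
proof (induction xs)
  case (Cons x xs)
  obtain w K where x: "x = (w, K)" by fastforce
  have w: "w \<in> LQ" "coprime K p"
    using Cons.prems x by auto
  have prems: "w \<in> LQ \<and> w \<noteq> 0 \<and> coprime K p" if "(w, K) \<in> set xs" for w K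
    by (rule Cons.prems) (use that in simp)
  obtain u where u: "u \<in> Units M" "den (multiples xs) = den (map fst xs) \<otimes>\<^bsub>M\<^esub> u"
    using Cons.IH[OF prems] by blast
  have "good (map fst xs)"
    using prems by (auto simp: good_def)
  then have c: "den (map fst xs) \<in> carrier M" "u \<in> carrier M" "geo w K \<in> carrier M" "\<one>\<^bsub>M\<^esub> \<ominus>\<^bsub>M\<^esub> dl w \<in> carrier M"
    using u(1) telescope[OF w(1)] w(1) by (simp_all add: M.Units_closed)
  have "den (multiples (x # xs)) = (\<one>\<^bsub>M\<^esub> \<ominus>\<^bsub>M\<^esub> dl w) \<otimes>\<^bsub>M\<^esub> geo w K \<otimes>\<^bsub>M\<^esub> (den (map fst xs) \<otimes>\<^bsub>M\<^esub> u)"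
    using u(2) telescope[OF w(1), of K] by (simp add: x)
  also have "\<dots> = den (map fst (x # xs)) \<otimes>\<^bsub>M\<^esub> (geo w K \<otimes>\<^bsub>M\<^esub> u)"
    using c by (simp add: x M.m_ac)
  finally show ?case
    using M.Units_m_closed[OF geo_unit[OF w] u(1)] by blast
qed (auto intro: bexI[of _ "\<one>\<^bsub>M\<^esub>"])

text \<open>Since \<open>1 - t\<^sup>K = (1 - t) (1 + \<dots> + t\<^bsup>K-1\<^esup>)\<close> and the second factor is a unit, the denominators
  \<open>1 - t\<^sup>K\<close> cancel up to units as soon as averaging alone makes the support finite.\<close>

lemma represents_measure:
  assumes xs: "\<And>w K. (w, K) \<in> set xs \<Longrightarrow> w \<in> LQ \<and> w \<noteq> 0 \<and> coprime K p"
    and sup: "supported (avgs xs h)"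
  shows "\<exists>\<mu>\<in>carrier M. represents h (of_measure B p \<mu>)"
proof -
  define ws where "ws = map fst xs"
  define vs where "vs = multiples xs"
  \<comment> \<open>This makes K w nonzero, so that the difference of the Dirac measures at 0 and K
    w is a legitimate denominator; 0 is coprime only to 1.\<close>
  have K0: "K \<noteq> 0" if "(w, K) \<in> set xs" for w K
  proof
    assume "K = 0"
    then have "coprime 0 p"
      using xs[OF that] by simp
    then show False
      using prime_gt_1_nat[OF p] by simp
  qed
  have ws: "good ws"
    using xs by (auto simp: good_def ws_def)
  have vs: "good vs"
    unfolding good_def
  proof
    fix v assume "v \<in> set vs"
    then obtain w K where wK: "(w, K) \<in> set xs" "v = smul (of_nat K) w"
      by (auto simp: vs_def)
    then show "v \<in> LQ \<and> v \<noteq> 0"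
      using xs[OF wK(1)] K0[OF wK(1)] by (simp add: LQ_nmul)
  qed
  have num: "supported (dops vs h)" "formal_sum (dops vs h) = den ws \<otimes>\<^bsub>M\<^esub> formal_sum (avgs xs h)"
    using formal_sum_dops[OF sup ws] dops_multiples[of xs h] by (simp_all add: ws_def vs_def)
  obtain u where u: "u \<in> Units M" "den vs = den ws \<otimes>\<^bsub>M\<^esub> u"
    using den_multiples[OF xs] unfolding ws_def vs_def by blast
  \<comment> \<open>After \<open>den ws\<close> is cancelled only the unit u is left in the
    denominator, and it is inverted among the measures.\<close>
  define \<mu> where "\<mu> = formal_sum (avgs xs h) \<otimes>\<^bsub>M\<^esub> inv\<^bsub>M\<^esub> u"
  have \<mu>: "\<mu> \<in> carrier M"
    using u(1) sup by (simp add: \<mu>_def)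
  have "u \<otimes>\<^bsub>M\<^esub> \<mu> = formal_sum (avgs xs h)"
    unfolding \<mu>_def using u(1) sup M.Units_closed[OF u(1)]
    by (simp add: M.m_lcomm[of u] M.Units_r_inv)
  then have "formal_sum (dops vs h) = den vs \<otimes>\<^bsub>M\<^esub> \<mu>"
    unfolding num(2) u(2) using u(1) \<mu> ws by (simp add: M.m_assoc M.Units_closed)
  then have "PM.fract (formal_sum (dops vs h)) (den vs) = of_measure B p \<mu>"
    unfolding of_measure_fract using \<mu> vs num(1)
    by (intro PM.frac_eqI den_in PM.one_S) simp_all
  then show ?thesis
    using \<mu> vs num(1) unfolding represents_def by metis
qed

end

section \<open>Periods and supports of test functions\<close>

context padic_lattice
begin

text \<open>On a compact set containing the support, local constancy is uniform by a Lebesgue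
  number. A pair of close points with only one in the compact set is covered by symmetry, and a pair
  outside has both values 0.\<close>

lemma local_schwartz_period:
  assumes "g \<in> local_schwartz B p"
  obtains d where "d > 0" "\<And>x y. x \<in> V \<Longrightarrow> y \<in> V \<Longrightarrow> near d x y \<Longrightarrow> g x = g y"
proof -
  obtain K where cont: "continuous_map (V_top B p) (discrete_topology UNIV) g"
    and K: "compactin (V_top B p) K" "{x. g x \<noteq> 0} \<subseteq> K"
    using assms by (auto simp: local_schwartz_def)
  have KV: "K \<subseteq> V"
    using compactin_subset_topspace[OF K(1)] by simp
  have "\<exists>r>0. \<forall>y\<in>V. near r x y \<longrightarrow> g y = g x" if x: "x \<in> K" for x
  proof -
    have "openin (V_top B p) {y \<in> V. g y \<in> {g x}}"
      using openin_continuous_map_preimage[OF cont, of "{g x}"] by simp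
    moreover have "x \<in> {y \<in> V. g y \<in> {g x}}"
      using x KV by blast
    ultimately obtain r where "r > 0" "\<forall>y\<in>V. near r x y \<longrightarrow> y \<in> {y \<in> V. g y \<in> {g x}}"
      unfolding openin_V_top_iff by blast
    then show ?thesis by (intro exI[of _ r]) simp
  qed
  then have "\<forall>x\<in>K. \<exists>r. r > 0 \<and> (\<forall>y\<in>V. near r x y \<longrightarrow> g y = g x)"
    by blast
  from bchoice[OF this] obtain r where r: "\<And>x. x \<in> K \<Longrightarrow> r x > 0"
    "\<And>x y. x \<in> K \<Longrightarrow> y \<in> V \<Longrightarrow> near (r x) x y \<Longrightarrow> g y = g x"
    by blast
  obtain d F where dF: "d > 0" "finite F" "F \<subseteq> K" "\<And>x. x \<in> K \<Longrightarrow> \<exists>z\<in>F. near (r z) z x \<and> d \<le> r z"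
    using compactin_near_cover[OF K(1), of r] r(1) by metis
  have eq: "g x = g y" if xy: "x \<in> K" "y \<in> V" "near d x y" for x y
  proof -
    obtain z where z: "z \<in> F" "near (r z) z x" "d \<le> r z"
      using dF(4)[OF xy(1)] by blast
    have zK: "z \<in> K" using dF(3) z(1) by blast
    have "near (r z) z y"
      using near_trans[OF z(2) near_mono[OF xy(3) z(3)]] zK xy KV by blast
    then show ?thesis
      using r(2)[OF zK xy(2)] r(2)[OF zK _ z(2)] xy(1) KV by auto
  qed
  have "g x = g y" if xy: "x \<in> V" "y \<in> V" "near d x y" for x y
  proof -
    consider "x \<in> K" | "y \<in> K" | "g x = 0" "g y = 0"
      using K(2) by auto
    then show ?thesis
    proof cases
      case 1
      then show ?thesis using eq xy by blast
    next
      case 2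
      then show ?thesis using eq[OF 2 xy(1) near_sym[OF xy(3)]] by simp
    qed simp
  qed
  then show ?thesis
    using that dF(1) by blast
qed

lemma local_schwartz_bounded:
  assumes "g \<in> local_schwartz B p"
  obtains R where "\<And>x b. x \<in> V \<Longrightarrow> g x \<noteq> 0 \<Longrightarrow> b \<in> B \<Longrightarrow> qnorm (x b) \<le> R"
proof -
  obtain K where K: "compactin (V_top B p) K" "{x. g x \<noteq> 0} \<subseteq> K"
    using assms by (auto simp: local_schwartz_def)
  have KV: "K \<subseteq> V"
    using compactin_subset_topspace[OF K(1)] by simp
  obtain d F where dF: "(d :: real) > 0" "finite F" "F \<subseteq> K" "\<And>x. x \<in> K \<Longrightarrow> \<exists>z\<in>F. near 1 z x \<and> d \<le> 1"
    using compactin_near_cover[OF K(1), of "\<lambda>_. 1"] by (metis zero_less_one)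
  \<comment> \<open>Each point of the compact set is within 1 of a centre, so its coordinates are
    bounded by those of the centre or by 1.\<close>
  define R where "R = Max (insert 1 ((\<lambda>(z, b). qnorm (z b)) ` (F \<times> B)))"
  have "qnorm (x b) \<le> R" if x: "x \<in> V" "g x \<noteq> 0" "b \<in> B" for x b
  proof -
    have "x \<in> K" using K(2) x(2) by blast
    then obtain z where z: "z \<in> F" "near 1 z x"
      using dF(4) by blast
    have fin: "finite (insert 1 ((\<lambda>(z, b). qnorm (z b)) ` (F \<times> B)))"
      using dF(2) finite_B by simp
    have R: "1 \<le> R" "qnorm (z b) \<le> R"
      unfolding R_def using z(1) x(3) by (auto intro!: Max_ge[OF fin])
    have c: "x b \<in> carrier (Qp p)" "z b \<in> carrier (Qp p)"
      using V_comp x z(1) dF(3) KV by blast+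
    have "qp_dist p (x b) \<zero>\<^bsub>Qp p\<^esub> \<le> max (qp_dist p (x b) (z b)) (qp_dist p (z b) \<zero>\<^bsub>Qp p\<^esub>)"
      by (rule qdist_ultra[OF c Q.zero_closed])
    moreover have "qp_dist p (x b) (z b) \<le> 1"
      using near_sym[OF z(2)] x(3) unfolding near_def by (simp add: less_imp_le)
    ultimately show ?thesis
      using R c by (simp add: qdist_eq a_minus_def)
  qed
  then show ?thesis using that by blast
qed

end

section \<open>Periods and denominators of adelic test functions on rational vectors\<close>

context lattice_space
begin

text \<open>Period and support are expressed by powers of the prime, so that the data of different
  primes can be multiplied into one integer. The larger of two exponents serves both
  purposes.\<close>

lemma local_schwartz_rational:
  assumes g: "g \<in> local_schwartz B p"
  obtains k where
    "\<And>v t. (\<And>b. b \<in> B \<Longrightarrow> padic_abs p (crd t b) \<le> 1 / real p ^ k) \<Longrightarrow> g (emb (v + t)) = g (emb v)"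
    "\<And>v b. g (emb v) \<noteq> 0 \<Longrightarrow> b \<in> B \<Longrightarrow> padic_abs p (crd v b) \<le> real p ^ k"
proof -
  obtain d where d: "d > 0" "\<And>x y. x \<in> V \<Longrightarrow> y \<in> V \<Longrightarrow> near d x y \<Longrightarrow> g x = g y"
    using local_schwartz_period[OF g] by blast
  obtain R where R: "\<And>x b. x \<in> V \<Longrightarrow> g x \<noteq> 0 \<Longrightarrow> b \<in> B \<Longrightarrow> qnorm (x b) \<le> R"
    using local_schwartz_bounded[OF g] by blast
  obtain k1 where k1: "1 / real p ^ k1 < d"
    using p_power_small[OF d(1)] .
  obtain k2 where k2: "R < real p ^ k2"
    using real_arch_pow[of "real p" R] prime_gt_1_nat[OF p] by auto
  define k where "k = max k1 k2"
  have p1: "real p \<ge> 1"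
    using prime_ge_1_nat[OF p] by simp
  have "1 / real p ^ k \<le> 1 / real p ^ k1"
    using p1 unfolding k_def by (intro divide_left_mono power_increasing) simp_all
  then have small: "1 / real p ^ k < d"
    using k1 by linarith
  have "real p ^ k2 \<le> real p ^ k"
    using p1 unfolding k_def by (intro power_increasing) simp_all
  then have big: "R \<le> real p ^ k"
    using k2 by linarith
  show ?thesis
  proof (rule that[of k])
    fix v t assume t: "\<And>b. b \<in> B \<Longrightarrow> padic_abs p (crd t b) \<le> 1 / real p ^ k"
    have "near d (emb (v + t)) (emb v)"
      unfolding near_def
    proof
      fix b assume b: "b \<in> B"
      then show "qp_dist p (emb (v + t) b) (emb v b) < d"
        using t[OF b] small by (simp add: V_emb_def qdist_of_Q coord_add)
    qed
    then show "g (emb (v + t)) = g (emb v)"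
      by (rule d(2)[OF emb_V emb_V])
  next
    fix v b assume "g (emb v) \<noteq> 0" "b \<in> B"
    then show "padic_abs p (crd v b) \<le> real p ^ k"
      using R[OF emb_V, of v b] big by (simp add: V_emb_def)
  qed
qed

lemma lattice_space_at: "prime q \<Longrightarrow> lattice_space q smul B"
  by (intro lattice_space.intro padic.intro vs.finite_dimensional_vector_space_axioms)

text \<open>All these primes divide the denominator of x.\<close>

lemma finite_bad_primes: "finite {q. prime q \<and> padic_abs q x > 1}"
proof -
  obtain a b where ab: "quotient_of x = (a, b)" by fastforce
  have b: "b > 0" and x: "x = of_int a / of_int b"
    using ab quotient_of_denom_pos quotient_of_div by blast+
  have "{q. prime q \<and> padic_abs q x > 1} \<subseteq> {..nat b}"
  proof (rule subsetI)
    fix q assume "q \<in> {q. prime q \<and> padic_abs q x > 1}"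
    then have q: "prime q" "padic_abs q x > 1" by simp_all
    interpret q: padic q using q(1) by (rule padic.intro)
    have "int q dvd b"
    proof (rule ccontr)
      assume "\<not> int q dvd b"
      then have "padic_abs q (of_int b) = 1"
        by (rule q.padic_abs_coprime)
      then have "padic_abs q x = padic_abs q (x * of_int b)"
        by (simp add: padic_abs_mult[OF q(1)])
      also have "x * of_int b = of_int a"
        using x b by simp
      finally show False
        using q(2) q.padic_abs_int_le_1[of a] by simp
    qed
    then show "q \<in> {..nat b}"
      using zdvd_imp_le[OF _ b] b by fastforce
  qed
  then show ?thesis
    by (rule finite_subset) simp
qed

lemma V_emb_in_adeles:
  assumes "\<And>q. q \<in> P \<Longrightarrow> prime q"
  shows "(\<lambda>q\<in>P. V_emb smul B q v) \<in> adeles B P"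
proof -
  have "{q \<in> P. V_emb smul B q v \<notin> L_at B q} \<subseteq> (\<Union>b\<in>B. {q. prime q \<and> padic_abs q (crd v b) > 1})"
  proof
    fix q assume q: "q \<in> {q \<in> P. V_emb smul B q v \<notin> L_at B q}"
    then have "prime q" using assms by blast
    then interpret q: lattice_space q smul B by (rule lattice_space_at)
    show "q \<in> (\<Union>b\<in>B. {q. prime q \<and> padic_abs q (crd v b) > 1})"
      using q \<open>prime q\<close> by (auto simp: q.emb_L_iff not_le)
  qed
  then have "finite {q \<in> P. V_emb smul B q v \<notin> L_at B q}"
    by (rule finite_subset) (simp add: finite_B finite_bad_primes)
  moreover have "V_emb smul B q v \<in> V_at B q" if "q \<in> P" for q
    using lattice_space.emb_V[OF lattice_space_at[OF assms[OF that]]] .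
  ultimately show ?thesis
    by (simp add: adeles_def restrict_PiE_iff cong: conj_cong)
qed

definition away :: "('v adele \<Rightarrow> int) \<Rightarrow> 'v \<Rightarrow> int" where
  "away f' v = f' (\<lambda>q\<in>primes_away p. V_emb smul B q v)"

abbreviation "test f' \<equiv> on_V smul B (tensor_char B p f' L)"

lemma test_eq: "test f' v = (if v \<in> LQ then away f' v else 0)"
proof -
  have "(\<lambda>q\<in>primes. V_emb smul B q v) \<in> adeles B primes"
    by (rule V_emb_in_adeles) (simp add: primes_def)
  moreover have "(\<lambda>q\<in>primes. V_emb smul B q v) p = emb v"
    using p by (simp add: primes_def)
  moreover have "restrict (\<lambda>q\<in>primes. V_emb smul B q v) (primes_away p) = (\<lambda>q\<in>primes_away p. V_emb smul B q v)"
    by (rule restrict_ext) (simp add: primes_def primes_away_def)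
  ultimately show ?thesis
    by (simp add: on_V_def diagonal_def tensor_char_def LQ_def away_def)
qed

text \<open>All but finitely many factors are indicators of L_q, which are invariant under
  q-integral translations and supported on q-integral vectors. At each exceptional prime a power of
  that prime serves as a period and as a denominator for the support. N is the product of these
  powers, prime to p since only primes other than p occur.\<close>

lemma away_schwartz:
  assumes f': "f' \<in> schwartz B (primes_away p)"
  obtains N where "N > 0" "coprime N p"
    "\<And>v t. (\<And>q b. prime q \<Longrightarrow> q \<noteq> p \<Longrightarrow> b \<in> B \<Longrightarrow> padic_abs q (crd t b) \<le> padic_abs q (of_nat N)) \<Longrightarrow>
      away f' (v + t) = away f' v"
    "\<And>v q b. away f' v \<noteq> 0 \<Longrightarrow> prime q \<Longrightarrow> q \<noteq> p \<Longrightarrow> b \<in> B \<Longrightarrow> padic_abs q (of_nat N * crd v b) \<le> 1"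
proof -
  let ?P = "primes_away p"
  obtain m :: nat and c :: "nat \<Rightarrow> int" and \<phi> where
    \<phi>: "\<And>i q. i < m \<Longrightarrow> q \<in> ?P \<Longrightarrow> \<phi> i q \<in> local_schwartz B q"
      "\<And>i. i < m \<Longrightarrow> finite {q \<in> ?P. \<phi> i q \<noteq> indicator (L_at B q)}"
    and f: "f' = (\<lambda>x. \<Sum>i<m. c i * pure_tensor B ?P (\<phi> i) x)"
    using f' unfolding schwartz_def by blast
  define X where "X = (\<Union>i<m. {q \<in> ?P. \<phi> i q \<noteq> indicator (L_at B q)})"
  have X: "finite X" "X \<subseteq> ?P"
    unfolding X_def using \<phi>(2) by auto
  have prime_P: "prime q" if "q \<in> ?P" for q
    using that by (simp add: primes_away_def)
  have "\<exists>k. (\<forall>v t. (\<forall>b\<in>B. padic_abs q (crd t b) \<le> 1 / real q ^ k) \<longrightarrow> \<phi> i q (V_emb smul B q (v + t)) = \<phi> i q (V_emb smul B q v)) \<and>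
      (\<forall>v b. \<phi> i q (V_emb smul B q v) \<noteq> 0 \<longrightarrow> b \<in> B \<longrightarrow> padic_abs q (crd v b) \<le> real q ^ k)"
    if iq: "i < m" "q \<in> ?P" for i q
  proof -
    interpret q: lattice_space q smul B
      by (rule lattice_space_at[OF prime_P[OF iq(2)]])
    show ?thesis
      using q.local_schwartz_rational[OF \<phi>(1)[OF iq]] by metis
  qed
  then have "\<forall>i q. \<exists>k. i < m \<and> q \<in> ?P \<longrightarrow>
      (\<forall>v t. (\<forall>b\<in>B. padic_abs q (crd t b) \<le> 1 / real q ^ k) \<longrightarrow> \<phi> i q (V_emb smul B q (v + t)) = \<phi> i q (V_emb smul B q v)) \<and>
      (\<forall>v b. \<phi> i q (V_emb smul B q v) \<noteq> 0 \<longrightarrow> b \<in> B \<longrightarrow> padic_abs q (crd v b) \<le> real q ^ k)"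
    by blast
  then obtain k where k: "\<And>i q v t. i < m \<Longrightarrow> q \<in> ?P \<Longrightarrow> (\<forall>b\<in>B. padic_abs q (crd t b) \<le> 1 / real q ^ k i q) \<Longrightarrow>
      \<phi> i q (V_emb smul B q (v + t)) = \<phi> i q (V_emb smul B q v)"
    "\<And>i q v b. i < m \<Longrightarrow> q \<in> ?P \<Longrightarrow> \<phi> i q (V_emb smul B q v) \<noteq> 0 \<Longrightarrow> b \<in> B \<Longrightarrow> padic_abs q (crd v b) \<le> real q ^ k i q"
    by metis
  \<comment> \<open>The exponents are summed over the terms of f', which dominates each single
    \<open>k i q\<close>.\<close>
  define N where "N = (\<Prod>q\<in>X. q ^ (\<Sum>i<m. k i q))"
  have "N > 0"
    unfolding N_def using X prime_P by (intro prod_pos) (simp add: prime_gt_0_nat subset_iff)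
  moreover have "coprime N p"
    unfolding N_def
  proof (rule prod_coprime_left)
    fix q assume "q \<in> X"
    then have "prime q" "q \<noteq> p"
      using X by (auto simp: primes_away_def)
    then show "coprime (q ^ (\<Sum>i<m. k i q)) p"
      using p by (simp add: primes_coprime)
  qed
  have Nq: "padic_abs q (of_nat N) \<le> 1 / real q ^ k i q" if "q \<in> X" "i < m" for q i
  proof -
    interpret q: padic q
      using that(1) X prime_P by (intro padic.intro) blast
    have "q ^ k i q dvd q ^ (\<Sum>i<m. k i q)"
      using that(2) by (intro le_imp_power_dvd member_le_sum) simp_all
    also have "\<dots> dvd N"
      unfolding N_def using X(1) that(1) by (rule dvd_prodI)
    finally have "int q ^ k i q dvd int N"
      by (metis of_nat_dvd_iff of_nat_power)
    then show ?thesis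
      using q.padic_abs_dvd[of "k i q" "int N"] by simp
  qed
  have unram: "\<phi> i q = indicator (L_at B q)" if "q \<in> ?P" "q \<notin> X" "i < m" for i q
    using that by (auto simp: X_def)
  let ?d = "\<lambda>v. \<lambda>q\<in>?P. V_emb smul B q v"
  have ad: "?d v \<in> adeles B ?P" for v
    by (rule V_emb_in_adeles) (rule prime_P)
  have period: "away f' (v + t) = away f' v"
    if t: "\<And>q b. prime q \<Longrightarrow> q \<noteq> p \<Longrightarrow> b \<in> B \<Longrightarrow> padic_abs q (crd t b) \<le> padic_abs q (of_nat N)" for v t
  proof -
    have loc: "\<phi> i q (V_emb smul B q (v + t)) = \<phi> i q (V_emb smul B q v)" if iq: "i < m" "q \<in> ?P" for i q
    proof (cases "q \<in> X")
      case True
      have "\<forall>b\<in>B. padic_abs q (crd t b) \<le> 1 / real q ^ k i q"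
      proof
        fix b assume "b \<in> B"
        then show "padic_abs q (crd t b) \<le> 1 / real q ^ k i q"
          using t[of q b] Nq[OF True iq(1)] iq(2) by (simp add: primes_away_def)
      qed
      then show ?thesis by (rule k(1)[OF iq])
    next
      case False
      interpret q: lattice_space q smul B
        by (rule lattice_space_at[OF prime_P[OF iq(2)]])
      have "t \<in> q.LQ"
        unfolding q.LQ_def mem_Collect_eq q.emb_L_iff
      proof
        fix b assume "b \<in> B"
        then show "padic_abs q (crd t b) \<le> 1"
          using t[of q b] q.padic_abs_int_le_1[of "int N"] iq(2) by (simp add: primes_away_def)
      qed
      then have "V_emb smul B q (v + t) \<in> L_at B q \<longleftrightarrow> V_emb smul B q v \<in> L_at B q"
        using q.LQ_add[of v t] q.LQ_diff[of "v + t" t] by (auto simp: q.LQ_def)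
      then show ?thesis
        unfolding unram[OF iq(2) False iq(1)] by (simp add: indicator_def)
    qed
    have "pure_tensor B ?P (\<phi> i) (?d (v + t)) = pure_tensor B ?P (\<phi> i) (?d v)" if "i < m" for i
    proof -
      have "{q. q \<in> ?P \<and> \<phi> i q (?d (v + t) q) \<noteq> 1} = {q. q \<in> ?P \<and> \<phi> i q (?d v q) \<noteq> 1}"
        using loc[OF that] by auto
      then show ?thesis
        unfolding pure_tensor_def using ad loc[OF that] by (auto intro!: prod.cong)
    qed
    then show ?thesis
      unfolding away_def f by (intro sum.cong) simp_all
  qed
  have support: "padic_abs q (of_nat N * crd v b) \<le> 1"
    if v: "away f' v \<noteq> 0" and q: "prime q" "q \<noteq> p" and b: "b \<in> B" for v q b
  proof -
    have qP: "q \<in> ?P" using q by (simp add: primes_away_def)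
    interpret q: lattice_space q smul B
      by (rule lattice_space_at[OF q(1)])
    obtain i where i: "i < m" "pure_tensor B ?P (\<phi> i) (?d v) \<noteq> 0"
      using v unfolding away_def f by (metis (no_types, lifting) lessThan_iff mult_zero_right sum.neutral)
    \<comment> \<open>Finiteness matters: \<open>prod\<close> over an infinite set is 1, so a
      vanishing factor would not make the pure tensor vanish.\<close>
    have "{q. q \<in> ?P \<and> \<phi> i q (?d v q) \<noteq> 1} \<subseteq> X \<union> {q \<in> ?P. ?d v q \<notin> L_at B q}"
      using unram[OF _ _ i(1)] by (auto simp: indicator_def)
    moreover have "finite {q \<in> ?P. ?d v q \<notin> L_at B q}"
      using ad[of v] unfolding adeles_def by blast
    ultimately have fin: "finite {q. q \<in> ?P \<and> \<phi> i q (?d v q) \<noteq> 1}"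
      using X(1) by (meson finite_UnI finite_subset)
    have nz: "\<phi> i q (V_emb smul B q v) \<noteq> 0"
    proof
      assume "\<phi> i q (V_emb smul B q v) = 0"
      then have "\<exists>q\<in>{q. q \<in> ?P \<and> \<phi> i q (?d v q) \<noteq> 1}. \<phi> i q (?d v q) = 0"
        using qP by (intro bexI[of _ q]) simp_all
      from prod_zero[OF fin this] have "pure_tensor B ?P (\<phi> i) (?d v) = 0"
        unfolding pure_tensor_def by simp
      with i(2) show False by simp
    qed
    show ?thesis
    proof (cases "q \<in> X")
      case True
      have "padic_abs q (of_nat N * crd v b) \<le> 1 / real q ^ k i q * real q ^ k i q"
        unfolding padic_abs_mult[OF q(1)]
        by (intro mult_mono Nq[OF True i(1)] k(2)[OF i(1) qP nz b]) (simp_all add: padic_abs_nonneg)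
      then show ?thesis
        using prime_gt_0_nat[OF q(1)] by simp
    next
      case False
      have "V_emb smul B q v \<in> L_at B q"
        using nz unfolding unram[OF qP False i(1)] by (simp add: indicator_def split: if_splits)
      then have "padic_abs q (crd v b) \<le> 1"
        using b by (simp add: q.emb_L_iff)
      then show ?thesis
        using q.padic_abs_int_le_1[of "int N"] padic_abs_nonneg
        by (simp add: padic_abs_mult[OF q(1)] mult_le_one)
    qed
  qed
  show ?thesis
    by (rule that[OF \<open>N > 0\<close> \<open>coprime N p\<close> period support])
qed

end

section \<open>The Vanishing Hypothesis as a finite sum\<close>

lemma quotient_of_mult: "of_int (snd (quotient_of x)) * x = of_int (fst (quotient_of x))"
proof -
  obtain a b where ab: "quotient_of x = (a, b)" by fastforce
  have "x = of_int a / of_int b" "b > 0"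
    using ab quotient_of_denom_pos quotient_of_div by blast+
  then have "of_int b * x = of_int a" by simp
  then show ?thesis by (simp add: ab)
qed

lemma rat_integral:
  assumes "\<And>q. prime q \<Longrightarrow> padic_abs q x \<le> 1" shows "x \<in> \<int>"
proof -
  obtain a b where ab: "quotient_of x = (a, b)" by fastforce
  have b: "b > 0" and x: "x = of_int a / of_int b"
    using ab quotient_of_denom_pos quotient_of_div by blast+
  have "b = 1"
  proof (rule ccontr)
    assume "b \<noteq> 1"
    then have "nat b \<noteq> 1" using b by simp
    then obtain q where q: "prime q" "q dvd nat b"
      using prime_factor_nat by blast
    then have "int q dvd int (nat b)"
      by (simp only: of_nat_dvd_iff)
    then have "int q dvd b"
      using b by simp
    then show False
      using padic.padic_integer_denom[OF padic.intro[OF q(1)] assms[OF q(1)]] ab by simp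
  qed
  then show ?thesis using x by simp
qed

lemma period_sum:
  assumes "\<And>i. a (i + P) = (a i :: int)"
  shows "(\<Sum>i<P * n. a i) = int n * (\<Sum>i<P. a i)"
proof (induction n)
  case (Suc n)
  have shift: "a (P * n + i) = a i" for i
  proof (induction n)
    case (Suc n)
    then show ?case using assms[of "P * n + i"] by (simp add: algebra_simps)
  qed simp
  have split: "(\<Sum>i<P * n + k. a i) = (\<Sum>i<P * n. a i) + (\<Sum>i<k. a (P * n + i))" for k
    by (induction k) simp_all
  show ?case
    using Suc shift split[of P] by (simp add: algebra_simps)
qed simp

text \<open>The period in \<open>haar_Q\<close> is an unspecified choice of which only the defining
  property is available, so it is handed on together with the vanishing sum.\<close>

lemma haar_zeroD:
  assumes "haar_Q g = 0" "n > 0" "\<And>x. g (x + of_nat n) = g x"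
  obtains N where "N > 0" "\<And>x. g (x + of_nat N) = g x" "(\<Sum>x | 0 \<le> x \<and> x < of_nat N \<and> g x \<noteq> 0. g x) = 0"
proof -
  define N where "N = (SOME N::nat. N > 0 \<and> (\<forall>x. g (x + of_nat N) = g x))"
  have N: "N > 0 \<and> (\<forall>x. g (x + of_nat N) = g x)"
    unfolding N_def by (rule someI[of _ n]) (use assms(2,3) in simp)
  have "of_int (\<Sum>x | 0 \<le> x \<and> x < of_nat N \<and> g x \<noteq> 0. g x) / of_nat N = (0 :: rat)"
    using assms(1) unfolding haar_Q_def N_def Let_def .
  then have "(\<Sum>x | 0 \<le> x \<and> x < of_nat N \<and> g x \<noteq> 0. g x) = 0"
    using N by (simp del: of_int_sum)
  with N show ?thesis
    using that[of N] by simp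
qed

context padic
begin

lemma padic_abs_eq_1: "coprime n p \<Longrightarrow> padic_abs p (of_nat n) = 1"
  using padic_abs_coprime[of "int n"] p
  by (metis coprime_absorb_right int_dvd_int_iff not_prime_unit of_int_of_nat_eq)

lemma padic_abs_away: "prime q \<Longrightarrow> q \<noteq> p \<Longrightarrow> padic_abs q (of_nat p ^ s) = 1"
  using padic.padic_abs_eq_1[OF padic.intro, of q "p ^ s"] p by (simp add: primes_coprime)

lemma split_off_p:
  assumes "(n :: nat) \<noteq> 0" obtains s n' where "n = p ^ s * n'" "coprime n' p" "n' > 0"
proof -
  obtain n' where n': "n = p ^ multiplicity p n * n'" "\<not> p dvd n'"
    using multiplicity_decompose'[of n p] assms p by (metis not_prime_unit)
  then show ?thesis
    using that[OF n'(1)] prime_imp_coprime[OF p n'(2)] assms by (cases "n' = 0") (simp_all add: coprime_commute)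
qed

end

context lattice_space
begin

text \<open>The locale is interpreted once more for Q with basis {1}, where the coordinate of x is
  x. On rational numbers the adelic pullback is evaluation at v + x u, and the factor at p restricts
  x to p-integral numbers.\<close>

lemma pullback_eq:
  "on_V (*) {1} (tensor_char {1} p (line_pullback smul B p v u f') (L_at {1} p)) x =
     (if padic_abs p x \<le> 1 then away f' (v + smul x u) else 0)"
proof -
  interpret Q1: lattice_space p "(*)" "{1 :: rat}"
    by (intro lattice_space.intro padic_axioms vector_space_over_itself.finite_dimensional_vector_space_axioms)
  have c: "coord (*) {1 :: rat} x 1 = x"
    using vector_space_over_itself.sum_representation_eq[OF vector_space_over_itself.independent_Basis Q1.in_span_B vector_space_over_itself.finite_Basis order_refl, of x]
    by simp
  have LQ: "x \<in> Q1.LQ \<longleftrightarrow> padic_abs p x \<le> 1"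
    by (simp add: Q1.LQ_def Q1.emb_L_iff c)
  have prime_P: "prime q" if "q \<in> primes_away p" for q
    using that by (simp add: primes_away_def)
  have "(\<lambda>q\<in>primes_away p. V_emb (*) {1} q x) \<in> adeles {1} (primes_away p)"
    by (rule Q1.V_emb_in_adeles) (rule prime_P)
  then have "Q1.away (line_pullback smul B p v u f') x =
      f' (\<lambda>q\<in>primes_away p. \<lambda>b\<in>B. V_emb smul B q v b \<oplus>\<^bsub>Qp q\<^esub>
        (\<lambda>q\<in>primes_away p. V_emb (*) {1} q x) q 1 \<otimes>\<^bsub>Qp q\<^esub> V_emb smul B q u b)"
    unfolding Q1.away_def line_pullback_def by simp
  also have "(\<lambda>q\<in>primes_away p. \<lambda>b\<in>B. V_emb smul B q v b \<oplus>\<^bsub>Qp q\<^esub>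
        (\<lambda>q\<in>primes_away p. V_emb (*) {1} q x) q 1 \<otimes>\<^bsub>Qp q\<^esub> V_emb smul B q u b) =
      (\<lambda>q\<in>primes_away p. V_emb smul B q (v + smul x u))"
  proof (rule restrict_ext)
    fix q assume q: "q \<in> primes_away p"
    interpret q: lattice_space q smul B
      by (rule lattice_space_at[OF prime_P[OF q]])
    show "(\<lambda>b\<in>B. V_emb smul B q v b \<oplus>\<^bsub>Qp q\<^esub>
        (\<lambda>q\<in>primes_away p. V_emb (*) {1} q x) q 1 \<otimes>\<^bsub>Qp q\<^esub> V_emb smul B q u b) = V_emb smul B q (v + smul x u)"
      unfolding V_emb_def[of smul B q "v + smul x u"]
    proof (rule restrict_ext)
      fix b assume b: "b \<in> B"
      then show "V_emb smul B q v b \<oplus>\<^bsub>Qp q\<^esub>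
        (\<lambda>q\<in>primes_away p. V_emb (*) {1} q x) q 1 \<otimes>\<^bsub>Qp q\<^esub> V_emb smul B q u b = q.of_Q (crd (v + smul x u) b)"
        using q by (simp add: V_emb_def c coord_add coord_scale q.of_Q_add q.of_Q_mult)
    qed
  qed
  finally show ?thesis
    unfolding Q1.test_eq LQ away_def[of f'] by (simp only:)
qed

text \<open>The test function depends on \<open>p\<close>-power multiples of \<open>u\<close> in the same way as on multiples of \<open>u\<close>, since
  multiplication by \<open>p\<close> permutes the residues modulo \<open>K\<close>.\<close>

lemma vanishing_avg:
  assumes f': "f' \<in> schwartz B (primes_away p)" and van: "vanishing_hypothesis smul B p f' u"
  obtains c w K where "c > 0" "w = smul c u" "w \<in> LQ" "w \<noteq> 0" "K > 0" "coprime K p"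
    "\<And>v. avg w K (test f') v = 0" "\<And>v. test f' (v + smul (of_nat K) w) = test f' v"
proof -
  let ?F = "away f'"
  have u: "u \<noteq> 0" and haar: "haar_away p (line_pullback smul B p v u f') = 0" for v
    using van by (simp_all add: vanishing_hypothesis_def)
  obtain N where N: "N > 0" "coprime N p"
    and period: "\<And>v t. (\<And>q b. prime q \<Longrightarrow> q \<noteq> p \<Longrightarrow> b \<in> B \<Longrightarrow> padic_abs q (crd t b) \<le> padic_abs q (of_nat N)) \<Longrightarrow>
      ?F (v + t) = ?F v"
    and support: "\<And>v q b. ?F v \<noteq> 0 \<Longrightarrow> prime q \<Longrightarrow> q \<noteq> p \<Longrightarrow> b \<in> B \<Longrightarrow> padic_abs q (of_nat N * crd v b) \<le> 1"
    using away_schwartz[OF f'] by metis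
  \<comment> \<open>D clears the denominators of the coordinates of u. Its p-part p^s is split off:
    only D' may enter a period prime to p, while p^s reappears in the scaling of u.\<close>
  define D where "D = (\<Prod>b\<in>B. nat (snd (quotient_of (crd u b))))"
  have "D \<noteq> 0"
    unfolding D_def using quotient_of_denom_pos' finite_B by (simp add: prod_zero_iff not_le)
  then obtain s D' where D': "D = p ^ s * D'" "coprime D' p" "D' > 0"
    by (rule split_off_p)
  have Du: "of_nat p ^ s * of_nat D' * crd u b \<in> \<int>" if b: "b \<in> B" for b
  proof -
    have "nat (snd (quotient_of (crd u b))) dvd D"
      unfolding D_def using finite_B b by (rule dvd_prodI)
    then obtain r where r: "D = nat (snd (quotient_of (crd u b))) * r" by blast
    have pos: "snd (quotient_of (crd u b)) > 0"
      by (rule quotient_of_denom_pos')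
    have "of_nat D * crd u b = of_nat r * (of_int (snd (quotient_of (crd u b))) * crd u b)"
      using r pos by (simp add: of_nat_nat)
    also note quotient_of_mult
    finally show ?thesis
      using D'(1) by simp
  qed
  have int1: "padic_abs q x \<le> 1" if "x \<in> \<int>" "prime q" for x q
    using that padic.padic_abs_int_le_1[OF padic.intro] by (auto elim!: Ints_cases)
  \<comment> \<open>At the primes other than p, D' y u is integral, so N times it is a
    period.\<close>
  have period_m: "?F (v + smul (of_nat (N * D') * y) u) = ?F v"
    if y: "\<And>q. prime q \<Longrightarrow> q \<noteq> p \<Longrightarrow> padic_abs q y \<le> 1" for v y
  proof (rule period)
    fix q b assume q: "prime q" "q \<noteq> p" and b: "b \<in> B"
    have "padic_abs q (of_nat D' * crd u b) = padic_abs q (of_nat p ^ s * of_nat D' * crd u b)"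
      using padic_abs_away[OF q] by (simp add: padic_abs_mult[OF q(1)])
    also have "\<dots> \<le> 1" by (rule int1[OF Du[OF b] q(1)])
    finally have 1: "padic_abs q (of_nat D' * crd u b) \<le> 1" .
    have "crd (smul (of_nat (N * D') * y) u) b = of_nat N * (of_nat D' * crd u b * y)"
      by (simp add: coord_scale)
    then have "padic_abs q (crd (smul (of_nat (N * D') * y) u) b) =
        padic_abs q (of_nat N) * (padic_abs q (of_nat D' * crd u b) * padic_abs q y)"
      by (simp only: padic_abs_mult[OF q(1)])
    also have "\<dots> \<le> padic_abs q (of_nat N) * 1"
      using 1 y[OF q] by (intro mult_left_mono mult_le_one) (simp_all add: padic_abs_nonneg)
    finally show "padic_abs q (crd (smul (of_nat (N * D') * y) u) b) \<le> padic_abs q (of_nat N)" by simp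
  qed
  obtain b0 where b0: "b0 \<in> B" "crd u b0 \<noteq> 0"
    using coord_ext[of u 0] u by (auto simp: coord_zero)
  obtain a d where ad: "quotient_of (crd u b0) = (a, d)" by fastforce
  have d: "d > 0" and a: "crd u b0 = of_int a / of_int d"
    using ad quotient_of_denom_pos quotient_of_div by blast+
  then have "nat \<bar>a\<bar> \<noteq> 0" using b0(2) by auto
  then obtain r n' where n': "nat \<bar>a\<bar> = p ^ r * n'" "coprime n' p" "n' > 0"
    by (rule split_off_p)
  \<comment> \<open>Away from p, N clears the denominators of coordinates on the support. Two
    support points on a line differ in coordinate b0 by (x - y) a/d, so away from p the denominator
    of x - y divides N a. The p-part of a is dropped because x and y are p-integral.\<close>
  define K0 where "K0 = N * n'"
  have K0: "K0 > 0" "coprime K0 p"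
    using N n' by (simp_all add: K0_def)
  have K0_int: "of_nat K0 * (x - y) \<in> \<int>"
    if x: "padic_abs p x \<le> 1" "?F (v + smul x u) \<noteq> 0" and y: "padic_abs p y \<le> 1" "?F (v + smul y u) \<noteq> 0" for v x y
  proof (rule rat_integral)
    fix q :: nat assume q: "prime q"
    interpret q: padic q by (rule padic.intro[OF q])
    show "padic_abs q (of_nat K0 * (x - y)) \<le> 1"
    proof (cases "q = p")
      case True
      have "padic_abs p (x - y) \<le> 1"
        using padic_abs_diff_ultra[OF p, of x y] x(1) y(1) by linarith
      then show ?thesis
        using True padic_abs_int_le_1[of "int K0"] padic_abs_nonneg by (simp add: padic_abs_mult[OF p] mult_le_one)
    next
      case False
      have "padic_abs q (of_nat N * crd (v + smul x u) b0 - of_nat N * crd (v + smul y u) b0) \<le> 1"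
        using padic_abs_diff_ultra[OF q, of "of_nat N * crd (v + smul x u) b0" "of_nat N * crd (v + smul y u) b0"]
          support[OF x(2) q False b0(1)] support[OF y(2) q False b0(1)] by linarith
      moreover have "of_nat N * crd (v + smul x u) b0 - of_nat N * crd (v + smul y u) b0 = of_nat N * (x - y) * crd u b0"
        by (simp add: coord_add coord_scale algebra_simps)
      ultimately have 1: "padic_abs q (of_nat N * (x - y)) * padic_abs q (crd u b0) \<le> 1"
        by (simp only: padic_abs_mult[OF q])
      have "padic_abs q (of_nat n') = padic_abs q (of_nat (nat \<bar>a\<bar>))"
        unfolding n'(1) using padic_abs_away[OF q False] by (simp add: padic_abs_mult[OF q])
      also have "\<dots> = padic_abs q (of_int a)"
        by (cases "a \<ge> 0") (simp_all add: padic_abs_minus[OF q])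
      also have "of_int a = crd u b0 * of_int d"
        using a d by simp
      also have "padic_abs q (crd u b0 * of_int d) \<le> padic_abs q (crd u b0) * 1"
        unfolding padic_abs_mult[OF q] by (intro mult_left_mono q.padic_abs_int_le_1 padic_abs_nonneg)
      finally have "padic_abs q (of_nat N * (x - y)) * padic_abs q (of_nat n') \<le> padic_abs q (of_nat N * (x - y)) * padic_abs q (crd u b0)"
        by (intro mult_left_mono) (simp_all add: padic_abs_nonneg)
      then show ?thesis
        using 1 by (simp add: K0_def padic_abs_mult[OF q] mult_ac)
    qed
  qed
  define m where "m = N * D'"
  have m: "m > 0" "coprime m p"
    using N D' by (simp_all add: m_def)
  \<comment> \<open>x = i / K0 moves by the period m when the index i moves by m K0.\<close>
  define K where "K = m * K0"
  have K: "K > 0" "coprime K p"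
    using m K0 by (simp_all add: K_def)
  have frac_p: "padic_abs p (of_nat i / of_nat K0) \<le> 1" for i
  proof -
    have "padic_abs p (of_nat i / of_nat K0) = padic_abs p (of_nat i / of_nat K0) * padic_abs p (of_nat K0)"
      by (simp add: padic_abs_eq_1[OF K0(2)])
    also have "\<dots> = padic_abs p (of_nat i)"
      using K0(1) by (simp flip: padic_abs_mult[OF p])
    finally show ?thesis using padic_abs_int_le_1[of "int i"] by simp
  qed
  have sum0: "(\<Sum>i<K. ?F (v + smul (of_nat i / of_nat K0) u)) = 0" for v
  proof -
    define \<alpha> where "\<alpha> i = ?F (v + smul (of_nat i / of_nat K0) u)" for i
    define g where "g x = (if padic_abs p x \<le> 1 then ?F (v + smul x u) else 0)" for x
    have g_\<alpha>: "g (of_nat i / of_nat K0) = \<alpha> i" for i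
      by (simp add: g_def \<alpha>_def frac_p)
    have g_per: "g (x + of_nat m) = g x" for x
    proof -
      have "padic_abs p (x + of_nat m) \<le> 1 \<longleftrightarrow> padic_abs p x \<le> 1"
        using padic_abs_ultra[OF p, of x "of_nat m"] padic_abs_diff_ultra[OF p, of "x + of_nat m" "of_nat m"]
          padic_abs_int_le_1[of "int m"] by auto
      moreover have eq: "v + smul (x + of_nat m) u = v + smul x u + smul (of_nat (N * D') * 1) u"
        by (simp add: m_def vs.scale_left_distrib add.assoc)
      have "?F (v + smul (x + of_nat m) u) = ?F (v + smul x u)"
        unfolding eq by (rule period_m) simp
      ultimately show ?thesis
        by (simp only: g_def)
    qed
    have g0: "haar_Q g = 0"
      using haar[of v] unfolding haar_away_def pullback_eq[abs_def] g_def[abs_def] .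
    obtain n where n: "n > 0" "\<And>x. g (x + of_nat n) = g x"
      "(\<Sum>x | 0 \<le> x \<and> x < of_nat n \<and> g x \<noteq> 0. g x) = 0"
      using haar_zeroD[OF g0 m(1) g_per] by blast
    have "(\<Sum>i<n * K0. \<alpha> i) = 0"
    \<comment> \<open>By \<open>K0_int\<close> the support of g lies in one coset of (1/K0) Z. If
      some \<alpha> i0 is nonzero, this coset is (1/K0) Z itself, and the sum over i is the Haar
      sum; otherwise every term is 0.\<close>
    proof (cases "\<forall>i. \<alpha> i = 0")
      case False
      then obtain i0 where i0: "\<alpha> i0 \<noteq> 0" by blast
      let ?A = "{x. 0 \<le> x \<and> x < of_nat n \<and> g x \<noteq> 0}" and ?h = "\<lambda>i. of_nat i / of_nat K0 :: rat"
      have inj: "inj_on ?h {..<n * K0}"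
        using K0(1) by (auto simp: inj_on_def)
      have sub: "?A \<subseteq> ?h ` {..<n * K0}"
      proof
        fix x assume x: "x \<in> ?A"
        have "padic_abs p x \<le> 1" "?F (v + smul x u) \<noteq> 0"
          using x by (auto simp: g_def split: if_splits)
        then have "of_nat K0 * (x - of_nat i0 / of_nat K0) \<in> \<int>"
          using i0 frac_p[of i0] by (intro K0_int) (simp_all add: \<alpha>_def)
        then have "of_nat K0 * (x - of_nat i0 / of_nat K0) + of_nat i0 \<in> \<int>"
          by (rule Ints_add) simp
        then have "of_nat K0 * x \<in> \<int>"
          using K0(1) by (simp add: right_diff_distrib)
        then obtain k where k: "of_nat K0 * x = of_int k"
          by (rule Ints_cases)
        have "0 \<le> (of_int k :: rat)" "of_int k < (of_nat (n * K0) :: rat)"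
          using x K0(1) unfolding k[symmetric] by (simp_all add: mult.commute)
        then have "0 \<le> k" "k < int (n * K0)"
          by (simp, metis of_int_less_iff of_int_of_nat_eq)
        moreover from this k K0(1) have "x = ?h (nat k)"
          by (simp add: field_simps)
        moreover from calculation(1,2) have "nat k < n * K0"
          by (simp only: nat_less_iff)
        ultimately show "x \<in> ?h ` {..<n * K0}"
          by (intro image_eqI[of _ _ "nat k"]) simp_all
      qed
      have "(\<Sum>i<n * K0. \<alpha> i) = (\<Sum>x\<in>?h ` {..<n * K0}. g x)"
        unfolding sum.reindex[OF inj] comp_def g_\<alpha> ..
      also have "\<dots> = (\<Sum>x\<in>?A. g x)"
      proof (rule sum.mono_neutral_right[OF _ sub])
        show "\<forall>x\<in>?h ` {..<n * K0} - ?A. g x = 0"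
        proof
          fix x assume x: "x \<in> ?h ` {..<n * K0} - ?A"
          then obtain i where i: "i < n * K0" "x = ?h i" by blast
          have "of_nat i < (of_nat (n * K0) :: rat)"
            using i(1) by (simp only: of_nat_less_iff)
          then have "0 \<le> x" "x < of_nat n"
            using i(2) K0(1) by (simp_all add: pos_divide_less_eq)
          then show "g x = 0" using x by blast
        qed
      qed simp
      finally show ?thesis using n(3) by simp
    qed simp
    moreover have "\<alpha> (i + n * K0) = \<alpha> i" for i
      using n(2)[of "of_nat i / of_nat K0"] K0(1) g_\<alpha>[of "i + n * K0"] g_\<alpha>[of i] by (simp add: add_divide_distrib)
    \<comment> \<open>The Haar period n and the period m are unrelated. A sum of n m K0 terms is
      counted in two ways: as m copies of the vanishing Haar sum and as n copies of the sum over K =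
      m K0 terms.\<close>
    ultimately have "(\<Sum>i<n * K0 * m. \<alpha> i) = 0"
      by (subst period_sum) simp_all
    moreover have "\<alpha> (i + m * K0) = \<alpha> i" for i
      using g_per[of "of_nat i / of_nat K0"] K0(1) g_\<alpha>[of "i + m * K0"] g_\<alpha>[of i] by (simp add: add_divide_distrib)
    then have "(\<Sum>i<m * K0 * n. \<alpha> i) = int n * (\<Sum>i<m * K0. \<alpha> i)"
      by (rule period_sum)
    ultimately have "int n * (\<Sum>i<K. \<alpha> i) = 0"
      by (simp add: K_def mult_ac)
    then show ?thesis
      using n(1) by (simp add: \<alpha>_def)
  qed
  \<comment> \<open>p^s u is p-integral by the choice of s, and division by K0, a p-adic unit, keeps
    it so.\<close>
  define c where "c = of_nat p ^ s / (of_nat K0 :: rat)"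
  define w where "w = smul c u"
  have c: "c > 0"
    using K0(1) prime_gt_0_nat[OF p] by (simp add: c_def)
  have w0: "w \<noteq> 0"
    using c u by (simp add: w_def)
  have wL: "w \<in> LQ"
    unfolding LQ_def mem_Collect_eq emb_L_iff
  proof
    fix b assume b: "b \<in> B"
    have "of_nat (K0 * D') * crd w b = of_nat p ^ s * of_nat D' * crd u b"
      using K0(1) by (simp add: w_def coord_scale c_def)
    then have "padic_abs p (of_nat (K0 * D')) * padic_abs p (crd w b) \<le> 1"
      using int1[OF Du[OF b] p] by (simp only: flip: padic_abs_mult[OF p])
    moreover have "padic_abs p (of_nat (K0 * D')) = 1"
      using K0 D' by (intro padic_abs_eq_1) simp
    ultimately show "padic_abs p (crd w b) \<le> 1" by simp
  qed
  have sumw: "(\<Sum>j<K. ?F (v + smul (of_nat j) w)) = 0" for v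
  proof -
    define \<alpha> where "\<alpha> i = ?F (v + smul (of_nat i / of_nat K0) u)" for i
    have per: "\<alpha> (i + K) = \<alpha> i" for i
    proof -
      have eq: "v + smul (of_nat (i + K) / of_nat K0) u = v + smul (of_nat i / of_nat K0) u + smul (of_nat (N * D') * 1) u"
        using K0(1) by (simp add: K_def m_def add_divide_distrib vs.scale_left_distrib add.assoc)
      show ?thesis
        unfolding \<alpha>_def eq by (rule period_m) simp
    qed
    have per_mult: "\<alpha> (i + K * n) = \<alpha> i" for i n
    proof (induction n)
      case (Suc n)
      then show ?case using per[of "i + K * n"] by (simp add: algebra_simps)
    qed simp
    have mod: "\<alpha> i = \<alpha> (i mod K)" for i
      using per_mult[of "i mod K" "i div K"] by simp
    let ?h = "\<lambda>j. (p ^ s * j) mod K"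
    have inj: "inj_on ?h {..<K}"
    proof (rule inj_onI)
      fix i j assume ij: "i \<in> {..<K}" "j \<in> {..<K}" "?h i = ?h j"
      then have "[p ^ s * i = p ^ s * j] (mod K)"
        by (simp add: cong_def)
      then have "[i = j] (mod K)"
        using K(2) by (simp add: cong_mult_lcancel_nat coprime_commute)
      then show "i = j" using ij by (simp add: cong_def)
    qed
    have img: "?h ` {..<K} = {..<K}"
      using K(1) by (intro endo_inj_surj inj) auto
    have "?F (v + smul (of_nat j) w) = \<alpha> (?h j)" for j
      unfolding mod[symmetric] by (simp add: \<alpha>_def w_def c_def mult.commute)
    then have "(\<Sum>j<K. ?F (v + smul (of_nat j) w)) = (\<Sum>i\<in>?h ` {..<K}. \<alpha> i)"
      by (simp add: sum.reindex[OF inj])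
    then show ?thesis
      unfolding img using sum0[of v] by (simp add: \<alpha>_def)
  qed
  have LQ_shift: "v - smul (of_nat j) w \<in> LQ \<longleftrightarrow> v \<in> LQ" for v j
    using LQ_nmul[OF wL, of j] LQ_diff[of v "smul (of_nat j) w"] LQ_add[of "v - smul (of_nat j) w" "smul (of_nat j) w"]
    by auto
  have avg0: "avg w K (test f') v = 0" for v
  proof (cases "v \<in> LQ")
    case True
    \<comment> \<open>\<open>avg\<close> steps backwards from v; read in reverse order it is the
      forward sum starting at v'.\<close>
    define v' where "v' = v - smul (of_nat (K - 1)) w"
    have "v - smul (of_nat (K - Suc j)) w = v' + smul (of_nat j) w" if "j < K" for j
    proof -
      have "of_nat (K - 1) = (of_nat (K - Suc j) + of_nat j :: rat)"
        using that by (simp flip: of_nat_add)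
      then show ?thesis
        by (simp add: v'_def vs.scale_left_distrib)
    qed
    then have "(\<Sum>j<K. ?F (v - smul (of_nat (K - Suc j)) w)) = (\<Sum>j<K. ?F (v' + smul (of_nat j) w))"
      by (intro sum.cong) simp_all
    then have "(\<Sum>j<K. ?F (v - smul (of_nat j) w)) = 0"
      using sumw[of v'] sum.nat_diff_reindex[of "\<lambda>j. ?F (v - smul (of_nat j) w)" K] by simp
    then show ?thesis
      using True by (simp add: avg_def test_eq LQ_shift)
  qed (simp add: avg_def test_eq LQ_shift)
  \<comment> \<open>K0 cancels and K w becomes N D' p^s u: a period as in \<open>period_m\<close>
    with y = p^s.\<close>
  have "test f' (v + smul (of_nat K) w) = test f' v" for v
  proof -
    have eq: "smul (of_nat K) w = smul (of_nat (N * D') * of_nat p ^ s) u"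
      using K0(1) by (simp add: w_def c_def K_def m_def)
    have "?F (v + smul (of_nat K) w) = ?F v"
      unfolding eq by (rule period_m) (simp add: padic_abs_away)
    then show ?thesis
      using LQ_shift[of "v + smul (of_nat K) w" K] by (simp add: test_eq)
  qed
  with that[OF c w_def wL w0 K avg0] show ?thesis by blast
qed

end

section \<open>Cones\<close>

lemma common_denominator:
  assumes "finite X"
  obtains n :: nat where "n > 0" "\<And>x. x \<in> X \<Longrightarrow> of_nat n * (x :: rat) \<in> \<int>"
proof -
  have "\<exists>n>0. \<forall>x\<in>X. of_nat n * x \<in> \<int>"
    using assms
  proof (induction X)
    case (insert y X)
    then obtain n :: nat where n: "n > 0" "\<forall>x\<in>X. of_nat n * x \<in> \<int>" by blast
    define d where "d = nat (snd (quotient_of y))"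
    have d: "d > 0" "of_nat d * y \<in> \<int>"
      using quotient_of_denom_pos'[of y] quotient_of_mult[of y] by (simp_all add: d_def)
    have "of_nat (n * d) * x \<in> \<int>" if "x \<in> insert y X" for x
    proof (cases "x = y")
      case True
      have "of_nat n * (of_nat d * y) \<in> \<int>" by (rule Ints_mult[OF Ints_of_nat d(2)])
      then show ?thesis using True by (simp add: mult.assoc)
    next
      case False
      then have "of_nat n * x \<in> \<int>" using n(2) that by simp
      from Ints_mult[OF Ints_of_nat[of d] this]
      show ?thesis by (simp add: mult_ac)
    qed
    then show ?case using n(1) d(1) by (intro exI[of _ "n * d"]) simp
  qed (auto intro: exI[of _ 1])
  then show ?thesis using that by blast
qed

context lattice_space
begin

text \<open>The rational points of the open cone, described by rational coefficients; everything but
  the gluing of the cones takes place here.\<close>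

definition rat_cone :: "'v set \<Rightarrow> 'v set" where
  "rat_cone D = {v \<in> vs.span D. \<forall>u\<in>D. vs.representation D v u > 0}"

abbreviation "rep \<equiv> vs.representation"

definition real_vec :: "'v \<Rightarrow> 'v \<Rightarrow> real" where
  "real_vec v = (\<lambda>b\<in>B. of_rat (crd v b))"

lemma span_expand:
  assumes "vs.independent D" "finite D" "v \<in> vs.span D"
  shows "(\<Sum>u\<in>D. smul (rep D v u) u) = v"
  by (rule vs.sum_representation_eq[OF assms(1,3,2) order_refl])

lemma coord_sum: "crd (\<Sum>u\<in>D. smul (c u) u) b = (\<Sum>u\<in>D. c u * crd u b)"
  by (induction D rule: infinite_finite_induct) (simp_all add: coord_zero coord_add coord_scale)

lemma rep_sum:
  assumes D: "vs.independent D" "finite D" and v: "v = (\<Sum>u\<in>D. smul (c u) u)" and u: "u \<in> D"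
  shows "v \<in> vs.span D" "rep D v u = c u"
proof -
  have s: "smul (c u) u \<in> vs.span D" if "u \<in> D" for u
    using that by (intro vs.span_scale vs.span_base)
  then show "v \<in> vs.span D"
    unfolding v by (rule vs.span_sum)
  have "rep D v u = (\<Sum>w\<in>D. rep D (smul (c w) w) u)"
    unfolding v by (subst vs.representation_sum[OF D(1)]) (simp_all add: s)
  also have "\<dots> = (\<Sum>w\<in>D. if u = w then c w else 0)"
    by (intro sum.cong) (simp_all add: vs.representation_scale[OF D(1) vs.span_base] vs.representation_basis[OF D(1)])
  also have "\<dots> = c u"
    using D(2) u by simp
  finally show "rep D v u = c u" .
qed

text \<open>A rational vector in a real cone with rational generators has rational coefficients: apply the
  functionals dual to an extension of the generators to a basis.\<close>

lemma open_cone_iff: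
  assumes D: "finite D" "vs.independent D"
  shows "real_vec v \<in> open_cone smul B D \<longleftrightarrow> v \<in> rat_cone D"
proof
  assume v: "v \<in> rat_cone D"
  then have span: "v \<in> vs.span D" and pos: "\<forall>u\<in>D. rep D v u > 0"
    by (auto simp: rat_cone_def)
  have "crd v b = (\<Sum>u\<in>D. rep D v u * crd u b)" for b
    using coord_sum[of "rep D v" D b] span_expand[OF D(2,1) span] by simp
  then have "real_vec v = (\<lambda>b\<in>B. \<Sum>u\<in>D. of_rat (rep D v u) * of_rat (crd u b))"
    by (simp add: real_vec_def of_rat_sum of_rat_mult)
  then show "real_vec v \<in> open_cone smul B D"
    unfolding open_cone_def using pos by (intro CollectI exI[of _ "\<lambda>u. of_rat (rep D v u)"]) simp
next
  assume "real_vec v \<in> open_cone smul B D"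
  then obtain a where a: "real_vec v = (\<lambda>b\<in>B. \<Sum>u\<in>D. a u * of_rat (crd u b))" "\<forall>u\<in>D. a u > 0"
    unfolding open_cone_def by blast
  have crd_v: "of_rat (crd v b) = (\<Sum>u\<in>D. a u * of_rat (crd u b))" if "b \<in> B" for b
    using fun_cong[OF a(1), of b] that by (simp add: real_vec_def)
  define D' where "D' = vs.extend_basis D"
  have D': "D \<subseteq> D'" "vs.independent D'" "vs.span D' = UNIV"
    unfolding D'_def using vs.extend_basis_superset[OF D(2)] vs.independent_extend_basis[OF D(2)]
      vs.span_extend_basis[OF D(2)] by blast+
  have fin: "finite D'"
    using D'(2) by (rule vs.finiteI_independent)
  have phi: "rep D' x u = (\<Sum>b\<in>B. crd x b * rep D' b u)" for x u
  proof -
    have "rep D' x u = rep D' (\<Sum>b\<in>B. smul (crd x b) b) u"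
      using span_expand[OF vs.independent_Basis finite_B in_span_B, of x] by simp
    also have "\<dots> = (\<Sum>b\<in>B. crd x b * rep D' b u)"
      by (simp add: vs.representation_sum[OF D'(2)] vs.representation_scale[OF D'(2)] D'(3))
    finally show ?thesis .
  qed
  have coeff: "of_rat (rep D' v u') = (if u' \<in> D then a u' else 0)" for u'
  proof -
    have "of_rat (rep D' v u') = (\<Sum>b\<in>B. of_rat (crd v b) * of_rat (rep D' b u'))"
      unfolding phi[of v] by (simp add: of_rat_sum of_rat_mult)
    also have "\<dots> = (\<Sum>b\<in>B. \<Sum>u\<in>D. a u * (of_rat (crd u b) * of_rat (rep D' b u')))"
      by (intro sum.cong) (simp_all add: crd_v sum_distrib_right mult.assoc)
    also have "\<dots> = (\<Sum>u\<in>D. a u * of_rat (\<Sum>b\<in>B. crd u b * rep D' b u'))"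
      by (subst sum.swap) (simp add: of_rat_sum of_rat_mult sum_distrib_left)
    also have "\<dots> = (\<Sum>u\<in>D. if u' = u then a u else 0)"
      unfolding phi[symmetric]
      using D'(1) by (intro sum.cong) (auto simp: vs.representation_basis[OF D'(2)])
    also have "\<dots> = (if u' \<in> D then a u' else 0)"
      using D(1) by simp
    finally show ?thesis .
  qed
  have "v = (\<Sum>u\<in>D'. smul (rep D' v u) u)"
    using span_expand[OF D'(2) fin, of v] D'(3) by simp
  also have "\<dots> = (\<Sum>u\<in>D. smul (rep D' v u) u)"
  proof (rule sum.mono_neutral_right[OF fin D'(1)])
    have "rep D' v u = 0" if "u \<notin> D" for u
      using coeff[of u] that by simp
    then show "\<forall>u\<in>D' - D. smul (rep D' v u) u = 0" by simp
  qed
  finally have v: "v = (\<Sum>u\<in>D. smul (rep D' v u) u)" .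
  have "v \<in> vs.span D"
    by (subst v) (intro vs.span_sum vs.span_scale vs.span_base)
  moreover have "rep D v u > 0" if u: "u \<in> D" for u
  proof -
    have "of_rat (rep D v u) = a u"
      unfolding rep_sum(2)[OF D(2,1) v u] using coeff[of u] u by simp
    then show ?thesis
      using a(2) u by (metis zero_less_of_rat_iff)
  qed
  ultimately show "v \<in> rat_cone D"
    by (simp add: rat_cone_def)
qed

lemma parallelepiped_iff:
  assumes "finite D" "vs.independent D"
  shows "v \<in> parallelepiped smul D a \<longleftrightarrow> v \<in> rat_cone D \<and> (\<forall>u\<in>D. rep D v u \<le> a u)"
proof
  assume "v \<in> parallelepiped smul D a"
  then obtain c where c: "v = (\<Sum>u\<in>D. smul (c u) u)" "\<forall>u\<in>D. 0 < c u \<and> c u \<le> a u"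
    unfolding parallelepiped_def by blast
  have "v \<in> vs.span D"
    unfolding c(1) by (intro vs.span_sum vs.span_scale vs.span_base)
  then show "v \<in> rat_cone D \<and> (\<forall>u\<in>D. rep D v u \<le> a u)"
    using rep_sum(2)[OF assms(2,1) c(1)] c(2) by (simp add: rat_cone_def)
next
  assume v: "v \<in> rat_cone D \<and> (\<forall>u\<in>D. rep D v u \<le> a u)"
  then have "v = (\<Sum>u\<in>D. smul (rep D v u) u)"
    using span_expand[OF assms(2,1)] by (simp add: rat_cone_def)
  then show "v \<in> parallelepiped smul D a"
    unfolding parallelepiped_def using v by (intro CollectI exI[of _ "rep D v"]) (simp add: rat_cone_def)
qed

lemma rep_shift:
  assumes D: "vs.independent D" and u: "u \<in> D" and v: "v \<in> vs.span D"
  shows "v - smul c u \<in> vs.span D" "rep D (v - smul c u) u' = rep D v u' - (if u' = u then c else 0)"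
proof -
  have s: "smul c u \<in> vs.span D"
    using u by (intro vs.span_scale vs.span_base)
  then show "v - smul c u \<in> vs.span D"
    using v by (intro vs.span_diff)
  show "rep D (v - smul c u) u' = rep D v u' - (if u' = u then c else 0)"
    using vs.representation_diff[OF D s v] vs.representation_scale[OF D vs.span_base[OF u], of c]
      vs.representation_basis[OF D u] by simp
qed

lemma span_shift_iff: "u \<in> D \<Longrightarrow> v - smul c u \<in> vs.span D \<longleftrightarrow> v \<in> vs.span D"
  using vs.span_add[of "v - smul c u" D "smul c u"] vs.span_diff[of v D "smul c u"] vs.span_scale vs.span_base
  by auto

lemma rep_not_span: "v \<notin> vs.span D \<Longrightarrow> rep D v u = 0"
  by (simp add: vs.representation_def)

text \<open>The lattice (1/n) L for n > 0. A test function f is supported on such a lattice, whose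
  discreteness turns bounded supports into finite ones.\<close>

definition Lat :: "nat \<Rightarrow> 'v set" where
  "Lat n = {v. \<forall>b\<in>B. of_nat n * crd v b \<in> \<int>}"

lemma Lat_add: "v \<in> Lat n \<Longrightarrow> w \<in> Lat n \<Longrightarrow> v + w \<in> Lat n"
  by (simp add: Lat_def coord_add distrib_left)

lemma finite_Lat_box:
  assumes "n > 0" shows "finite {v \<in> Lat n. \<forall>b\<in>B. \<bar>crd v b\<bar> \<le> R}"
proof -
  define m where "m = \<lceil>of_nat n * R\<rceil>"
  let ?A = "{v \<in> Lat n. \<forall>b\<in>B. \<bar>crd v b\<bar> \<le> R}" and ?h = "\<lambda>v. \<lambda>b\<in>B. \<lfloor>of_nat n * crd v b\<rfloor>"
  have fl: "of_int \<lfloor>of_nat n * crd v b\<rfloor> = of_nat n * crd v b" if "v \<in> ?A" "b \<in> B" for v b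
    using that by (auto simp: Lat_def elim!: Ints_cases)
  have "?h v \<in> B \<rightarrow>\<^sub>E {-m..m}" if v: "v \<in> ?A" for v
    unfolding restrict_PiE_iff
  proof
    fix b assume b: "b \<in> B"
    have "\<bar>of_nat n * crd v b\<bar> \<le> of_nat n * R"
      using v b by (simp add: abs_mult mult_left_mono)
    then have "of_nat n * crd v b \<le> of_int m" "- of_nat n * crd v b \<le> of_int m"
      unfolding m_def using le_of_int_ceiling[of "of_nat n * R"] by linarith+
    then have "(of_int \<lfloor>of_nat n * crd v b\<rfloor> :: rat) \<le> of_int m" "of_int (- m) \<le> (of_int \<lfloor>of_nat n * crd v b\<rfloor> :: rat)"
      unfolding fl[OF v b] by simp_all
    then show "\<lfloor>of_nat n * crd v b\<rfloor> \<in> {-m..m}"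
      by (simp only: of_int_le_iff atLeastAtMost_iff)
  qed
  then have "?h ` ?A \<subseteq> B \<rightarrow>\<^sub>E {-m..m}"
    by blast
  then have "finite (?h ` ?A)"
    by (rule finite_subset) (simp add: finite_PiE finite_B)
  moreover have "inj_on ?h ?A"
  proof (rule inj_onI)
    fix v w assume v: "v \<in> ?A" and w: "w \<in> ?A" and eq: "?h v = ?h w"
    show "v = w"
    proof (rule coord_ext)
      fix b assume b: "b \<in> B"
      then have "\<lfloor>of_nat n * crd v b\<rfloor> = \<lfloor>of_nat n * crd w b\<rfloor>"
        using fun_cong[OF eq, of b] by simp
      then have "of_nat n * crd v b = of_nat n * crd w b"
        using fl[OF v b] fl[OF w b] by metis
      then show "crd v b = crd w b"
        using assms by simp
    qed
  qed
  ultimately show ?thesis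
    by (rule finite_imageD)
qed

text \<open>Bounded coefficients on \<open>D\<close> give bounded coordinates in the basis
  \<open>B\<close>, and a box contains finitely many points of the lattice.\<close>

lemma finite_Lat_parallelepiped:
  assumes "n > 0" "finite D" "vs.independent D"
  shows "finite (Lat n \<inter> {v \<in> rat_cone D. \<forall>u\<in>D. rep D v u \<le> a u})"
proof (rule finite_subset[OF _ finite_Lat_box[OF assms(1)]])
  let ?R = "\<Sum>b\<in>B. \<Sum>u\<in>D. a u * \<bar>crd u b\<bar>"
  show "Lat n \<inter> {v \<in> rat_cone D. \<forall>u\<in>D. rep D v u \<le> a u} \<subseteq> {v \<in> Lat n. \<forall>b\<in>B. \<bar>crd v b\<bar> \<le> \<bar>?R\<bar>}"
  proof clarify
    fix v b assume L: "v \<in> Lat n" and v: "v \<in> rat_cone D" and le: "\<forall>u\<in>D. rep D v u \<le> a u" and b: "b \<in> B"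
    have pos: "0 < rep D v u" "0 < a u" if "u \<in> D" for u
      using v le that by (force simp: rat_cone_def)+
    have nonneg: "0 \<le> a u * \<bar>crd u b'\<bar>" if "u \<in> D" for u b'
      using pos(2)[OF that] by simp
    have "crd v b = (\<Sum>u\<in>D. rep D v u * crd u b)"
      using coord_sum[of "rep D v" D b] span_expand[OF assms(3,2), of v] v by (simp add: rat_cone_def)
    then have "\<bar>crd v b\<bar> \<le> (\<Sum>u\<in>D. \<bar>rep D v u * crd u b\<bar>)"
      by (simp add: sum_abs)
    also have "\<dots> \<le> (\<Sum>u\<in>D. a u * \<bar>crd u b\<bar>)"
      using le pos by (intro sum_mono) (simp add: abs_mult abs_of_pos mult_right_mono)
    also have "\<dots> \<le> ?R"
      using finite_B nonneg by (intro member_le_sum[OF b] sum_nonneg) blast+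
    finally show "\<bar>crd v b\<bar> \<le> \<bar>?R\<bar>" by simp
  qed
qed

definition on_cone :: "('v \<Rightarrow> int) \<Rightarrow> 'v set \<Rightarrow> 'v \<Rightarrow> int" where
  "on_cone f D v = (if v \<in> rat_cone D then f v else 0)"

text \<open>As f is periodic, the difference along u only cuts the cone: the translated cone is the
  part with u-coefficient greater than \<open>a u\<close>, and the part with coefficient at most
  \<open>a u\<close> remains. Doing this for all generators leaves the half-open
  parallelepiped.\<close>

lemma dops_on_cone:
  assumes D: "finite D" "vs.independent D" and us: "set us \<subseteq> D" "distinct us"
    and per: "\<And>u v. u \<in> D \<Longrightarrow> f (v + smul (a u) u) = f v" and a: "\<And>u. u \<in> D \<Longrightarrow> a u > 0"
  shows "dops (map (\<lambda>u. smul (a u) u) us) (on_cone f D) v =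
    (if v \<in> rat_cone D \<and> (\<forall>u\<in>set us. rep D v u \<le> a u) then f v else 0)"
  using us
proof (induction us arbitrary: v)
  case Nil
  then show ?case by (simp add: on_cone_def)
next
  case (Cons u us)
  have u: "u \<in> D" "u \<notin> set us" "set us \<subseteq> D" "distinct us" using Cons.prems by simp_all
  let ?w = "smul (a u) u"
  have fw: "f (v - ?w) = f v"
    using per[OF u(1), of "v - ?w"] by simp
  have "v - ?w \<in> rat_cone D \<and> (\<forall>u'\<in>set us. rep D (v - ?w) u' \<le> a u') \<longleftrightarrow>
      v \<in> rat_cone D \<and> (\<forall>u'\<in>set us. rep D v u' \<le> a u') \<and> rep D v u > a u"
  proof (cases "v \<in> vs.span D")
    case True
    note sh = rep_shift[OF D(2) u(1) True]
    have 1: "(\<forall>u'\<in>set us. rep D (v - ?w) u' \<le> a u') \<longleftrightarrow> (\<forall>u'\<in>set us. rep D v u' \<le> a u')"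
      using u(2) by (intro ball_cong refl) (auto simp: sh(2))
    have 2: "(\<forall>u'\<in>D. rep D (v - ?w) u' > 0) \<longleftrightarrow> (\<forall>u'\<in>D. rep D v u' > 0) \<and> rep D v u > a u"
    proof
      assume *: "\<forall>u'\<in>D. rep D (v - ?w) u' > 0"
      have gt: "rep D v u > a u"
        using bspec[OF * u(1)] by (simp add: sh(2))
      moreover have "rep D v u' > 0" if "u' \<in> D" for u'
        using bspec[OF * that] gt a[OF u(1)] by (cases "u' = u") (simp_all add: sh(2))
      ultimately show "(\<forall>u'\<in>D. rep D v u' > 0) \<and> rep D v u > a u" by blast
    qed (simp add: sh(2))
    show ?thesis
      unfolding 1 rat_cone_def using 2 sh(1) True by auto
  next
    case False
    then show ?thesis
      using span_shift_iff[OF u(1), of v] by (simp add: rat_cone_def)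
  qed
  then show ?case
    using Cons.IH[OF u(3,4)] by (auto simp: dop_def fw not_le)
qed

text \<open>The fraction that defines the pseudo-measure arises from one difference per generator:
  the numerator is the sum over the parallelepiped, the denominator the product over
  \<open>D\<close>.\<close>

lemma open_cone_represents:
  assumes D: "finite D" "vs.independent D"
    and adm: "admissible_scaling smul B p f D a"
    and f: "n > 0" "\<And>v. f v \<noteq> 0 \<Longrightarrow> v \<in> LQ \<inter> Lat n"
  shows "represents (on_cone f D) (open_cone_pseudo_measure smul B p f D a)"
proof -
  let ?w = "\<lambda>u. smul (a u) u"
  have a: "a u > 0" "?w u \<in> LQ" and per: "f (v + ?w u) = f v" if "u \<in> D" for u v
    using adm that by (auto simp: admissible_scaling_def LQ_def)
  obtain us where us: "set us = D" "distinct us"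
    using finite_distinct_list[OF D(1)] by blast
  have w0: "?w u \<noteq> 0" if "u \<in> D" for u
    using a(1)[OF that] D(2) that vs.dependent_zero by auto
  let ?ws = "map ?w us"
  have good: "good ?ws"
    using a(2) w0 us(1) by (auto simp: good_def)
  have dops: "dops ?ws (on_cone f D) v = (if v \<in> parallelepiped smul D a then f v else 0)" for v
    unfolding parallelepiped_iff[OF D] using dops_on_cone[OF D _ us(2), of f a v] us(1) per a(1) by simp
  have supp: "supp (dops ?ws (on_cone f D)) = {v \<in> parallelepiped smul D a. f v \<noteq> 0}"
    by (auto simp: supp_def dops)
  have "{v \<in> parallelepiped smul D a. f v \<noteq> 0} \<subseteq> Lat n \<inter> {v \<in> rat_cone D. \<forall>u\<in>D. rep D v u \<le> a u}"
    using f(2) parallelepiped_iff[OF D] by blast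
  then have "finite {v \<in> parallelepiped smul D a. f v \<noteq> 0}"
    by (rule finite_subset[OF _ finite_Lat_parallelepiped[OF f(1) D]])
  then have sup: "supported (dops ?ws (on_cone f D))"
    unfolding supported_def supp using f(2) by blast
  have num: "formal_sum (dops ?ws (on_cone f D)) =
      (\<Oplus>\<^bsub>M\<^esub>v\<in>{v \<in> parallelepiped smul D a. f v \<noteq> 0}. [f v] \<cdot>\<^bsub>M\<^esub> dl v)"
    unfolding formal_sum_def supp
    by (rule M.finsum_cong') (use f(2) add_pow_dl_closed in \<open>auto simp: dops\<close>)
  have den: "den ?ws = (\<Otimes>\<^bsub>M\<^esub>u\<in>D. \<one>\<^bsub>M\<^esub> \<ominus>\<^bsub>M\<^esub> dl (?w u))"
  proof -
    have "den (map ?w us) = (\<Otimes>\<^bsub>M\<^esub>u\<in>set us. \<one>\<^bsub>M\<^esub> \<ominus>\<^bsub>M\<^esub> dl (?w u))" if "set us \<subseteq> D" "distinct us" for us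
      using that
    proof (induction us)
      case (Cons u us)
      then have "(\<Otimes>\<^bsub>M\<^esub>u\<in>insert u (set us). \<one>\<^bsub>M\<^esub> \<ominus>\<^bsub>M\<^esub> dl (?w u)) =
          (\<one>\<^bsub>M\<^esub> \<ominus>\<^bsub>M\<^esub> dl (?w u)) \<otimes>\<^bsub>M\<^esub> (\<Otimes>\<^bsub>M\<^esub>u\<in>set us. \<one>\<^bsub>M\<^esub> \<ominus>\<^bsub>M\<^esub> dl (?w u))"
        using a(2) by (intro M.finprod_insert) auto
      then show ?case using Cons by simp
    qed simp
    then show ?thesis using us by simp
  qed
  have dS: "\<one>\<^bsub>M\<^esub> \<ominus>\<^bsub>M\<^esub> dl (?w u) \<in> denominators B p" if "u \<in> D" for u
    by (rule denominator_dl[OF a(2)[OF that] w0[OF that]])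
  note fp = PM.finprod_frac[OF D(1), of "\<lambda>u. \<one>\<^bsub>M\<^esub> \<ominus>\<^bsub>M\<^esub> dl (?w u)", OF dS]
  have "open_cone_pseudo_measure smul B p f D a =
      (\<Otimes>\<^bsub>PM.Loc\<^esub>u\<in>D. PM.fract \<one>\<^bsub>M\<^esub> (\<one>\<^bsub>M\<^esub> \<ominus>\<^bsub>M\<^esub> dl (?w u))) \<otimes>\<^bsub>PM.Loc\<^esub>
      of_measure B p (formal_sum (dops ?ws (on_cone f D)))"
    unfolding open_cone_pseudo_measure_def Let_def pseudo_measure_ring_def num dl_0[symmetric] dl_def ..
  also have "\<dots> = PM.fract \<one>\<^bsub>M\<^esub> (den ?ws) \<otimes>\<^bsub>PM.Loc\<^esub> PM.fract (formal_sum (dops ?ws (on_cone f D))) \<one>\<^bsub>M\<^esub>"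
    using fp by (simp add: den of_measure_fract)
  also have "\<dots> = PM.fract (formal_sum (dops ?ws (on_cone f D))) (den ?ws)"
    using sup good by (simp add: PM.frac_mult den_in PM.one_S)
  finally show ?thesis
    using good sup unfolding represents_def by blast
qed

section \<open>Averages on an open cone\<close>

lemma supp_avg:
  assumes "supp h \<subseteq> S" "\<And>v. v \<in> S \<Longrightarrow> v + w \<in> S"
  shows "supp (avg w K h) \<subseteq> S"
proof
  fix v assume "v \<in> supp (avg w K h)"
  then have "\<exists>j<K. h (v - smul (of_nat j) w) \<noteq> 0"
    unfolding supp_def avg_def by (metis (mono_tags, lifting) lessThan_iff mem_Collect_eq sum.neutral)
  then obtain j where j: "v - smul (of_nat j) w \<in> S"
    using assms(1) by (auto simp: supp_def)
  have "x + smul (of_nat j) w \<in> S" if "x \<in> S" for x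
  proof (induction j)
    case (Suc j)
    then show ?case
      using assms(2)[OF Suc] unfolding smul_Suc by (simp add: add.assoc)
  qed (use that in simp)
  from this[OF j] show "v \<in> S" by simp
qed

lemma supp_avgs:
  assumes "supp h \<subseteq> S" "\<And>v w K. (w, K) \<in> set xs \<Longrightarrow> v \<in> S \<Longrightarrow> v + w \<in> S"
  shows "supp (avgs xs h) \<subseteq> S"
  using assms(2)
proof (induction xs)
  case (Cons x xs)
  obtain w K where x: "x = (w, K)" by fastforce
  have IH: "supp (avgs xs h) \<subseteq> S"
  proof (rule Cons.IH)
    show "v + w \<in> S" if "(w, K) \<in> set xs" "v \<in> S" for v w K
      by (rule Cons.prems[of w K]) (use that in simp_all)
  qed
  show ?case
    unfolding x avgs_simps
    by (rule supp_avg[OF IH]) (rule Cons.prems[of w K], simp_all add: x)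
qed (use assms(1) in simp)

lemma avg_avg: "avg w K (avg w' K' h) = avg w' K' (avg w K h)"
proof
  fix v
  have eq: "v - smul (of_nat i) w - smul (of_nat j) w' = v - smul (of_nat j) w' - smul (of_nat i) w" for i j
    by (simp add: algebra_simps)
  show "avg w K (avg w' K' h) v = avg w' K' (avg w K h) v"
    unfolding avg_def by (subst sum.swap) (simp only: eq)
qed

lemma avgs_avg: "avgs xs (avg w K h) = avg w K (avgs xs h)"
proof (induction xs)
  case (Cons x xs)
  then show ?case by (cases x) (simp add: avg_avg)
qed simp

text \<open>Averaging along \<open>u\<close> kills the part of the cone whose \<open>u\<close>-coordinate is large, and the averages along
  the other generators do not move this coordinate.\<close>

lemma avgs_on_cone_eq_0:
  assumes D: "finite D" "vs.independent D" and us: "set us \<subseteq> D" "distinct us" and u: "u \<in> set us"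
    and c: "c u > 0" and v: "rep D v u > of_nat (K u) * c u"
    and avg: "\<And>v. avg (smul (c u) u) (K u) f v = 0"
  shows "avgs (map (\<lambda>u. (smul (c u) u, K u)) us) (on_cone f D) v = 0"
proof -
  let ?x = "\<lambda>u. (smul (c u) u, K u)"
  have uD: "u \<in> D" using us u by blast
  obtain xs ys where xy: "us = xs @ u # ys"
    using split_list[OF u] by blast
  let ?g = "avg (smul (c u) u) (K u) (on_cone f D)"
  \<comment> \<open>Averages commute, so the one along u may be applied to the cone function before
    all others.\<close>
  have eq: "avgs (map ?x us) (on_cone f D) = avgs (map ?x (xs @ ys)) ?g"
    unfolding xy by (simp add: avgs_avg)
  have g0: "?g v = 0" if v: "rep D v u > of_nat (K u) * c u" for v
  proof -
    \<comment> \<open>Outside the span \<open>rep\<close> has the default value 0, which the lower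
      bound on the u-coefficient excludes.\<close>
    have span: "v \<in> vs.span D"
    proof (rule ccontr)
      assume "v \<notin> vs.span D"
      then have "rep D v u = 0" by (rule rep_not_span)
      then show False using v c by (simp add: mult_less_0_iff)
    qed
    \<comment> \<open>The points looked at differ from v in the u-coefficient only, and this stays
      positive: all of them lie in the cone or none does.\<close>
    have "v - smul (of_nat j) (smul (c u) u) \<in> rat_cone D \<longleftrightarrow> v \<in> rat_cone D" if j: "j < K u" for j
    proof -
      note sh = rep_shift[OF D(2) uD span, of "of_nat j * c u"]
      have "(of_nat j :: rat) * c u \<le> of_nat (K u) * c u"
        using j c by (intro mult_right_mono) simp_all
      then have "rep D v u - of_nat j * c u > 0"
        using v by linarith
      moreover have "rep D v u > 0"
        using v c by (smt (verit) mult_nonneg_nonneg of_nat_0_le_iff order_less_le_trans less_imp_le not_less order_trans)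
      ultimately have "rep D (v - smul (of_nat j * c u) u) u' > 0 \<longleftrightarrow> rep D v u' > 0" for u'
        by (cases "u' = u") (simp_all add: sh(2))
      then show ?thesis
        using sh(1) span by (simp add: rat_cone_def)
    qed
    then have "?g v = (if v \<in> rat_cone D then avg (smul (c u) u) (K u) f v else 0)"
      unfolding avg_def on_cone_def by (auto intro!: sum.cong sum.neutral)
    then show ?thesis using avg by simp
  qed
  have gen: "avgs (map ?x zs) ?g v = 0" if "rep D v u > of_nat (K u) * c u" "set zs \<subseteq> D" "u \<notin> set zs" for zs v
    using that
  proof (induction zs arbitrary: v)
    case (Cons z zs)
    have z: "z \<in> D" "z \<noteq> u" using Cons.prems by auto
    have "rep D (v - smul (of_nat j) (smul (c z) z)) u > of_nat (K u) * c u" for j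
    proof -
      have "v \<in> vs.span D"
      proof (rule ccontr)
        assume "v \<notin> vs.span D"
        then have "rep D v u = 0" by (rule rep_not_span)
        then show False using Cons.prems(1) c by (simp add: mult_less_0_iff)
      qed
      from rep_shift(2)[OF D(2) z(1) this, of "of_nat j * c z" u] show ?thesis
        using Cons.prems(1) z(2) by simp
    qed
    then have "avgs (map ?x zs) ?g (v - smul (of_nat j) (smul (c z) z)) = 0" for j
      using Cons.IH Cons.prems by simp
    then show ?case
      unfolding list.map avgs_simps avg_def[of "smul (c z) z" "K z" "avgs (map ?x zs) ?g"] by simp
  qed (simp add: g0)
  show ?thesis
    unfolding eq by (rule gen[OF v]) (use us xy in auto)
qed

text \<open>Averages keep the support inside the cone, which is closed under adding positive
  multiples of its generators, and bound each coefficient by K u times c u. Within a common lattice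
  this leaves finitely many points, so \<open>represents_measure\<close> applies.\<close>

lemma open_cone_measure:
  assumes D: "finite D" "vs.independent D"
    and cK: "\<And>u. u \<in> D \<Longrightarrow> c u > 0 \<and> smul (c u) u \<in> LQ \<and> smul (c u) u \<noteq> 0 \<and> coprime (K u) p"
    and avg: "\<And>u v. u \<in> D \<Longrightarrow> avg (smul (c u) u) (K u) f v = 0"
    and f: "n > 0" "\<And>v. f v \<noteq> 0 \<Longrightarrow> v \<in> LQ \<inter> Lat n"
  shows "\<exists>\<mu>\<in>carrier M. represents (on_cone f D) (of_measure B p \<mu>)"
proof -
  obtain us where us: "set us = D" "distinct us"
    using finite_distinct_list[OF D(1)] by blast
  let ?xs = "map (\<lambda>u. (smul (c u) u, K u)) us"
  have "finite ((\<lambda>(u, b). crd (smul (c u) u) b) ` (D \<times> B))"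
    using D(1) finite_B by simp
  \<comment> \<open>The averages translate by the vectors c u u, which need not lie in (1/n) L; m
    refines the lattice so that it contains them.\<close>
  then obtain m :: nat where m: "m > 0" "\<And>x. x \<in> (\<lambda>(u, b). crd (smul (c u) u) b) ` (D \<times> B) \<Longrightarrow> of_nat m * x \<in> \<int>"
    by (rule common_denominator) blast
  have wL: "smul (c u) u \<in> Lat (n * m)" if "u \<in> D" for u
    unfolding Lat_def
  proof (intro CollectI ballI)
    fix b assume "b \<in> B"
    then have "of_nat m * crd (smul (c u) u) b \<in> \<int>"
      using that by (intro m(2)) force
    from Ints_mult[OF Ints_of_nat[of n] this]
    show "of_nat (n * m) * crd (smul (c u) u) b \<in> \<int>"
      by (simp add: mult.assoc)
  qed
  have fL: "v \<in> Lat (n * m)" if "v \<in> Lat n" for v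
    unfolding Lat_def
  proof (intro CollectI ballI)
    fix b assume "b \<in> B"
    then have "of_nat n * crd v b \<in> \<int>"
      using that by (simp add: Lat_def)
    from Ints_mult[OF Ints_of_nat[of m] this]
    show "of_nat (n * m) * crd v b \<in> \<int>"
      by (simp add: mult_ac)
  qed
  have cone_add: "v + smul (c u) u \<in> rat_cone D" if "v \<in> rat_cone D" "u \<in> D" for u v
  proof -
    have v: "v \<in> vs.span D" "\<forall>u\<in>D. rep D v u > 0"
      using that(1) by (simp_all add: rat_cone_def)
    have "v + smul (c u) u = v - smul (- c u) u"
      by simp
    then show ?thesis
      using rep_shift[OF D(2) that(2) v(1), of "- c u"] v(2) cK[OF that(2)] by (auto simp: rat_cone_def add_pos_pos)
  qed
  let ?S = "LQ \<inter> Lat (n * m) \<inter> rat_cone D"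
  have sub: "supp (avgs ?xs (on_cone f D)) \<subseteq> ?S"
  proof (rule supp_avgs)
    show "supp (on_cone f D) \<subseteq> ?S"
      using f(2) fL by (auto simp: supp_def on_cone_def)
    show "v + w \<in> ?S" if "(w, K) \<in> set ?xs" "v \<in> ?S" for v w K
      using that us(1) cK wL cone_add by (auto intro: LQ_add Lat_add)
  qed
  have "rep D v u \<le> of_nat (K u) * c u" if "v \<in> supp (avgs ?xs (on_cone f D))" "u \<in> D" for v u
  proof (rule ccontr)
    assume "\<not> ?thesis"
    then have "avgs ?xs (on_cone f D) v = 0"
      using us cK avg that(2) by (intro avgs_on_cone_eq_0[OF D]) auto
    then show False
      using that(1) by (simp add: supp_def)
  qed
  then have "supp (avgs ?xs (on_cone f D)) \<subseteq> Lat (n * m) \<inter> {v \<in> rat_cone D. \<forall>u\<in>D. rep D v u \<le> of_nat (K u) * c u}"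
    using sub by blast
  then have "supported (avgs ?xs (on_cone f D))"
    unfolding supported_def using sub finite_subset[OF _ finite_Lat_parallelepiped[OF _ D]] f(1) m(1) by simp
  then show ?thesis
    using cK us(1) by (intro represents_measure[of ?xs]) auto
qed

end

section \<open>Gluing the open cones\<close>

context lattice_space
begin

text \<open>The cones are disjoint, so their indicators add up to that of the union. The right-hand
  side involves C alone, whence independence of the decomposition.\<close>

lemma decomposition_sum:
  assumes "cone_decomposition smul B \<D> C"
  shows "(\<lambda>v. \<Sum>D\<in>\<D>. on_cone f D v) = (\<lambda>v. if real_vec v \<in> C then f v else 0)"
proof
  fix v
  have fin: "finite \<D>" and D: "\<And>D. D \<in> \<D> \<Longrightarrow> finite D \<and> vs.independent D"
    and C: "C = (\<Union>D\<in>\<D>. open_cone smul B D)"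
    and dis: "pairwise (\<lambda>D D'. disjnt (open_cone smul B D) (open_cone smul B D')) \<D>"
    using assms by (simp_all add: cone_decomposition_def cone_union_def)
  have iff: "v \<in> rat_cone D \<longleftrightarrow> real_vec v \<in> open_cone smul B D" if "D \<in> \<D>" for D
    using open_cone_iff D[OF that] by blast
  show "(\<Sum>D\<in>\<D>. on_cone f D v) = (if real_vec v \<in> C then f v else 0)"
  proof (cases "real_vec v \<in> C")
    case True
    then obtain D0 where D0: "D0 \<in> \<D>" "real_vec v \<in> open_cone smul B D0"
      using C by blast
    have "real_vec v \<notin> open_cone smul B D" if "D \<in> \<D>" "D \<noteq> D0" for D
      using dis D0 that unfolding pairwise_def disjnt_def by blast
    then have "(\<Sum>D\<in>\<D>. on_cone f D v) = (\<Sum>D\<in>{D0}. on_cone f D v)"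
      using fin D0(1) iff by (intro sum.mono_neutral_right) (auto simp: on_cone_def)
    then show ?thesis
      using True D0 iff[OF D0(1)] by (simp add: on_cone_def)
  next
    case False
    then have "on_cone f D v = 0" if "D \<in> \<D>" for D
      using that iff[OF that] C by (auto simp: on_cone_def)
    then show ?thesis using False by simp
  qed
qed

text \<open>Denominators are bounded by N away from p, and at p the factor [L_p] forces
  integrality.\<close>

lemma test_support:
  assumes "f' \<in> schwartz B (primes_away p)"
  obtains n where "n > 0" "\<And>v. test f' v \<noteq> 0 \<Longrightarrow> v \<in> LQ \<inter> Lat n"
proof -
  obtain N where N: "N > 0" and
    support: "\<And>v q b. away f' v \<noteq> 0 \<Longrightarrow> prime q \<Longrightarrow> q \<noteq> p \<Longrightarrow> b \<in> B \<Longrightarrow> padic_abs q (of_nat N * crd v b) \<le> 1"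
    using away_schwartz[OF assms] by metis
  have "v \<in> LQ \<inter> Lat N" if "test f' v \<noteq> 0" for v
  proof -
    have v: "v \<in> LQ" "away f' v \<noteq> 0"
      using that by (auto simp: test_eq split: if_splits)
    have "of_nat N * crd v b \<in> \<int>" if b: "b \<in> B" for b
    proof (rule rat_integral)
      fix q :: nat assume q: "prime q"
      show "padic_abs q (of_nat N * crd v b) \<le> 1"
      proof (cases "q = p")
        case True
        have "padic_abs p (crd v b) \<le> 1"
          using v(1) b by (simp add: LQ_def emb_L_iff)
        then show ?thesis
          using True padic_abs_int_le_1[of "int N"] padic_abs_nonneg by (simp add: padic_abs_mult[OF p] mult_le_one)
      next
        case False
        then show ?thesis using support[OF v(2) q False b] by simp
      qed
    qed
    then show ?thesis using v(1) by (simp add: Lat_def)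
  qed
  with N that show ?thesis by blast
qed

lemma of_measure_finsum:
  assumes "finite A" "\<And>a. a \<in> A \<Longrightarrow> \<mu> a \<in> carrier M"
  shows "(\<Oplus>\<^bsub>PM.Loc\<^esub>a\<in>A. of_measure B p (\<mu> a)) = of_measure B p (\<Oplus>\<^bsub>M\<^esub>a\<in>A. \<mu> a)"
  using assms
proof (induction A)
  case empty
  then show ?case by (simp add: of_measure_fract PM.Loc_zero)
next
  case (insert a A)
  have "(\<Oplus>\<^bsub>PM.Loc\<^esub>a\<in>insert a A. of_measure B p (\<mu> a)) = of_measure B p (\<mu> a) \<oplus>\<^bsub>PM.Loc\<^esub> (\<Oplus>\<^bsub>PM.Loc\<^esub>a\<in>A. of_measure B p (\<mu> a))"
    using insert by (intro PM.LocA.finsum_insert) (auto simp: of_measure_fract PM.one_S intro!: PM.frac_closed)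
  also have "\<dots> = of_measure B p (\<mu> a \<oplus>\<^bsub>M\<^esub> (\<Oplus>\<^bsub>M\<^esub>a\<in>A. \<mu> a))"
  proof -
    have "(\<Oplus>\<^bsub>M\<^esub>a\<in>A. \<mu> a) \<in> carrier M"
      using insert.prems by (intro M.finsum_closed) auto
    then show ?thesis
      using insert unfolding of_measure_fract by (simp add: PM.frac_add_same PM.one_S)
  qed
  also have "\<mu> a \<oplus>\<^bsub>M\<^esub> (\<Oplus>\<^bsub>M\<^esub>a\<in>A. \<mu> a) = (\<Oplus>\<^bsub>M\<^esub>a\<in>insert a A. \<mu> a)"
    using insert by (intro M.finsum_insert[symmetric]) auto
  finally show ?case .
qed

lemma represents_candidate:
  assumes f': "f' \<in> schwartz B (primes_away p)"
    and \<D>: "cone_decomposition smul B \<D> C"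
    and adm: "\<forall>D\<in>\<D>. admissible_scaling smul B p (test f') D (a D)"
  shows "represents (\<lambda>v. if real_vec v \<in> C then test f' v else 0)
    (\<Oplus>\<^bsub>PM.Loc\<^esub>D\<in>\<D>. open_cone_pseudo_measure smul B p (test f') D (a D))"
proof -
  obtain n where n: "n > 0" "\<And>v. test f' v \<noteq> 0 \<Longrightarrow> v \<in> LQ \<inter> Lat n"
    using test_support[OF f'] by blast
  have fin: "finite \<D>" and D: "\<And>D. D \<in> \<D> \<Longrightarrow> finite D \<and> vs.independent D"
    using \<D> by (simp_all add: cone_decomposition_def cone_union_def)
  have rep: "represents (on_cone (test f') D) (open_cone_pseudo_measure smul B p (test f') D (a D))" if "D \<in> \<D>" for D
    using D[OF that] adm that n by (intro open_cone_represents) auto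
  have "represents (\<lambda>v. \<Sum>D\<in>\<D>. on_cone (test f') D v)
      (\<Oplus>\<^bsub>PM.Loc\<^esub>D\<in>\<D>. open_cone_pseudo_measure smul B p (test f') D (a D))"
    by (rule represents_sum[OF fin rep])
  then show ?thesis
    unfolding decomposition_sum[OF \<D>] .
qed

text \<open>All candidates represent the test function cut off by C, so uniqueness resolves the
  definite description as soon as one candidate is given.\<close>

lemma pseudo_measure_eqI:
  assumes f': "f' \<in> schwartz B (primes_away p)"
    and \<D>: "cone_decomposition smul B \<D> C"
    and adm: "\<forall>D\<in>\<D>. admissible_scaling smul B p (test f') D (a D)"
  shows "pseudo_measure smul B p f' C L =
    (\<Oplus>\<^bsub>PM.Loc\<^esub>D\<in>\<D>. open_cone_pseudo_measure smul B p (test f') D (a D))"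
  unfolding pseudo_measure_def Let_def pseudo_measure_ring_def
proof (rule the_equality)
  show "\<exists>\<D>' a'. cone_decomposition smul B \<D>' C \<and> (\<forall>D\<in>\<D>'. admissible_scaling smul B p (test f') D (a' D)) \<and>
      (\<Oplus>\<^bsub>PM.Loc\<^esub>D\<in>\<D>. open_cone_pseudo_measure smul B p (test f') D (a D)) =
      (\<Oplus>\<^bsub>PM.Loc\<^esub>D\<in>\<D>'. open_cone_pseudo_measure smul B p (test f') D (a' D))"
    using \<D> adm by blast
next
  fix \<Lambda> assume "\<exists>\<D>' a'. cone_decomposition smul B \<D>' C \<and> (\<forall>D\<in>\<D>'. admissible_scaling smul B p (test f') D (a' D)) \<and>
      \<Lambda> = (\<Oplus>\<^bsub>PM.Loc\<^esub>D\<in>\<D>'. open_cone_pseudo_measure smul B p (test f') D (a' D))"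
  then obtain \<D>' a' where "cone_decomposition smul B \<D>' C" "\<forall>D\<in>\<D>'. admissible_scaling smul B p (test f') D (a' D)"
      "\<Lambda> = (\<Oplus>\<^bsub>PM.Loc\<^esub>D\<in>\<D>'. open_cone_pseudo_measure smul B p (test f') D (a' D))"
    by blast
  then show "\<Lambda> = (\<Oplus>\<^bsub>PM.Loc\<^esub>D\<in>\<D>. open_cone_pseudo_measure smul B p (test f') D (a D))"
    using represents_unique[OF represents_candidate[OF f'] represents_candidate[OF f' \<D> adm]] by simp
qed

text \<open>Each open cone is treated separately: its pseudo-measure and the measure from
  \<open>open_cone_measure\<close> represent the same function and hence agree.\<close>

lemma pseudo_measure_is_measure:
  assumes f': "f' \<in> schwartz B (primes_away p)"
    and \<D>: "cone_decomposition smul B \<D> C" "\<And>D. D \<in> \<D> \<Longrightarrow> D \<subseteq> E"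
    and van: "\<And>w. w \<in> E \<Longrightarrow> vanishing_hypothesis smul B p f' w"
  shows "pseudo_measure smul B p f' C L \<in> of_measure B p ` carrier M"
proof -
  obtain n where n: "n > 0" "\<And>v. test f' v \<noteq> 0 \<Longrightarrow> v \<in> LQ \<inter> Lat n"
    using test_support[OF f'] by blast
  have fin: "finite \<D>" and D: "\<And>D. D \<in> \<D> \<Longrightarrow> finite D \<and> vs.independent D"
    using \<D>(1) by (simp_all add: cone_decomposition_def cone_union_def)
  have "\<exists>c K. u \<in> E \<longrightarrow> c > 0 \<and> smul c u \<in> LQ \<and> smul c u \<noteq> 0 \<and> (K :: nat) > 0 \<and> coprime K p \<and>
      (\<forall>v. avg (smul c u) K (test f') v = 0) \<and> (\<forall>v. test f' (v + smul (of_nat K) (smul c u)) = test f' v)" for u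
  proof (cases "u \<in> E")
    case True
    show ?thesis
      by (rule vanishing_avg[OF f' van[OF True]]) blast
  qed blast
  then obtain c and K :: "'v \<Rightarrow> nat" where cK: "\<And>u. u \<in> E \<Longrightarrow> c u > 0 \<and> smul (c u) u \<in> LQ \<and> smul (c u) u \<noteq> 0 \<and> K u > 0 \<and> coprime (K u) p \<and>
      (\<forall>v. avg (smul (c u) u) (K u) (test f') v = 0) \<and> (\<forall>v. test f' (v + smul (of_nat (K u)) (smul (c u) u)) = test f' v)"
    by metis
  \<comment> \<open>K u steps by the vector c u u are a period of the test function, so this scaling
    is admissible and provides a candidate for the definite description.\<close>
  define a where "a u = of_nat (K u) * c u" for u
  have adm: "admissible_scaling smul B p (test f') D a" if "D \<in> \<D>" for D
    unfolding admissible_scaling_def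
  proof
    fix u assume "u \<in> D"
    then have u: "u \<in> E" using \<D>(2)[OF that] by blast
    have "smul (a u) u = smul (of_nat (K u)) (smul (c u) u)"
      by (simp add: a_def)
    then show "a u > 0 \<and> emb (smul (a u) u) \<in> L \<and> (\<forall>v. test f' (v + smul (a u) u) = test f' v)"
      using cK[OF u] LQ_nmul[of "smul (c u) u" "K u"] by (simp add: a_def LQ_def)
  qed
  have "\<exists>\<mu>\<in>carrier M. open_cone_pseudo_measure smul B p (test f') D a = of_measure B p \<mu>" if "D \<in> \<D>" for D
  proof -
    have DE: "u \<in> E" if "u \<in> D" for u
      using \<D>(2)[OF \<open>D \<in> \<D>\<close>] that by blast
    have "\<exists>\<mu>\<in>carrier M. represents (on_cone (test f') D) (of_measure B p \<mu>)"
      using D[OF that] cK[OF DE] n by (intro open_cone_measure[of D c K]) auto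
    moreover have "represents (on_cone (test f') D) (open_cone_pseudo_measure smul B p (test f') D a)"
      using D[OF that] adm[OF that] n by (intro open_cone_represents) auto
    ultimately show ?thesis
      using represents_unique by blast
  qed
  then obtain \<mu> where \<mu>: "\<And>D. D \<in> \<D> \<Longrightarrow> \<mu> D \<in> carrier M"
    "\<And>D. D \<in> \<D> \<Longrightarrow> open_cone_pseudo_measure smul B p (test f') D a = of_measure B p (\<mu> D)"
    by metis
  have "pseudo_measure smul B p f' C L = (\<Oplus>\<^bsub>PM.Loc\<^esub>D\<in>\<D>. open_cone_pseudo_measure smul B p (test f') D a)"
    using pseudo_measure_eqI[OF f' \<D>(1), of "\<lambda>_. a"] adm by blast
  also have "\<dots> = (\<Oplus>\<^bsub>PM.Loc\<^esub>D\<in>\<D>. of_measure B p (\<mu> D))"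
    using \<mu> by (intro PM.LocA.finsum_cong') (auto simp: of_measure_fract PM.one_S intro!: PM.frac_closed)
  also have "\<dots> = of_measure B p (\<Oplus>\<^bsub>M\<^esub>D\<in>\<D>. \<mu> D)"
    by (rule of_measure_finsum[of \<D> \<mu>, OF fin \<mu>(1)])
  finally show ?thesis
    using \<mu>(1) by (intro image_eqI) (auto intro!: M.finsum_closed)
qed

end

theorem theorem4p15:
  fixes smul :: "rat \<Rightarrow> 'v::ab_group_add \<Rightarrow> 'v"
    and L B E :: "'v set"
    and p :: nat
    and f' :: "'v adele \<Rightarrow> int"
    and C :: "('v \<Rightarrow> real) set"
  assumes "lattice_basis smul L B"
    and "prime p"
    and "f' \<in> schwartz B (primes_away p)"
    and "rational_simplicial_cone smul B C"
    and "pointed_cone B C"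
    and "has_extremal_rays smul B C E"
    and "\<forall>w\<in>E. vanishing_hypothesis smul B p f' w"
  shows "pseudo_measure smul B p f' C (L_at B p) \<in> of_measure B p ` carrier (measure_ring B p)"
proof -
  interpret lattice_space p smul B
    using assms(1,2) by (intro lattice_space.intro padic.intro) (simp_all add: lattice_basis_def)
  obtain \<D> where "cone_decomposition smul B \<D> C" "\<forall>D\<in>\<D>. D \<subseteq> E"
    using assms(6) unfolding has_extremal_rays_def by blast
  then show ?thesis
    using assms(7) by (intro pseudo_measure_is_measure[OF assms(3), of \<D> C E]) auto
qed

end
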